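(* (i) Each of the lattices $\mathscr{PL}$, $\Delta_{1/2}\mathscr{PL}$, $\mathscr{SPL}$ and $\mathscr{S_\infty PL}$ is upper dense in $\mathscr L$ (i.e., if $\mathscr L'$ denotes any one of them, then for all $I\in\mathscr L'$ and $J\in\mathscr L$ with $I\subsetneq J$ there is $L\in\mathscr L'$ with $I\subsetneq L\subsetneq J$), but every ideal in each of these lattices has a lower gap in $\mathscr L$. (ii) None of the lattices $\mathscr{PL}$, $\Delta_{1/2}\mathscr{PL}$, $\mathscr{SPL}$ and $\mathscr{S_\infty PL}$ has gaps.
   Context: $H$ is a separable infinite-dimensional complex Hilbert space. "Ideal" means a two-sided ideal of $B(H)$ contained in the compact operators. $\mathscr L$ is the lattice of all nonzero ideals, ordered by inclusion (meet $\cap$, join $+$). $c_o^*$ is the set of nonnegative monotone nonincreasing sequences converging to $0$, and $(\ell^1)^*$ the set of summable sequences in $c_o^*$. $\Sigma(I):=\{s(X)\mid X\in I\}\subset c_o^*$, where $s(X)$ is the sequence of s-numbers (singular values) of $X$; an ideal is determined by $\Sigma(I)$. For $\xi\in c_o^*$, $(\xi)$ is the principal ideal generated by $\mathrm{diag}\,\xi$; every principal ideal has this form, and $\eta\in\Sigma((\xi))$ iff $\eta=O(D_m\xi)$ for some $m\in\mathbb N$, where $(D_m\xi)_n:=\xi_{\lceil n/m\rceil}$. $\mathscr{PL}$: all nonzero principal ideals. $\Delta_{1/2}\mathscr{PL}$: all nonzero principal ideals having a generator $\xi\in c_o^*$ with $D_2\xi=O(\xi)$ (the $\Delta_{1/2}$-condition).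 $\mathscr{SPL}$: all nonzero am-stable principal ideals, where $I$ is am-stable if $I={}_aI$, with $\Sigma({}_aI)=\{\xi\in c_o^*\mid \xi_a\in\Sigma(I)\}$ and $(\xi_a)_n:=\frac1n\sum_{j=1}^n\xi_j$; $(\xi)$ is am-stable iff $\xi_a=O(\xi)$. $\mathscr{S_\infty PL}$: all nonzero am-$\infty$ stable principal ideals, where $I$ is am-$\infty$ stable if $I={}_{a_\infty}I$, with $\Sigma({}_{a_\infty}I)=\{\xi\in(\ell^1)^*\mid\xi_{a_\infty}\in\Sigma(I)\}$ and $(\xi_{a_\infty})_n:=\frac1n\sum_{j=n+1}^\infty\xi_j$; $(\xi)$ is am-$\infty$ stable iff $\xi$ is summable and $\xi_{a_\infty}=O(\xi)$. A gap in a lattice of ideals is a pair $I\subsetneq J$ of (nonzero) ideals in the lattice such that there is no ideal of the lattice strictly between $I$ and $J$. A lower gap for an ideal $I$ in $\mathscr L$ is a pair $J\subsetneq I$ with no ideal of $\mathscr L$ strictly between $J$ and $I$; here $J$ is an ideal in $\mathscr L$ or, by convention, $J=\{0\}$ is also allowed. *)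

theory Defs
  imports "HOL-Analysis.Analysis" "HOL-Algebra.Ideal"
begin

section \<open>Complex Hilbert spaces\<close>

text \<open>
  The underlying real Hilbert space structure is inherited, so that norm, topology and bounded
  linear maps are those of the library; the complex inner product is linear in its first argument,
  and its real part is the inherited real inner product.
\<close>

class chilbert_space = real_inner + complete_space +
  fixes cscale :: "complex \<Rightarrow> 'a \<Rightarrow> 'a"
    and cinner :: "'a \<Rightarrow> 'a \<Rightarrow> complex"
  assumes cscale_add_right: "cscale c (x + y) = cscale c x + cscale c y"
    and cscale_add_left: "cscale (c + d) x = cscale c x + cscale d x"
    and cscale_cscale: "cscale c (cscale d x) = cscale (c * d) x"
    and cscale_of_real: "cscale (of_real r) x = scaleR r x"
    and cinner_commute: "cinner x y = cnj (cinner y x)"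
    and cinner_add_left: "cinner (x + y) z = cinner x z + cinner y z"
    and cinner_cscale_left: "cinner (cscale c x) y = c * cinner x y"
    and Re_cinner: "Re (cinner x y) = inner x y"

global_interpretation complex_vector: vector_space "cscale :: complex \<Rightarrow> 'a \<Rightarrow> 'a::chilbert_space"
proof
  show "cscale 1 x = x" for x :: 'a
    using cscale_of_real[of 1 x] by simp
qed (simp_all add: cscale_add_right cscale_add_left cscale_cscale)

definition orthonormal_basis :: "(nat \<Rightarrow> 'a::chilbert_space) \<Rightarrow> bool" where
  "orthonormal_basis e \<longleftrightarrow>
     (\<forall>i j. cinner (e i) (e j) = (if i = j then 1 else 0)) \<and>
     closure (complex_vector.span (range e)) = UNIV"


section \<open>Bounded operators and singular values\<close>

text \<open>
  The type of bounded linear maps only provides real linearity, so complex linearity has to be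
  imposed on the carrier of \<open>B(H)\<close>.
\<close>

definition BH :: "('a::chilbert_space \<Rightarrow>\<^sub>L 'a) ring" where
  "BH = \<lparr>carrier = {T. \<forall>c x. blinfun_apply T (cscale c x) = cscale c (blinfun_apply T x)},
         mult = (o\<^sub>L), one = id_blinfun, zero = 0, add = (+)\<rparr>"

definition compact_ops :: "('a::chilbert_space \<Rightarrow>\<^sub>L 'a) set" where
  "compact_ops = {T \<in> carrier BH. compact (closure (blinfun_apply T ` cball 0 1))}"

definition hilbert_adjoint :: "('a::chilbert_space \<Rightarrow>\<^sub>L 'a) \<Rightarrow> ('a \<Rightarrow>\<^sub>L 'a)" where
  "hilbert_adjoint T =
     (THE S. \<forall>x y. cinner (blinfun_apply T x) y = cinner x (blinfun_apply S y))"

text \<open>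
  All sequences are indexed from 0, so \<open>\<xi> n\<close> stands for what is usually written \<open>\<xi>\<^sub>n\<^sub>+\<^sub>1\<close>.
\<close>

definition c0_star :: "(nat \<Rightarrow> real) set" where
  "c0_star = {\<xi>. (\<forall>n. 0 \<le> \<xi> n) \<and> antimono \<xi> \<and> \<xi> \<longlonglongrightarrow> 0}"

definition l1_star :: "(nat \<Rightarrow> real) set" where
  "l1_star = {\<xi> \<in> c0_star. summable \<xi>}"

text \<open>
  The singular values of a compact operator \<open>T\<close> are the square roots of the eigenvalues of
  \<open>T\<^sup>* T\<close>, arranged in decreasing order and repeated according to multiplicity: every \<open>t > 0\<close>
  occurs exactly as often as the dimension of the eigenspace for \<open>t\<^sup>2\<close>. As usual, the value 0
  serves only as padding when \<open>T\<close> has finite rank. A sequence in \<open>c\<^sub>o\<^sup>*\<close> is determined by the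
  multiplicities of its positive values.
\<close>

definition singular_values :: "('a::chilbert_space \<Rightarrow>\<^sub>L 'a) \<Rightarrow> nat \<Rightarrow> real" where
  "singular_values T =
     (THE \<xi>. \<xi> \<in> c0_star \<and>
        (\<forall>t>0. card {n. \<xi> n = t} =
           complex_vector.dim
             {x. blinfun_apply (hilbert_adjoint T o\<^sub>L T) x = cscale (of_real (t\<^sup>2)) x}))"


section \<open>Operator ideals\<close>

definition ideals :: "('a::chilbert_space \<Rightarrow>\<^sub>L 'a) set set" where
  "ideals = {I. ideal I BH \<and> I \<subseteq> compact_ops \<and> I \<noteq> {0}}"

definition char_set :: "('a::chilbert_space \<Rightarrow>\<^sub>L 'a) set \<Rightarrow> (nat \<Rightarrow> real) set" where
  "char_set I = singular_values ` I"

text \<open>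
  The ideal with a given characteristic set; an ideal consists of exactly those compact operators
  whose singular values lie in its characteristic set.
\<close>

definition ideal_of_char_set :: "(nat \<Rightarrow> real) set \<Rightarrow> ('a::chilbert_space \<Rightarrow>\<^sub>L 'a) set" where
  "ideal_of_char_set S = {T \<in> compact_ops. singular_values T \<in> S}"

text \<open>
  The choice of the orthonormal basis is immaterial for the generated ideal, since two diagonal
  operators with the same diagonal are unitarily equivalent.
\<close>

definition is_diag :: "(nat \<Rightarrow> real) \<Rightarrow> ('a::chilbert_space \<Rightarrow>\<^sub>L 'a) \<Rightarrow> bool" where
  "is_diag \<xi> T \<longleftrightarrow> T \<in> carrier BH \<and>
     (\<exists>e. orthonormal_basis e \<and> (\<forall>n. blinfun_apply T (e n) = cscale (of_real (\<xi> n)) (e n)))"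

definition is_generator :: "(nat \<Rightarrow> real) \<Rightarrow> ('a::chilbert_space \<Rightarrow>\<^sub>L 'a) set \<Rightarrow> bool" where
  "is_generator \<xi> I \<longleftrightarrow> \<xi> \<in> c0_star \<and> (\<exists>T. is_diag \<xi> T \<and> I = genideal BH {T})"

text \<open>With 0-based indices, \<open>\<lceil>(n + 1) / m\<rceil> - 1 = n div m\<close>.\<close>

definition ampliation :: "nat \<Rightarrow> (nat \<Rightarrow> real) \<Rightarrow> nat \<Rightarrow> real" where
  "ampliation m \<xi> n = \<xi> (n div m)"

definition arith_mean :: "(nat \<Rightarrow> real) \<Rightarrow> nat \<Rightarrow> real" where
  "arith_mean \<xi> n = (\<Sum>j\<le>n. \<xi> j) / real (n + 1)"

definition arith_mean_inf :: "(nat \<Rightarrow> real) \<Rightarrow> nat \<Rightarrow> real" where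
  "arith_mean_inf \<xi> n = (\<Sum>j. \<xi> (j + (n + 1))) / real (n + 1)"

text \<open>
  The bound is required at every index, not just eventually as in the library's Landau symbols.
  The two notions differ for sequences that are eventually zero: these do not satisfy
  the \<open>\<Delta>\<^sub>1\<^sub>/\<^sub>2\<close>-condition.
\<close>

definition dominated :: "(nat \<Rightarrow> real) \<Rightarrow> (nat \<Rightarrow> real) \<Rightarrow> bool" where
  "dominated \<eta> \<xi> \<longleftrightarrow> (\<exists>M. \<forall>n. \<eta> n \<le> M * \<xi> n)"

definition pre_am :: "('a::chilbert_space \<Rightarrow>\<^sub>L 'a) set \<Rightarrow> ('a \<Rightarrow>\<^sub>L 'a) set" where
  "pre_am I = ideal_of_char_set {\<xi> \<in> c0_star. arith_mean \<xi> \<in> char_set I}"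

definition pre_am_inf :: "('a::chilbert_space \<Rightarrow>\<^sub>L 'a) set \<Rightarrow> ('a \<Rightarrow>\<^sub>L 'a) set" where
  "pre_am_inf I = ideal_of_char_set {\<xi> \<in> l1_star. arith_mean_inf \<xi> \<in> char_set I}"

definition PL :: "('a::chilbert_space \<Rightarrow>\<^sub>L 'a) set set" where
  "PL = {I \<in> ideals. principalideal I BH}"

definition Delta_half_PL :: "('a::chilbert_space \<Rightarrow>\<^sub>L 'a) set set" where
  "Delta_half_PL = {I \<in> PL. \<exists>\<xi>. is_generator \<xi> I \<and> dominated (ampliation 2 \<xi>) \<xi>}"

definition SPL :: "('a::chilbert_space \<Rightarrow>\<^sub>L 'a) set set" where
  "SPL = {I \<in> PL. I = pre_am I}"

definition S_inf_PL :: "('a::chilbert_space \<Rightarrow>\<^sub>L 'a) set set" where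
  "S_inf_PL = {I \<in> PL. I = pre_am_inf I}"


section \<open>Density and gaps\<close>

definition upper_dense :: "'b set set \<Rightarrow> 'b set set \<Rightarrow> bool" where
  "upper_dense L' L \<longleftrightarrow> (\<forall>I\<in>L'. \<forall>J\<in>L. I \<subset> J \<longrightarrow> (\<exists>K\<in>L'. I \<subset> K \<and> K \<subset> J))"

definition is_gap :: "'b set set \<Rightarrow> 'b set \<Rightarrow> 'b set \<Rightarrow> bool" where
  "is_gap L I J \<longleftrightarrow> I \<in> L \<and> J \<in> L \<and> I \<subset> J \<and> \<not> (\<exists>K\<in>L. I \<subset> K \<and> K \<subset> J)"

definition has_lower_gap :: "('a::chilbert_space \<Rightarrow>\<^sub>L 'a) set \<Rightarrow> bool" where
  "has_lower_gap I \<longleftrightarrow>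
     (\<exists>J. (J \<in> ideals \<or> J = {0}) \<and> J \<subset> I \<and> \<not> (\<exists>K\<in>ideals. J \<subset> K \<and> K \<subset> I))"

end

theory Submission
  imports Defs
begin

text \<open>
  An ideal of compact operators generated by \<open>T\<close> consists of the compact operators whose singular
  values are dominated by an ampliation of those of \<open>T\<close>. This turns the density statements into
  statements on sequences: if \<open>\<rho> \<ge> \<xi>\<close> is not dominated by an ampliation of \<open>\<xi>\<close>, a sequence
  \<open>\<sigma>\<close> strictly between the two is obtained from \<open>\<xi>\<close> by lifting it to \<open>\<rho>\<close> at very sparse
  points. For the other three lattices \<open>\<sigma>\<close> is then decreased to its largest minorant \<open>\<tau>\<close> with a
  prescribed bound for the ratios \<open>\<tau>\<^sub>2\<^sub>n / \<tau>\<^sub>n\<close>; the bound is slightly weaker than the one that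
  membership in the lattice gives for \<open>\<xi>\<close>, so that \<open>\<tau>\<close> stays strictly above \<open>\<xi>\<close>. A lower gap
  comes from an ideal that is maximal among the ideals inside \<open>(T)\<close> not containing \<open>T\<close>.
\<close>

section \<open>Sequences and ampliations\<close>

text \<open>Lifting at sparse points leaves the smaller lattices, while lowering \<sigma> again may
  bring it back to the level of \<xi>. The way out is that all three conditions are open conditions
  on ratios under doubling of the 1-based index. The \<Delta>-condition asks for some bound B on
  \<tau>_n / \<tau>_2n; am-stability of (\<xi>) yields such a bound with B < 2, up to a constant in
  the iterated form, and B < 2 gives am-stability back; am-\<infinity> stability corresponds in the
  same way to \<tau>_2n / \<tau>_n \<le> B < 1/2. So the bound B0 of \<xi> may be relaxed to an
  admissible B > B0. In the regularisation the term j doublings or halvings away is at least a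
  multiple of (B / B0)^j times \<xi>. This beats every constant for large j, and the finitely many
  other j are settled at a point where \<sigma> is huge compared with \<xi>. If ratios are bounded
  below, an ampliation costs only a constant; in the am-\<infinity> case this fails and ampliations
  have to be carried through the estimates.\<close>

definition amp_le :: "(nat \<Rightarrow> real) \<Rightarrow> (nat \<Rightarrow> real) \<Rightarrow> bool" where
  "amp_le \<xi> \<eta> \<longleftrightarrow> (\<exists>m>0. dominated \<xi> (ampliation m \<eta>))"

lemma c0_starD:
  assumes "\<xi> \<in> c0_star"
  shows "0 \<le> \<xi> n" and "m \<le> n \<Longrightarrow> \<xi> n \<le> \<xi> m" and "\<xi> \<longlonglongrightarrow> 0"
  using assms by (auto simp: c0_star_def antimono_def)

lemma c0_starI:
  assumes "\<And>n. 0 \<le> \<xi> n" "\<And>m n. m \<le> n \<Longrightarrow> \<xi> n \<le> \<xi> m" "\<xi> \<longlonglongrightarrow> 0"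
  shows "\<xi> \<in> c0_star"
  using assms by (auto simp: c0_star_def antimono_def)

lemma amp_leI: "0 < m \<Longrightarrow> (\<And>n. \<xi> n \<le> M * \<eta> (n div m)) \<Longrightarrow> amp_le \<xi> \<eta>"
  by (auto simp: amp_le_def dominated_def ampliation_def)

lemma amp_le_of_le: "(\<And>n. \<xi> n \<le> M * \<eta> n) \<Longrightarrow> amp_le \<xi> \<eta>"
  by (rule amp_leI[of 1]) auto

lemma amp_le_refl: "amp_le \<xi> \<xi>"
  by (rule amp_le_of_le[of _ 1]) simp

text \<open>Since \<eta> is nonnegative the constant may be enlarged to M \<ge> 1, which lets later
  estimates multiply by M without sign cases.\<close>

lemma amp_leE:
  assumes "amp_le \<xi> \<eta>" and "\<And>n. 0 \<le> \<eta> n"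
  obtains m M where "0 < m" "1 \<le> M" "\<And>n. \<xi> n \<le> M * \<eta> (n div m)"
proof -
  obtain m M where m: "0 < m" and M: "\<And>n. \<xi> n \<le> M * \<eta> (n div m)"
    using assms(1) by (auto simp: amp_le_def dominated_def ampliation_def)
  have "\<xi> n \<le> max 1 M * \<eta> (n div m)" for n
    using M[of n] mult_right_mono[of M "max 1 M" "\<eta> (n div m)"] assms(2) by fastforce
  with m show thesis by (intro that[of m "max 1 M"]) auto
qed

text \<open>Floor divisions compose, so the ampliations by m and k combine to the ampliation by m *
  k.\<close>

lemma amp_le_trans:
  assumes "amp_le \<xi> \<eta>" "amp_le \<eta> \<zeta>" "\<eta> \<in> c0_star" "\<zeta> \<in> c0_star"
  shows "amp_le \<xi> \<zeta>"
proof -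
  obtain m M where m: "0 < m" "1 \<le> M" "\<And>n. \<xi> n \<le> M * \<eta> (n div m)"
    using amp_leE[OF assms(1) c0_starD(1)[OF assms(3)]] by blast
  obtain k K where k: "0 < k" "1 \<le> K" "\<And>n. \<eta> n \<le> K * \<zeta> (n div k)"
    using amp_leE[OF assms(2) c0_starD(1)[OF assms(4)]] by blast
  have "\<xi> n \<le> (M * K) * \<zeta> (n div (m * k))" for n
    using order_trans[OF m(3)[of n] mult_left_mono[OF k(3)[of "n div m"], of M]] m(2)
    by (simp add: div_mult2_eq mult.assoc)
  with m(1) k(1) show ?thesis by (intro amp_leI[of "m * k"]) auto
qed

text \<open>Since n div m tends to infinity, an ampliation of a null sequence is a null sequence.
  This is how the regularisations and both kinds of means are placed in
  \<open>c0_star\<close>.\<close>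

lemma amp_le_c0_star:
  assumes "\<And>n. 0 \<le> \<eta> n" "\<And>m n. m \<le> n \<Longrightarrow> \<eta> n \<le> \<eta> m" "amp_le \<eta> \<tau>" "\<tau> \<in> c0_star"
  shows "\<eta> \<in> c0_star"
proof (rule c0_starI)
  obtain m M where m: "0 < m" "1 \<le> M" "\<And>n. \<eta> n \<le> M * \<tau> (n div m)"
    using amp_leE[OF assms(3)] c0_starD(1)[OF assms(4)] by blast
  have "filterlim (\<lambda>n. n div m) at_top sequentially"
    using m(1)
    by (metis filterlim_at_top_div_const_nat)
  then have "(\<lambda>n. M * \<tau> (n div m)) \<longlonglongrightarrow> M * 0"
    by (intro tendsto_mult tendsto_const filterlim_compose[OF c0_starD(3)[OF assms(4)]])
  then show "\<eta> \<longlonglongrightarrow> 0"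
    using m(3) assms(1) by (intro real_tendsto_sandwich[of "\<lambda>_. 0" \<eta> _ "\<lambda>n. M * \<tau> (n div m)"]) auto
qed (use assms in auto)

text \<open>A sequence that vanishes from n on lies below an ampliation of every nonzero sequence:
  with ratio n + 1 all its nonzero entries are compared with \<xi> 0.\<close>

lemma not_amp_le_pos:
  assumes "\<xi> \<in> c0_star" "\<rho> \<in> c0_star" "0 < \<xi> 0" "\<not> amp_le \<rho> \<xi>"
  shows "0 < \<rho> n"
proof (rule ccontr)
  assume "\<not> 0 < \<rho> n"
  then have z: "\<rho> p \<le> 0" if "n \<le> p" for p
    using c0_starD(2)[OF assms(2) that] by auto
  have "\<rho> p \<le> \<rho> 0 / \<xi> 0 * \<xi> (p div Suc n)" for p
  proof (cases "n \<le> p")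
    case True
    then show ?thesis
      using z[OF True] c0_starD(1)[OF assms(1)] c0_starD(1)[OF assms(2), of 0] assms(3)
      by (smt (verit) divide_nonneg_pos mult_nonneg_nonneg)
  next
    case False
    then have "p div Suc n = 0" by simp
    then show ?thesis using c0_starD(2)[OF assms(2), of 0 p] assms(3) by simp
  qed
  then have "amp_le \<rho> \<xi>" by (rule amp_leI[OF zero_less_Suc])
  with assms(4) show False by simp
qed

text \<open>Domination cannot fail at finitely many indices only, because these could be absorbed by
  a larger constant. That argument divides by \<xi> (N + 1); if this is 0, the supposed inequality
  makes \<rho> vanish far out, against positivity.\<close>

lemma not_amp_le_far:
  assumes "\<xi> \<in> c0_star" "\<rho> \<in> c0_star" "0 < \<xi> 0" "\<not> amp_le \<rho> \<xi>" "0 < k"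
  shows "\<exists>p. N < p div k \<and> real k * \<xi> (p div k) < \<rho> p"
proof (rule ccontr)
  assume "\<not> ?thesis"
  then have le: "\<rho> p \<le> real k * \<xi> (p div k)" if "N < p div k" for p
    using that by force
  show False
  proof (cases "0 < \<xi> (Suc N)")
    case True
    define M where "M = max (real k) (\<rho> 0 / \<xi> (Suc N))"
    have "\<rho> p \<le> M * \<xi> (p div k)" for p
    proof (cases "N < p div k")
      case True
      have "real k * \<xi> (p div k) \<le> M * \<xi> (p div k)"
        using c0_starD(1)[OF assms(1)] by (intro mult_right_mono) (auto simp: M_def)
      with le[OF True] show ?thesis by linarith
    next
      case False
      have "\<rho> p \<le> \<rho> 0" using c0_starD(2)[OF assms(2)] by simp
      also have "\<dots> = \<rho> 0 / \<xi> (Suc N) * \<xi> (Suc N)" using True by simp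
      also have "\<dots> \<le> M * \<xi> (p div k)"
        using False True c0_starD(1)[OF assms(2), of 0] c0_starD(2)[OF assms(1), of "p div k" "Suc N"]
        by (intro mult_mono) (auto simp: M_def le_max_iff_disj)
      finally show ?thesis .
    qed
    with assms(4,5) show False using amp_leI[of k \<rho> M \<xi>] by blast
  next
    case False
    have "\<rho> p \<le> 0" if "N < p div k" for p
    proof -
      have "\<xi> (p div k) \<le> \<xi> (Suc N)" using that by (intro c0_starD(2)[OF assms(1)]) simp
      then have "real k * \<xi> (p div k) \<le> 0" using False by (simp add: mult_nonneg_nonpos)
      with le[OF that] show ?thesis by linarith
    qed
    from this[of "Suc N * k"] have "\<rho> (Suc N * k) \<le> 0" using assms(5) by auto
    with not_amp_le_pos[OF assms(1-4), of "Suc N * k"] show False by simp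
  qed
qed

text \<open>
  \<open>\<sigma>\<close> is the maximum of \<open>\<xi>\<close> and a step function that touches \<open>\<rho>\<close> at the points \<open>q k\<close>, which are so
  sparse that between two of them there is a point at which \<open>\<rho>\<close> is large compared with \<open>\<sigma>\<close>.
\<close>

lemma strictly_between_sequence:
  assumes "\<xi> \<in> c0_star" "\<rho> \<in> c0_star" "0 < \<xi> 0" "\<And>n. \<xi> n \<le> \<rho> n" "\<not> amp_le \<rho> \<xi>"
  obtains \<sigma> where "\<sigma> \<in> c0_star" "\<And>n. \<xi> n \<le> \<sigma> n" "\<And>n. \<sigma> n \<le> \<rho> n"
    "\<not> amp_le \<sigma> \<xi>" "\<not> amp_le \<rho> \<sigma>"
proof -
  \<comment> \<open>Here a and b are consecutive points of q. The inequality at b will keep \<sigma>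
    from being dominated by \<xi> with ratio and constant k + 1; the witness p, still past a after
    division by k + 1, will do the same for \<rho> against \<sigma>.\<close>
  define Q where "Q = (\<lambda>k a b. a < b \<and> real (Suc k) * \<xi> (b div Suc k) < \<rho> b \<and>
    (\<exists>p. a < p div Suc k \<and> real (Suc k) * \<xi> (p div Suc k) < \<rho> p \<and> real (Suc k) * \<rho> b < \<rho> p))"
  have "\<exists>q. \<forall>k. Q k (q k) (q (Suc k))"
  proof (rule dependent_nat_choice[of "\<lambda>_ _. True", simplified])
    fix a k :: nat
    \<comment> \<open>The witness p comes first; b is then taken so far out that \<rho> b is
      negligible against \<rho> p.\<close>
    obtain p where p: "a < p div Suc k" "real (Suc k) * \<xi> (p div Suc k) < \<rho> p"
      using not_amp_le_far[OF assms(1,2,3,5)] by blast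
    have "(\<lambda>n. real (Suc k) * \<rho> n) \<longlonglongrightarrow> real (Suc k) * 0"
      by (intro tendsto_intros c0_starD(3)[OF assms(2)])
    then have "eventually (\<lambda>n. real (Suc k) * \<rho> n < \<rho> p) sequentially"
      using not_amp_le_pos[OF assms(1,2,3,5), of p] by (intro order_tendstoD(2)[of _ 0]) auto
    then obtain N where N: "\<And>n. N \<le> n \<Longrightarrow> real (Suc k) * \<rho> n < \<rho> p"
      unfolding eventually_sequentially by blast
    obtain b where b: "max a N < b div Suc k" "real (Suc k) * \<xi> (b div Suc k) < \<rho> b"
      using not_amp_le_far[OF assms(1,2,3,5)] by blast
    have "b div Suc k \<le> b" by simp
    then show "\<exists>b. Q k a b" unfolding Q_def
      using p N[of b] b by (intro exI[of _ b] conjI exI[of _ p]) linarith+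
  qed
  then obtain q where q: "\<And>k. Q k (q k) (q (Suc k))" by blast
  have sm: "strict_mono q" using q by (auto simp: strict_mono_Suc_iff Q_def)
  \<comment> \<open>The first point of q at or after n has number l n, so \<rho> (q (l n)) is a step
    function that lies below \<rho> and meets it at the points of q.\<close>
  define l where "l = (\<lambda>n. LEAST k. n \<le> q k)"
  have l: "n \<le> q (l n)" for n
    unfolding l_def by (rule LeastI[of "\<lambda>k. n \<le> q k" n]) (rule strict_mono_imp_increasing[OF sm])
  have l_le: "l n \<le> k" if "n \<le> q k" for n k
    unfolding l_def by (rule Least_le) (rule that)
  define \<sigma> where "\<sigma> = (\<lambda>n. max (\<xi> n) (\<rho> (q (l n))))"
  have ge: "\<xi> n \<le> \<sigma> n" and le: "\<sigma> n \<le> \<rho> n" for n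
    using assms(4)[of n] c0_starD(2)[OF assms(2) l[of n]] by (auto simp: \<sigma>_def)
  have \<sigma>: "\<sigma> \<in> c0_star"
  proof (rule amp_le_c0_star[of _ \<rho>])
    show "0 \<le> \<sigma> n" for n using ge[of n] c0_starD(1)[OF assms(1), of n] by linarith
    show "amp_le \<sigma> \<rho>" using le by (intro amp_le_of_le[of _ 1]) auto
    fix m n :: nat assume mn: "m \<le> n"
    have "l m \<le> l n" by (rule l_le) (use l[of n] mn in linarith)
    then have "q (l m) \<le> q (l n)" using sm by (simp add: strict_mono_less_eq)
    then show "\<sigma> n \<le> \<sigma> m"
      using c0_starD(2)[OF assms(1) mn] c0_starD(2)[OF assms(2), of "q (l m)" "q (l n)"]
      by (auto simp: \<sigma>_def)
  qed (rule assms)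
  show thesis
  proof (rule that[OF \<sigma> ge le])
    show "\<not> amp_le \<sigma> \<xi>"
    proof
      assume "amp_le \<sigma> \<xi>"
      then obtain m M where m: "0 < m" "1 \<le> M" "\<And>n. \<sigma> n \<le> M * \<xi> (n div m)"
        using amp_leE c0_starD(1)[OF assms(1)] by blast
      \<comment> \<open>A single number k + 1 exceeds both the ratio m and the constant M, matching
        the form in which q was built.\<close>
      obtain k where k: "m + nat \<lceil>M\<rceil> = Suc k" using m(1) by (cases "m + nat \<lceil>M\<rceil>") auto
      let ?b = "q (Suc k)"
      have Mk: "M \<le> real (Suc k)" "m \<le> Suc k" using k[symmetric] real_nat_ceiling_ge[of M] by auto
      have "\<rho> ?b \<le> \<rho> (q (l ?b))"
        by (rule c0_starD(2)[OF assms(2)]) (simp add: strict_mono_less_eq[OF sm] l_le)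
      also have "\<dots> \<le> M * \<xi> (?b div m)" using m(3)[of ?b] by (simp add: \<sigma>_def)
      also have "\<dots> \<le> real (Suc k) * \<xi> (?b div Suc k)"
        using Mk m(1) c0_starD(1)[OF assms(1)]
        by (intro mult_mono c0_starD(2)[OF assms(1)] div_le_mono2) auto
      finally show False using q[of k] by (auto simp: Q_def)
    qed
    show "\<not> amp_le \<rho> \<sigma>"
    proof
      assume "amp_le \<rho> \<sigma>"
      then obtain m M where m: "0 < m" "1 \<le> M" "\<And>n. \<rho> n \<le> M * \<sigma> (n div m)"
        using amp_leE c0_starD(1)[OF \<sigma>] by blast
      obtain k where k: "m + nat \<lceil>M\<rceil> = Suc k" using m(1) by (cases "m + nat \<lceil>M\<rceil>") auto
      have Mk: "M \<le> real (Suc k)" "m \<le> Suc k" using k[symmetric] real_nat_ceiling_ge[of M] by auto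
      obtain p where p: "q k < p div Suc k" "real (Suc k) * \<xi> (p div Suc k) < \<rho> p"
        "real (Suc k) * \<rho> (q (Suc k)) < \<rho> p"
        using q[of k] by (auto simp: Q_def)
      \<comment> \<open>Past q k the step function has already dropped to at most \<rho> (q (k +
        1)), so both components of \<sigma> at p div (k + 1) are small against \<rho> p.\<close>
      have "q k < q (l (p div Suc k))" using l[of "p div Suc k"] p(1) by linarith
      then have "q (Suc k) \<le> q (l (p div Suc k))"
        by (simp add: strict_mono_less[OF sm] strict_mono_less_eq[OF sm])
      then have *: "\<rho> (q (l (p div Suc k))) \<le> \<rho> (q (Suc k))" by (rule c0_starD(2)[OF assms(2)])
      have "\<rho> p \<le> M * \<sigma> (p div m)" by (rule m(3))
      also have "\<dots> \<le> real (Suc k) * \<sigma> (p div Suc k)"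
        using Mk m(1) c0_starD(1)[OF \<sigma>]
        by (intro mult_mono c0_starD(2)[OF \<sigma>] div_le_mono2) auto
      also have "\<dots> \<le> max (real (Suc k) * \<xi> (p div Suc k)) (real (Suc k) * \<rho> (q (Suc k)))"
      proof -
        have "real (Suc k) * \<rho> (q (l (p div Suc k))) \<le> real (Suc k) * \<rho> (q (Suc k))"
          using * by (intro mult_left_mono) auto
        then show ?thesis unfolding \<sigma>_def max_def by auto
      qed
      finally show False using p by linarith
    qed
  qed
qed

section \<open>Sequences with controlled ratios under doubling of the index\<close>

lemma ampliation_power_le:
  fixes \<tau> :: "nat \<Rightarrow> real"
  assumes "\<And>n. \<tau> (n div 2) \<le> B * \<tau> n" "0 \<le> B"
  shows "\<tau> (n div 2 ^ j) \<le> B ^ j * \<tau> n"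
proof (induction j)
  case (Suc j)
  have "\<tau> (n div 2 ^ Suc j) = \<tau> (n div 2 ^ j div 2)" by (simp only: power_Suc2 div_mult2_eq)
  also have "\<dots> \<le> B * \<tau> (n div 2 ^ j)" by (rule assms)
  also have "\<dots> \<le> B * (B ^ j * \<tau> n)" using Suc assms(2) by (rule mult_left_mono)
  finally show ?case by simp
qed simp

lemma self_le_two_power: "m \<le> 2 ^ m" for m :: nat
  by (simp add: less_imp_le)

lemma regular_amp_le_imp:
  assumes \<tau>: "\<tau> \<in> c0_star" and reg: "\<And>j n. \<tau> (n div 2 ^ j) \<le> M * B ^ j * \<tau> n"
    and "amp_le \<eta> \<tau>"
  obtains L where "1 \<le> L" "\<And>n. \<eta> n \<le> L * \<tau> n"
proof -
  obtain m K where m: "0 < m" "1 \<le> K" "\<And>n. \<eta> n \<le> K * \<tau> (n div m)"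
    using amp_leE[OF assms(3)] c0_starD(1)[OF \<tau>] by blast
  let ?L = "max 1 (K * (M * B ^ m))"
  have "\<eta> n \<le> ?L * \<tau> n" for n
  proof -
    have "\<tau> (n div m) \<le> \<tau> (n div 2 ^ m)"
      using m(1) by (intro c0_starD(2)[OF \<tau>] div_le_mono2 self_le_two_power)
    also have "\<dots> \<le> M * B ^ m * \<tau> n" by (rule reg)
    finally have "K * \<tau> (n div m) \<le> K * (M * B ^ m * \<tau> n)" using m(2) by (intro mult_left_mono) auto
    also have "\<dots> \<le> ?L * \<tau> n"
      unfolding mult.assoc[symmetric] using c0_starD(1)[OF \<tau>] by (intro mult_right_mono) (auto simp: mult.assoc)
    finally show ?thesis using m(3)[of n] by linarith
  qed
  then show thesis by (intro that[of ?L]) auto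
qed

text \<open>
  The regularisation is the largest sequence below \<open>\<sigma>\<close> whose ratios under doubling of the
  (1-based) index are at least \<open>1/B\<close>.
\<close>

lemma regular_minorant:
  assumes \<xi>: "\<xi> \<in> c0_star" and \<sigma>: "\<sigma> \<in> c0_star" and pos: "0 < \<xi> 0" and le: "\<And>n. \<xi> n \<le> \<sigma> n"
    and nle: "\<not> amp_le \<sigma> \<xi>" and B: "1 \<le> B0" "B0 < B"
    and reg: "\<And>j n. \<xi> (n div 2 ^ j) \<le> M * B0 ^ j * \<xi> n"
  obtains \<tau> where "\<tau> \<in> c0_star" "\<And>n. \<tau> n \<le> \<sigma> n" "amp_le \<xi> \<tau>" "\<not> amp_le \<tau> \<xi>"
    "\<And>n. \<tau> (n div 2) \<le> B * \<tau> n"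
proof -
  \<comment> \<open>This is 2^j * (n + 1) - 1, the 1-based index multiplied by 2^j; it is the
    largest index that division by 2^j takes to n.\<close>
  define g :: "nat \<Rightarrow> nat \<Rightarrow> nat" where "g = (\<lambda>j n. 2 ^ j * n + (2 ^ j - 1))"
  have g_div: "g j n div 2 ^ j = n" for j n
    by (simp add: g_def del: diff_is_0_eq' One_nat_def add_diff_assoc)
  have g_mono: "g j m \<le> g j n" if "m \<le> n" for j m n unfolding g_def using that by (intro add_mono mult_le_mono2 order_refl)
  \<comment> \<open>It makes term j + 1 at n div 2 at most B times term j at n, which is the ratio
    bound for \<tau>.\<close>
  have g_Suc: "g j n \<le> g (Suc j) (n div 2)" for j n
  proof -
    have "n + 1 \<le> 2 * (n div 2) + 2" by presburger
    then have "2 ^ j * (n + 1) \<le> 2 ^ j * (2 * (n div 2) + 2)" by (rule mult_le_mono2)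
    moreover have "(1::nat) \<le> 2 ^ j" by simp
    ultimately show ?thesis by (simp add: g_def algebra_simps)
  qed
  have M: "1 \<le> M" using reg[of 0 0] pos by simp
  have \<xi>pos: "0 < \<xi> n" for n
  proof -
    have "\<xi> (n div 2 ^ n) \<le> M * B0 ^ n * \<xi> n" by (rule reg)
    moreover have "n div 2 ^ n = 0" by simp
    ultimately have "0 < M * B0 ^ n * \<xi> n" using pos by simp
    then show ?thesis using c0_starD(1)[OF \<xi>, of n] by (cases "\<xi> n = 0") auto
  qed
  define \<tau> where "\<tau> = (\<lambda>n. INF j. B ^ j * \<sigma> (g j n))"
  have bdd: "bdd_below (range (\<lambda>j. B ^ j * \<sigma> (g j n)))" for n
    using B c0_starD(1)[OF \<sigma>] by (intro bdd_belowI2[of _ 0]) auto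
  have lower: "\<tau> n \<le> B ^ j * \<sigma> (g j n)" for j n
    unfolding \<tau>_def by (rule cINF_lower[OF bdd]) simp
  have greatest: "c \<le> \<tau> n" if "\<And>j. c \<le> B ^ j * \<sigma> (g j n)" for c n
    unfolding \<tau>_def by (rule cINF_greatest) (use that in auto)
  have \<tau>_le: "\<tau> n \<le> \<sigma> n" for n using lower[of n 0] by (simp add: g_def)
  have \<tau>0: "\<tau> \<in> c0_star"
  proof (rule amp_le_c0_star[OF _ _ _ \<sigma>])
    show "0 \<le> \<tau> n" for n using B c0_starD(1)[OF \<sigma>] by (intro greatest) auto
    show "amp_le \<tau> \<sigma>" by (rule amp_le_of_le[of _ 1]) (use \<tau>_le in auto)
    show "\<tau> n \<le> \<tau> m" if "m \<le> n" for m n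
    proof (rule greatest)
      fix j
      have "\<tau> n \<le> B ^ j * \<sigma> (g j n)" by (rule lower)
      also have "\<dots> \<le> B ^ j * \<sigma> (g j m)"
        using B g_mono[OF that] by (intro mult_left_mono c0_starD(2)[OF \<sigma>]) auto
      finally show "\<tau> n \<le> B ^ j * \<sigma> (g j m)" .
    qed
  qed
  have step: "\<tau> (n div 2) \<le> B * \<tau> n" for n
  proof -
    have "\<tau> (n div 2) / B \<le> \<tau> n"
    proof (rule greatest)
      fix j
      have "\<tau> (n div 2) \<le> B ^ Suc j * \<sigma> (g (Suc j) (n div 2))" by (rule lower)
      also have "\<dots> \<le> B ^ Suc j * \<sigma> (g j n)"
        using B by (intro mult_left_mono c0_starD(2)[OF \<sigma>] g_Suc) auto
      finally show "\<tau> (n div 2) / B \<le> B ^ j * \<sigma> (g j n)" using B by (simp add: field_simps)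
    qed
    then show ?thesis using B by (simp add: field_simps)
  qed
  have \<xi>g: "\<xi> n \<le> M * B0 ^ j * \<xi> (g j n)" for j n using reg[of "g j n" j] by (simp add: g_div)
  have "amp_le \<xi> \<tau>"
  proof (rule amp_le_of_le[of _ M])
    fix n
    have "\<xi> n / M \<le> \<tau> n"
    proof (rule greatest)
      fix j
      have "\<xi> n \<le> M * B0 ^ j * \<xi> (g j n)" by (rule \<xi>g)
      also have "\<dots> \<le> M * B ^ j * \<sigma> (g j n)"
        using B M le c0_starD(1)[OF \<xi>] by (intro mult_mono power_mono) auto
      finally show "\<xi> n / M \<le> B ^ j * \<sigma> (g j n)" using M by (simp add: field_simps)
    qed
    then show "\<xi> n \<le> M * \<tau> n" using M by (simp add: field_simps)
  qed
  moreover have "\<not> amp_le \<tau> \<xi>"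
  proof
    assume "amp_le \<tau> \<xi>"
    then obtain L where L: "1 \<le> L" "\<And>n. \<tau> n \<le> L * \<xi> n"
      using regular_amp_le_imp[OF \<xi> reg] by blast
    \<comment> \<open>From j doublings on, the relaxed bound alone supplies the factor (L + 1) * M;
      for fewer doublings it has to come from the size of \<sigma>.\<close>
    obtain j where j: "(L + 1) * M < (B / B0) ^ j"
      using real_arch_pow[of "B / B0" "(L + 1) * M"] B by auto
    \<comment> \<open>The first entry beats (L + 1) * \<xi> q for fewer than j doublings. The second
      forces N \<ge> 2^j, hence q \<ge> 1 and g i q \<le> N for i < j.\<close>
    define K where "K = max ((L + 1) * M * B0 ^ j) (\<sigma> 0 / \<xi> (2 ^ j))"
    obtain N where N: "K * \<xi> N < \<sigma> N"
      using nle amp_le_of_le[of \<sigma> K \<xi>] by (meson not_less)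
    have N_ge: "2 ^ j \<le> N"
    proof (rule ccontr)
      assume "\<not> 2 ^ j \<le> N"
      then have "\<xi> (2 ^ j) \<le> \<xi> N" by (intro c0_starD(2)[OF \<xi>]) simp
      have "\<sigma> N \<le> \<sigma> 0" by (rule c0_starD(2)[OF \<sigma>]) simp
      also have "\<dots> = \<sigma> 0 / \<xi> (2 ^ j) * \<xi> (2 ^ j)" using \<xi>pos[of "2 ^ j"] by simp
      also have "\<dots> \<le> K * \<xi> N"
        using \<open>\<xi> (2 ^ j) \<le> \<xi> N\<close> \<xi>pos c0_starD(1)[OF \<sigma>, of 0]
        by (intro mult_mono) (auto simp: K_def le_max_iff_disj less_imp_le)
      finally show False using N by simp
    qed
    define q where "q = N div 2 ^ j"
    have "(L + 1) * \<xi> q \<le> \<tau> q"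
    proof (rule greatest)
      fix i
      show "(L + 1) * \<xi> q \<le> B ^ i * \<sigma> (g i q)"
      proof (cases "i < j")
        case True
        have "1 \<le> q" using N_ge by (simp add: q_def div_greater_zero_iff Suc_le_eq)
        have "(2::nat) ^ i * 2 \<le> 2 ^ j"
          using power_increasing[of "Suc i" j "2::nat"] True by simp
        have "2 ^ i * (q + 1) \<le> 2 ^ i * (2 * q)" using \<open>1 \<le> q\<close> by (intro mult_le_mono2) simp
        also have "\<dots> \<le> 2 ^ j * q"
          unfolding mult.assoc[symmetric] by (rule mult_le_mono1) fact
        also have "\<dots> \<le> N" by (simp add: q_def)
        finally have "g i q \<le> N" by (simp add: g_def)
        have "(L + 1) * \<xi> q \<le> (L + 1) * (M * B0 ^ j * \<xi> N)"
          unfolding q_def using L(1) by (intro mult_left_mono reg) auto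
        also have "\<dots> \<le> K * \<xi> N"
          unfolding mult.assoc[symmetric] using \<xi>pos[of N] by (intro mult_right_mono) (auto simp: K_def)
        also have "\<dots> \<le> \<sigma> N" using N by simp
        also have "\<dots> \<le> \<sigma> (g i q)" using \<open>g i q \<le> N\<close> by (rule c0_starD(2)[OF \<sigma>])
        also have "\<dots> \<le> B ^ i * \<sigma> (g i q)"
          using mult_right_mono[of 1 "B ^ i" "\<sigma> (g i q)"] B c0_starD(1)[OF \<sigma>, of "g i q"] by simp
        finally show ?thesis .
      next
        case False
        have "(L + 1) * M \<le> (B / B0) ^ i"
        proof -
          have "(B / B0) ^ j \<le> (B / B0) ^ i" using False B by (intro power_increasing) auto
          with j show ?thesis by linarith
        qed
        have "(L + 1) * \<xi> q \<le> (L + 1) * (M * B0 ^ i * \<xi> (g i q))"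
          using L(1) by (intro mult_left_mono \<xi>g) auto
        also have "\<dots> = ((L + 1) * M) * (B0 ^ i * \<xi> (g i q))" by simp
        also have "\<dots> \<le> (B / B0) ^ i * (B0 ^ i * \<xi> (g i q))"
          using \<open>(L + 1) * M \<le> (B / B0) ^ i\<close> B c0_starD(1)[OF \<xi>] by (intro mult_right_mono) auto
        also have "\<dots> = B ^ i * \<xi> (g i q)" using B by (simp add: power_divide)
        also have "\<dots> \<le> B ^ i * \<sigma> (g i q)" using B le by (intro mult_left_mono) auto
        finally show ?thesis .
      qed
    qed
    then show False using L(2)[of q] \<xi>pos[of q] by (simp add: algebra_simps)
  qed
  ultimately show thesis using that[OF \<tau>0 \<tau>_le _ _ step] by blast
qed

text \<open>
  Here the regularisation is the largest sequence below \<open>\<sigma>\<close> whose ratios under doubling of the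
  (1-based) index are at most \<open>B\<close>.
\<close>

lemma decaying_minorant:
  assumes \<xi>: "\<xi> \<in> c0_star" and \<sigma>: "\<sigma> \<in> c0_star" and pos: "0 < \<xi> 0" and le: "\<And>n. \<xi> n \<le> \<sigma> n"
    and nle: "\<not> amp_le \<sigma> \<xi>" and B: "0 < B0" "B0 < B" "B < 1"
    and dec: "\<And>j n. \<xi> (2 ^ j * (n + 1) - 1) \<le> M * B0 ^ j * \<xi> n"
  obtains \<tau> where "\<tau> \<in> c0_star" "\<And>n. \<tau> n \<le> \<sigma> n" "amp_le \<xi> \<tau>" "\<not> amp_le \<tau> \<xi>"
    "\<And>n. \<tau> (2 * n + 1) \<le> B * \<tau> n"
proof -
  have M: "1 \<le> M" using dec[of 0 0] pos by simp
  define J :: "nat \<Rightarrow> nat set" where "J = (\<lambda>n. {j. 2 ^ j \<le> n + 1})"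
  define g :: "nat \<Rightarrow> nat \<Rightarrow> nat" where "g = (\<lambda>j n. (n + 1) div 2 ^ j - 1)"
  have J_fin: "finite (J n)" for n
  proof (rule finite_subset)
    show "J n \<subseteq> {..n + 1}"
      using order_trans[OF self_le_two_power] unfolding J_def by blast
  qed simp
  have J0: "0 \<in> J n" for n by (simp add: J_def)
  have g_mono: "g j m \<le> g j n" if "m \<le> n" for j m n
    using that by (auto simp: g_def intro!: diff_le_mono div_le_mono)
  have g_Suc: "g j m + 1 = (m + 1) div 2 ^ j" if "j \<in> J m" for j m
    using that by (simp add: g_def J_def div_greater_zero_iff Suc_le_eq)
  define \<tau> where "\<tau> = (\<lambda>n. Min ((\<lambda>j. B ^ j * \<sigma> (g j n)) ` J n))"
  have lower: "\<tau> n \<le> B ^ j * \<sigma> (g j n)" if "j \<in> J n" for j n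
    unfolding \<tau>_def using that J_fin by (intro Min_le) auto
  have greatest: "c \<le> \<tau> n" if "\<And>j. j \<in> J n \<Longrightarrow> c \<le> B ^ j * \<sigma> (g j n)" for c n
    unfolding \<tau>_def using that J_fin J0[of n] by (subst Min_ge_iff) auto
  \<comment> \<open>Finiteness of J n lets strict inequalities pass to the minimum. Aiming at a
    factor L + 1 instead would give no contradiction where \<xi> vanishes.\<close>
  have strict: "c < \<tau> n" if "\<And>j. j \<in> J n \<Longrightarrow> c < B ^ j * \<sigma> (g j n)" for c n
    unfolding \<tau>_def using that J_fin J0[of n] by (subst Min_gr_iff) auto
  have \<tau>_le: "\<tau> n \<le> \<sigma> n" for n using lower[OF J0, of n] by (simp add: g_def)
  have \<tau>0: "\<tau> \<in> c0_star"
  proof (rule amp_le_c0_star[OF _ _ _ \<sigma>])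
    show "0 \<le> \<tau> n" for n using B c0_starD(1)[OF \<sigma>] by (intro greatest) auto
    show "amp_le \<tau> \<sigma>" by (rule amp_le_of_le[of _ 1]) (use \<tau>_le in auto)
    show "\<tau> n \<le> \<tau> m" if "m \<le> n" for m n
    proof (rule greatest)
      fix j assume "j \<in> J m"
      then have "j \<in> J n" using that by (auto simp: J_def)
      then have "\<tau> n \<le> B ^ j * \<sigma> (g j n)" by (rule lower)
      also have "\<dots> \<le> B ^ j * \<sigma> (g j m)"
        using B g_mono[OF that] by (intro mult_left_mono c0_starD(2)[OF \<sigma>]) auto
      finally show "\<tau> n \<le> B ^ j * \<sigma> (g j m)" .
    qed
  qed
  have step: "\<tau> (2 * n + 1) \<le> B * \<tau> n" for n
  proof -
    have "\<tau> (2 * n + 1) / B \<le> \<tau> n"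
    proof (rule greatest)
      fix j assume j: "j \<in> J n"
      then have "Suc j \<in> J (2 * n + 1)" by (simp add: J_def)
      then have "\<tau> (2 * n + 1) \<le> B ^ Suc j * \<sigma> (g (Suc j) (2 * n + 1))" by (rule lower)
      moreover have "g (Suc j) (2 * n + 1) = g j n"
        using div_mult_mult1[of 2 "n + 1" "2 ^ j"] by (simp add: g_def)
      ultimately show "\<tau> (2 * n + 1) / B \<le> B ^ j * \<sigma> (g j n)" using B by (simp add: field_simps)
    qed
    then show ?thesis using B by (simp add: field_simps)
  qed
  have \<xi>g: "\<xi> m \<le> M * B0 ^ j * \<xi> (g i n)" if "i \<in> J n" "2 ^ j * (g i n + 1) \<le> m + 1" for i j m n
  proof -
    have "\<xi> m \<le> \<xi> (2 ^ j * (g i n + 1) - 1)" using that by (intro c0_starD(2)[OF \<xi>]) simp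
    also have "\<dots> \<le> M * B0 ^ j * \<xi> (g i n)" by (rule dec)
    finally show ?thesis .
  qed
  have "amp_le \<xi> \<tau>"
  proof (rule amp_le_of_le[of _ M])
    fix n
    have "\<xi> n / M \<le> \<tau> n"
    proof (rule greatest)
      fix j assume j: "j \<in> J n"
      have "\<xi> n \<le> M * B0 ^ j * \<xi> (g j n)"
        by (rule \<xi>g[OF j]) (simp only: g_Suc[OF j] times_div_less_eq_dividend)
      also have "\<dots> \<le> M * B ^ j * \<sigma> (g j n)"
        using B M le c0_starD(1)[OF \<xi>] by (intro mult_mono power_mono) auto
      finally show "\<xi> n / M \<le> B ^ j * \<sigma> (g j n)" using M by (simp add: field_simps)
    qed
    then show "\<xi> n \<le> M * \<tau> n" using M by (simp add: field_simps)
  qed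
  moreover have "\<not> amp_le \<tau> \<xi>"
  proof
    assume "amp_le \<tau> \<xi>"
    then obtain l L where l: "0 < l" "1 \<le> L" "\<And>n. \<tau> n \<le> L * \<xi> (n div l)"
      using amp_leE c0_starD(1)[OF \<xi>] by blast
    \<comment> \<open>The ampliation, enlarged to ratio 2^l, uses up l of the i halvings; the
      division by B0^l compensates for them, and the shift by l in i0 makes l \<le> i.\<close>
    obtain i' where i': "L * M / B0 ^ l < (B / B0) ^ i'"
      using real_arch_pow[of "B / B0" "L * M / B0 ^ l"] B by auto
    define i0 where "i0 = i' + l"
    have i0: "L * M / B0 ^ l < (B / B0) ^ i" if "i0 \<le> i" for i
    proof -
      have "(B / B0) ^ i' \<le> (B / B0) ^ i"
        using that B by (intro power_increasing) (auto simp: i0_def)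
      with i' show ?thesis by linarith
    qed
    \<comment> \<open>It is at least 2^l, so that n div k \<le> n div 2^l, and so large that it
      outweighs the loss B^i0 caused by fewer than i0 halvings.\<close>
    define k where "k = 2 ^ l + nat \<lceil>L / B ^ i0\<rceil>"
    have k: "2 ^ l \<le> k" "0 < k" "L \<le> B ^ i0 * real k"
    proof -
      show "2 ^ l \<le> k" "0 < k" by (auto simp: k_def)
      have "L / B ^ i0 \<le> real k" using real_nat_ceiling_ge[of "L / B ^ i0"]
        by (simp add: k_def add_increasing)
      then show "L \<le> B ^ i0 * real k" using B by (simp add: field_simps)
    qed
    obtain n where n: "real k * \<xi> (n div k) < \<sigma> n"
      using not_amp_le_far[OF \<xi> \<sigma> pos nle k(2)] by blast
    have "L * \<xi> (n div 2 ^ l) < \<tau> n"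
    proof (rule strict)
      fix i assume i: "i \<in> J n"
      show "L * \<xi> (n div 2 ^ l) < B ^ i * \<sigma> (g i n)"
      proof (cases "i < i0")
        case True
        have "g i n \<le> n"
          using div_le_dividend[of "n + 1" "2 ^ i"] by (simp add: g_def del: div_le_dividend)
        have "L * \<xi> (n div 2 ^ l) \<le> (B ^ i0 * real k) * \<xi> (n div k)"
          using k l(2) B c0_starD(1)[OF \<xi>] by (intro mult_mono c0_starD(2)[OF \<xi>] div_le_mono2) auto
        also have "\<dots> < B ^ i0 * \<sigma> n" using n B by (simp add: mult.assoc)
        also have "\<dots> \<le> B ^ i * \<sigma> (g i n)"
          using True B c0_starD(1)[OF \<sigma>] \<open>g i n \<le> n\<close>
          by (intro mult_mono c0_starD(2)[OF \<sigma>] power_decreasing) auto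
        finally show ?thesis .
      next
        case False
        then have il: "i = (i - l) + l" "l \<le> i" by (auto simp: i0_def)
        have "2 ^ i * (g i n + 1) \<le> n + 1" by (simp only: g_Suc[OF i] times_div_less_eq_dividend)
        then have "2 ^ l * (2 ^ (i - l) * (g i n + 1)) \<le> n + 1"
          by (subst (asm) il(1)) (simp only: power_add mult_ac)
        then have "2 ^ (i - l) * (g i n + 1) \<le> (n + 1) div 2 ^ l"
          by (simp add: less_eq_div_iff_mult_less_eq mult.commute)
        also have "\<dots> \<le> n div 2 ^ l + 1"
          using div_le_mono[of "n + 1" "n + 2 ^ l" "2 ^ l"] by simp
        finally have a: "\<xi> (n div 2 ^ l) \<le> M * B0 ^ (i - l) * \<xi> (g i n)" by (intro \<xi>g[OF i])
        show ?thesis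
        proof (cases "\<xi> (n div 2 ^ l) = 0")
          case True
          then show ?thesis using not_amp_le_pos[OF \<xi> \<sigma> pos nle, of "g i n"] B by simp
        next
          case nz: False
          then have "0 < \<xi> (g i n)"
            using a c0_starD(1)[OF \<xi>, of "g i n"] c0_starD(1)[OF \<xi>, of "n div 2 ^ l"]
            by (cases "\<xi> (g i n) = 0") auto
          have "L * \<xi> (n div 2 ^ l) \<le> L * (M * B0 ^ (i - l) * \<xi> (g i n))"
            using a l(2) by (intro mult_left_mono) auto
          also have "\<dots> = (L * M / B0 ^ l) * (B0 ^ i * \<xi> (g i n))"
            using B il by (simp add: power_diff)
          also have "\<dots> < (B / B0) ^ i * (B0 ^ i * \<xi> (g i n))"
            using i0[of i] False B \<open>0 < \<xi> (g i n)\<close> by (intro mult_strict_right_mono) auto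
          also have "\<dots> = B ^ i * \<xi> (g i n)" using B by (simp add: power_divide)
          also have "\<dots> \<le> B ^ i * \<sigma> (g i n)" using B le by (intro mult_left_mono) auto
          finally show ?thesis .
        qed
      qed
    qed
    moreover have "L * \<xi> (n div l) \<le> L * \<xi> (n div 2 ^ l)"
      using l by (intro mult_left_mono c0_starD(2)[OF \<xi>] div_le_mono2 self_le_two_power) auto
    ultimately show False using l(3)[of n] by linarith
  qed
  ultimately show thesis using that[OF \<tau>0 \<tau>_le _ _ step] by blast
qed

section \<open>Arithmetic means and ratios below 2\<close>

lemma arith_mean_antimono:
  assumes "\<xi> \<in> c0_star" "m \<le> n"
  shows "arith_mean \<xi> n \<le> arith_mean \<xi> m"
proof -
  have "arith_mean \<xi> (Suc k) \<le> arith_mean \<xi> k" for k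
  proof -
    have "real (k + 1) * \<xi> (Suc k) = (\<Sum>j\<le>k. \<xi> (Suc k))" by simp
    also have "\<dots> \<le> (\<Sum>j\<le>k. \<xi> j)" by (intro sum_mono c0_starD(2)[OF assms(1)]) simp
    finally show ?thesis by (simp add: arith_mean_def field_simps)
  qed
  then show ?thesis using assms(2) by (rule lift_Suc_antimono_le)
qed

lemma arith_mean_nonneg: "\<xi> \<in> c0_star \<Longrightarrow> 0 \<le> arith_mean \<xi> n"
  by (simp add: arith_mean_def sum_nonneg c0_starD(1))

lemma le_arith_mean:
  assumes "\<xi> \<in> c0_star"
  shows "\<xi> n \<le> arith_mean \<xi> n"
proof -
  have "real (n + 1) * \<xi> n = (\<Sum>j\<le>n. \<xi> n)" by simp
  also have "\<dots> \<le> (\<Sum>j\<le>n. \<xi> j)" by (intro sum_mono c0_starD(2)[OF assms(1)]) simp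
  finally show ?thesis by (simp add: arith_mean_def field_simps)
qed

lemma arith_mean_eq: "real (n + 1) * arith_mean \<xi> n = (\<Sum>i<n + 1. \<xi> i)"
  by (simp add: arith_mean_def lessThan_Suc_atMost)

text \<open>Partial sums only grow up to the last index k with k div m = n, and k + 1 = m * (n + 1);
  hence removing the ampliation costs the factor m.\<close>

lemma arith_mean_bound_of_amp_le:
  assumes \<xi>: "\<xi> \<in> c0_star" and "amp_le (arith_mean \<xi>) \<xi>"
  obtains C where "1 \<le> C" "\<And>n. arith_mean \<xi> n \<le> C * \<xi> n"
proof -
  obtain m M where m: "0 < m" "1 \<le> M" "\<And>n. arith_mean \<xi> n \<le> M * \<xi> (n div m)"
    using amp_leE[OF assms(2)] c0_starD(1)[OF \<xi>] by blast
  have "arith_mean \<xi> n \<le> (real m * M) * \<xi> n" for n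
  proof -
    define k where "k = m * n + (m - 1)"
    have "k div m = n" using m(1) by (simp add: k_def del: add_diff_assoc)
    moreover have "k + 1 = m * (n + 1)" using m(1) by (simp add: k_def)
    moreover have "n \<le> k" using m(1) unfolding k_def by (cases m) auto
    ultimately have k: "k div m = n" "k + 1 = m * (n + 1)" "n \<le> k" by blast+
    have "real (n + 1) * arith_mean \<xi> n \<le> real (k + 1) * arith_mean \<xi> k"
      unfolding arith_mean_eq using k(3) c0_starD(1)[OF \<xi>] by (intro sum_mono2) auto
    also have "\<dots> \<le> real (k + 1) * (M * \<xi> n)" using m(3)[of k] k(1) by (intro mult_left_mono) auto
    also have "\<dots> = real (n + 1) * (real m * M * \<xi> n)" unfolding k(2) by (simp only: of_nat_mult mult_ac)
    finally show ?thesis by (rule mult_left_le_imp_le) simp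
  qed
  moreover have "1 \<le> real m * M" using mult_mono[of 1 "real m" 1 M] m by simp
  ultimately show thesis using that by blast
qed

text \<open>Doubling the range adds a fixed proportion to the partial sums: S (2 * N) - S N \<ge> N
  * \<xi> (2 * N - 1) \<ge> S (2 * N) / (2 * C). So S N \<le> a * S (2 * N) with a = 1 - 1 / (2 * C)
  < 1; after j doublings a mean is compared with a range 2^j times as long, which gives B = 2 * a <
  2.\<close>

lemma arith_mean_bound_imp_regular:
  assumes \<xi>: "\<xi> \<in> c0_star" and C: "1 \<le> C" and le: "\<And>n. arith_mean \<xi> n \<le> C * \<xi> n"
  obtains B where "1 \<le> B" "B < 2" "\<And>j n. \<xi> (n div 2 ^ j) \<le> C * B ^ j * \<xi> n"
proof -
  define S where "S = (\<lambda>N. \<Sum>i<N. \<xi> i)"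
  define a where "a = 1 - 1 / (2 * C)"
  have a: "1 / 2 \<le> a" "a < 1" using C by (auto simp: a_def field_simps)
  have S_le: "S (n + 1) \<le> C * real (n + 1) * \<xi> n" for n
    using mult_left_mono[OF le[of n], of "real (n + 1)"] unfolding arith_mean_eq S_def by (simp add: mult_ac)
  have dbl: "S N \<le> a * S (2 * N)" if "0 < N" for N
  proof -
    have "S (2 * N) = S N + (\<Sum>i\<in>{N..<2 * N}. \<xi> i)"
      unfolding S_def lessThan_atLeast0 by (rule sum.atLeastLessThan_concat[symmetric]) auto
    moreover have "(\<Sum>i\<in>{N..<2 * N}. \<xi> (2 * N - 1)) \<le> (\<Sum>i\<in>{N..<2 * N}. \<xi> i)"
      by (intro sum_mono c0_starD(2)[OF \<xi>]) auto
    moreover have "S (2 * N) \<le> C * real (2 * N) * \<xi> (2 * N - 1)"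
      using S_le[of "2 * N - 1"] that by simp
    ultimately have "S (2 * N) = S N + (\<Sum>i\<in>{N..<2 * N}. \<xi> i)"
      "real N * \<xi> (2 * N - 1) \<le> (\<Sum>i\<in>{N..<2 * N}. \<xi> i)"
      "S (2 * N) \<le> (2 * C) * (real N * \<xi> (2 * N - 1))"
      by auto
    moreover from this(2) have "(2 * C) * (real N * \<xi> (2 * N - 1)) \<le> (2 * C) * (\<Sum>i\<in>{N..<2 * N}. \<xi> i)"
      by (rule mult_left_mono) (use C in simp)
    ultimately have "S (2 * N) \<le> (2 * C) * (S (2 * N) - S N)" by simp
    then show ?thesis using C by (simp add: a_def field_simps)
  qed
  have pow: "S N \<le> a ^ j * S (2 ^ j * N)" if "0 < N" for N j
  proof (induction j)
    case (Suc j)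
    have "a ^ j * S (2 ^ j * N) \<le> a ^ j * (a * S (2 * (2 ^ j * N)))"
      using dbl[of "2 ^ j * N"] that a by (intro mult_left_mono) auto
    with Suc show ?case by (simp add: mult_ac)
  qed simp
  have "\<xi> (n div 2 ^ j) \<le> C * (2 * a) ^ j * \<xi> n" for j n
  proof -
    \<comment> \<open>The index k + 1 is reached from h + 1 by j doublings; passing from n to k
      \<ge> n only lowers the mean, so the bound at n applies.\<close>
    define h k where "h = n div 2 ^ j" and "k = 2 ^ j * h + (2 ^ j - 1)"
    have k: "k + 1 = 2 ^ j * (h + 1)" by (simp add: k_def)
    have "n < 2 ^ j * (h + 1)"
      unfolding h_def using dividend_less_times_div[of "2 ^ j" n] by (simp add: algebra_simps)
    then have "n \<le> k" using k by linarith
    have "real (h + 1) * \<xi> h \<le> S (h + 1)"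
      using mult_left_mono[OF le_arith_mean[OF \<xi>, of h], of "real (h + 1)"]
      unfolding arith_mean_eq S_def by simp
    also have "\<dots> \<le> a ^ j * S (k + 1)" unfolding k by (rule pow) simp
    also have "\<dots> = a ^ j * (real (k + 1) * arith_mean \<xi> k)" unfolding arith_mean_eq S_def ..
    also have "\<dots> \<le> a ^ j * (real (k + 1) * (C * \<xi> n))"
      using order_trans[OF arith_mean_antimono[OF \<xi> \<open>n \<le> k\<close>] le[of n]] a by (intro mult_left_mono) auto
    also have "\<dots> = real (h + 1) * (C * (2 * a) ^ j * \<xi> n)"
      unfolding k by (simp only: of_nat_mult power_mult_distrib of_nat_power of_nat_numeral mult_ac)
    finally show ?thesis unfolding h_def by (rule mult_left_le_imp_le) simp
  qed
  then show thesis using that[of "2 * a"] a by auto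
qed

text \<open>The block from 2^j to 2^(j + 1) sums to at most 2^j * \<tau> (2^j - 1), and these bounds
  grow at least by the factor 2 / B > 1 from block to block, so the last one controls the whole
  sum.\<close>

lemma arith_mean_bound:
  assumes \<tau>: "\<tau> \<in> c0_star" and B: "1 \<le> B" "B < 2" and reg: "\<And>n. \<tau> (n div 2) \<le> B * \<tau> n"
  obtains C where "0 \<le> C" "\<And>n. arith_mean \<tau> n \<le> C * \<tau> n"
proof -
  \<comment> \<open>This C solves (C + 1) * B = 2 * C, which lets the induction over dyadic blocks
    reproduce its constant.\<close>
  define C where "C = B / (2 - B)"
  have C: "1 \<le> C" "(C + 1) * B = 2 * C" using B by (auto simp: C_def field_simps)
  define S where "S = (\<lambda>N. \<Sum>i<N. \<tau> i)"
  have S_le: "S (2 ^ j) \<le> C * 2 ^ j * \<tau> (2 ^ j - 1)" for j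
  proof (induction j)
    case 0
    show ?case using mult_right_mono[OF C(1) c0_starD(1)[OF \<tau>, of 0]] by (simp add: S_def)
  next
    case (Suc j)
    have "S (2 * 2 ^ j) = S (2 ^ j) + (\<Sum>i\<in>{2 ^ j..<2 * 2 ^ j}. \<tau> i)"
      unfolding S_def lessThan_atLeast0 by (rule sum.atLeastLessThan_concat[symmetric]) auto
    also have "(\<Sum>i\<in>{2 ^ j..<2 * 2 ^ j}. \<tau> i) \<le> (\<Sum>i\<in>{2 ^ j..<2 * 2 ^ j :: nat}. \<tau> (2 ^ j - 1))"
      by (intro sum_mono c0_starD(2)[OF \<tau>]) auto
    finally have "S (2 ^ Suc j) \<le> (C + 1) * 2 ^ j * \<tau> (2 ^ j - 1)"
      using Suc by (simp add: algebra_simps)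
    also have "\<tau> (2 ^ j - 1) \<le> B * \<tau> (2 ^ Suc j - 1)"
    proof -
      have "(2 ^ Suc j - 1) div 2 = (2 ^ j - 1 :: nat)" by (cases "2 ^ j :: nat") auto
      then show ?thesis using reg[of "2 ^ Suc j - 1"] by simp
    qed
    finally have "S (2 ^ Suc j) \<le> (C + 1) * 2 ^ j * (B * \<tau> (2 ^ Suc j - 1))"
      using C(1) by (simp add: mult_left_mono)
    also have "\<dots> = ((C + 1) * B) * 2 ^ j * \<tau> (2 ^ Suc j - 1)" by (simp only: mult_ac)
    finally show ?case unfolding C(2) by (simp only: power_Suc mult_ac)
  qed
  have "arith_mean \<tau> n \<le> (2 * C) * \<tau> n" for n
  proof -
    \<comment> \<open>Enclosing n + 1 between two powers of two doubles the constant.\<close>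
    obtain j where j: "2 ^ j \<le> n + 1" "n + 1 < 2 ^ Suc j"
      using ex_power_ivl1[of 2 "n + 1"] by auto
    have "real (n + 1) * arith_mean \<tau> n \<le> S (2 ^ Suc j)"
      unfolding arith_mean_eq S_def using j c0_starD(1)[OF \<tau>] by (intro sum_mono2) auto
    also have "\<dots> \<le> C * 2 ^ Suc j * \<tau> (2 ^ Suc j - 1)" by (rule S_le)
    also have "\<dots> \<le> C * 2 ^ Suc j * \<tau> n"
      using C j by (intro mult_left_mono c0_starD(2)[OF \<tau>]) auto
    also have "\<dots> = real (2 ^ j) * (2 * C * \<tau> n)" by simp
    also have "\<dots> \<le> real (n + 1) * (2 * C * \<tau> n)"
      using j C c0_starD(1)[OF \<tau>] by (intro mult_right_mono of_nat_mono) auto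
    finally show ?thesis by (rule mult_left_le_imp_le) simp
  qed
  then show thesis using that[of "2 * C"] C by auto
qed

text \<open>Regularity of \<tau> turns \<open>amp_le\<close> into domination up to a constant, and
  averaging preserves that.\<close>

lemma amp_le_arith_mean:
  assumes \<tau>: "\<tau> \<in> c0_star" and B: "1 \<le> B" "B < 2" and reg: "\<And>n. \<tau> (n div 2) \<le> B * \<tau> n"
    and "amp_le \<eta> \<tau>"
  shows "amp_le (arith_mean \<eta>) \<tau>"
proof -
  obtain C where C: "0 \<le> C" "\<And>n. arith_mean \<tau> n \<le> C * \<tau> n"
    using arith_mean_bound[OF \<tau> B reg] by blast
  obtain L where L: "1 \<le> L" "\<And>n. \<eta> n \<le> L * \<tau> n"
    using regular_amp_le_imp[OF \<tau> _ assms(5), of 1 B] ampliation_power_le[of \<tau> B] reg B by auto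
  show ?thesis
  proof (rule amp_le_of_le)
    fix n
    have "arith_mean \<eta> n \<le> L * arith_mean \<tau> n"
      unfolding arith_mean_def times_divide_eq_right sum_distrib_left
      by (intro divide_right_mono sum_mono L) simp
    also have "\<dots> \<le> L * (C * \<tau> n)" using L C by (intro mult_left_mono) auto
    finally show "arith_mean \<eta> n \<le> (L * C) * \<tau> n" by simp
  qed
qed

section \<open>Arithmetic means at infinity and ratios below 1/2\<close>

lemma summable_shift: "summable \<xi> \<Longrightarrow> summable (\<lambda>i. \<xi> (i + N))" for \<xi> :: "nat \<Rightarrow> real"
  by (simp add: summable_iff_shift)

lemma tail_split:
  fixes \<xi> :: "nat \<Rightarrow> real"
  assumes "summable \<xi>" "N \<le> K"
  shows "(\<Sum>i. \<xi> (i + N)) = (\<Sum>i\<in>{N..<K}. \<xi> i) + (\<Sum>i. \<xi> (i + K))"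
proof -
  have "(\<Sum>i. \<xi> (i + N)) = (\<Sum>i. \<xi> (i + (K - N) + N)) + (\<Sum>i<K - N. \<xi> (i + N))"
    by (rule suminf_split_initial_segment) (rule summable_shift[OF assms(1)])
  also have "(\<Sum>i<K - N. \<xi> (i + N)) = (\<Sum>i\<in>{N..<K}. \<xi> i)"
    using sum.shift_bounds_nat_ivl[of \<xi> 0 N "K - N"] assms(2) by (simp add: lessThan_atLeast0)
  finally show ?thesis using assms(2) by (simp add: add.assoc)
qed

lemma arith_mean_inf_eq: "real (n + 1) * arith_mean_inf \<xi> n = (\<Sum>i. \<xi> (i + (n + 1)))"
  by (simp add: arith_mean_inf_def)

lemma l1_starD: "\<xi> \<in> l1_star \<Longrightarrow> \<xi> \<in> c0_star" "\<xi> \<in> l1_star \<Longrightarrow> summable \<xi>"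
  by (auto simp: l1_star_def)

lemma arith_mean_inf_nonneg: "\<xi> \<in> l1_star \<Longrightarrow> 0 \<le> arith_mean_inf \<xi> n"
  unfolding arith_mean_inf_def
  by (intro divide_nonneg_nonneg suminf_nonneg summable_shift of_nat_0_le_iff)
    (auto dest: l1_starD intro: c0_starD(1))

lemma arith_mean_inf_antimono:
  assumes "\<xi> \<in> l1_star" "m \<le> n"
  shows "arith_mean_inf \<xi> n \<le> arith_mean_inf \<xi> m"
proof -
  have "(\<Sum>i. \<xi> (i + (n + 1))) \<le> (\<Sum>i. \<xi> (i + (m + 1)))"
    using assms(2)
    by (intro suminf_le summable_shift l1_starD(2)[OF assms(1)] c0_starD(2)[OF l1_starD(1)[OF assms(1)]]) auto
  moreover have "0 \<le> (\<Sum>i. \<xi> (i + (m + 1)))"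
    by (intro suminf_nonneg summable_shift l1_starD(2)[OF assms(1)] c0_starD(1)[OF l1_starD(1)[OF assms(1)]])
  ultimately show ?thesis unfolding arith_mean_inf_def using assms(2) by (intro frac_le) auto
qed

text \<open>As for the ordinary mean, n is replaced by the last k with k div m = n. Tails shrink
  instead of growing, so the terms between n and k are estimated separately by (k + 1) * \<xi> n;
  they account for the summand 1 in C = m * (1 + M).\<close>

lemma arith_mean_inf_bound_of_amp_le:
  assumes \<xi>: "\<xi> \<in> l1_star" and "amp_le (arith_mean_inf \<xi>) \<xi>"
  obtains C where "1 \<le> C" "\<And>n. (\<Sum>i. \<xi> (i + (n + 1))) \<le> C * real (n + 1) * \<xi> n"
proof -
  note \<xi>0 = l1_starD(1)[OF \<xi>]
  obtain m M where m: "0 < m" "1 \<le> M" "\<And>n. arith_mean_inf \<xi> n \<le> M * \<xi> (n div m)"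
    using amp_leE[OF assms(2)] c0_starD(1)[OF \<xi>0] by blast
  define C where "C = real m * (1 + M)"
  have "(\<Sum>i. \<xi> (i + (n + 1))) \<le> C * real (n + 1) * \<xi> n" for n
  proof -
    define k where "k = m * n + (m - 1)"
    have "k div m = n" using m(1) by (simp add: k_def del: add_diff_assoc)
    moreover have "k + 1 = m * (n + 1)" using m(1) by (simp add: k_def)
    moreover have "n \<le> k" using m(1) unfolding k_def by (cases m) auto
    ultimately have k: "k div m = n" "k + 1 = m * (n + 1)" "n \<le> k" by blast+
    have "(\<Sum>i. \<xi> (i + (n + 1))) = (\<Sum>i\<in>{n + 1..<k + 1}. \<xi> i) + (\<Sum>i. \<xi> (i + (k + 1)))"
      using k(3) by (intro tail_split l1_starD(2) \<xi>) auto
    also have "(\<Sum>i\<in>{n + 1..<k + 1}. \<xi> i) \<le> (\<Sum>i\<in>{n + 1..<k + 1}. \<xi> n)"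
      by (intro sum_mono c0_starD(2)[OF \<xi>0]) auto
    also have "\<dots> \<le> real (k + 1) * \<xi> n"
      using c0_starD(1)[OF \<xi>0, of n] by (simp add: mult_right_mono)
    also have "(\<Sum>i. \<xi> (i + (k + 1))) \<le> real (k + 1) * (M * \<xi> n)"
      unfolding arith_mean_inf_eq[symmetric] using m(3)[of k] k(1) by (intro mult_left_mono) auto
    also have "real (k + 1) * \<xi> n + real (k + 1) * (M * \<xi> n) = C * real (n + 1) * \<xi> n"
      unfolding k(2) by (simp add: C_def algebra_simps)
    finally show ?thesis by simp
  qed
  moreover have "1 \<le> C" using mult_mono[of 1 "real m" 1 "1 + M"] m by (simp add: C_def)
  ultimately show thesis using that by blast
qed

text \<open>Tails replace partial sums: T (2 * N) \<le> 2 * C * N * \<xi> (2 * N - 1) \<le> 2 * C *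
  (T N - T (2 * N)) gives T (2 * N) \<le> A * T N with A < 1. Division by the length of the range
  turns powers of A into powers of A / 2.\<close>

lemma arith_mean_inf_bound_imp_decaying:
  assumes \<xi>: "\<xi> \<in> l1_star" and C: "1 \<le> C"
    and le: "\<And>n. (\<Sum>i. \<xi> (i + (n + 1))) \<le> C * real (n + 1) * \<xi> n"
  obtains B M where "0 < B" "B < 1 / 2" "\<And>j n. \<xi> (2 ^ j * (n + 1) - 1) \<le> M * B ^ j * \<xi> n"
proof -
  note \<xi>0 = l1_starD(1)[OF \<xi>]
  define T where "T = (\<lambda>N. \<Sum>i. \<xi> (i + N))"
  define A where "A = 2 * C / (2 * C + 1)"
  have A: "0 < A" "A < 1" using C by (auto simp: A_def)
  have half: "real N * \<xi> (2 * N - 1) + T (2 * N) \<le> T N" for N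
  proof -
    have "T N = (\<Sum>i\<in>{N..<2 * N}. \<xi> i) + T (2 * N)"
      unfolding T_def by (intro tail_split l1_starD(2) \<xi>) auto
    moreover have "(\<Sum>i\<in>{N..<2 * N}. \<xi> (2 * N - 1)) \<le> (\<Sum>i\<in>{N..<2 * N}. \<xi> i)"
      by (intro sum_mono c0_starD(2)[OF \<xi>0]) auto
    ultimately show ?thesis by simp
  qed
  have T0: "0 \<le> T N" for N
    unfolding T_def by (intro suminf_nonneg summable_shift l1_starD(2)[OF \<xi>] c0_starD(1)[OF \<xi>0])
  have dbl: "T (2 * N) \<le> A * T N" if "0 < N" for N
  proof -
    have "T (2 * N) \<le> C * real (2 * N) * \<xi> (2 * N - 1)"
      using le[of "2 * N - 1"] that by (simp add: T_def)
    then have "T (2 * N) * (2 * C + 1) \<le> 2 * C * T N"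
      using mult_left_mono[OF half[of N], of "2 * C"] C by (simp add: algebra_simps)
    then show ?thesis using C by (simp add: A_def field_simps)
  qed
  have pow: "T (2 ^ j * N) \<le> A ^ j * T N" if "0 < N" for N j
  proof (induction j)
    case (Suc j)
    have "T (2 * (2 ^ j * N)) \<le> A * T (2 ^ j * N)" by (rule dbl) (use that in simp)
    also have "\<dots> \<le> A * (A ^ j * T N)" using Suc A by (intro mult_left_mono) auto
    finally show ?case by (simp add: mult_ac)
  qed simp
  \<comment> \<open>One doubling is spent on N * \<xi> (2 * N - 1) \<le> T N; dividing C by A / 2
    makes up for the missing factor.\<close>
  define M where "M = 2 * C / A"
  have M: "1 \<le> M" using C A by (simp add: M_def field_simps)
  have "\<xi> (2 ^ j * (n + 1) - 1) \<le> M * (A / 2) ^ j * \<xi> n" for j n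
  proof (cases j)
    case 0
    then show ?thesis using mult_right_mono[OF M c0_starD(1)[OF \<xi>0, of n]] by simp
  next
    case (Suc i)
    let ?N = "2 ^ i * (n + 1)"
    have "real ?N * \<xi> (2 * ?N - 1) \<le> T ?N" using half[of ?N] T0[of "2 * ?N"] by linarith
    also have "\<dots> \<le> A ^ i * T (n + 1)" by (rule pow) simp
    also have "\<dots> \<le> A ^ i * (C * real (n + 1) * \<xi> n)"
      using le[of n] A unfolding T_def by (intro mult_left_mono) auto
    also have "\<dots> = real ?N * (M * (A / 2) ^ j * \<xi> n)"
      using A by (simp add: Suc M_def power_divide field_simps)
    finally have "\<xi> (2 * ?N - 1) \<le> M * (A / 2) ^ j * \<xi> n"
      by (rule mult_left_le_imp_le) (simp only: of_nat_0_less_iff nat_0_less_mult_iff, simp)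
    then show ?thesis by (simp add: Suc mult.assoc)
  qed
  then show thesis using that[of "A / 2" M] A by auto
qed

text \<open>The block of n + 1 terms after n contributes at most (n + 1) * \<tau> n, and passing
  from n to 2 * n + 1 multiplies this bound by at most 2 * B < 1. The geometric sum D = 1 / (1 - 2 *
  B) is the fixed point of D = 1 + 2 * B * D.\<close>

lemma decaying_imp_summable:
  assumes \<tau>: "\<tau> \<in> c0_star" and B: "0 < B" "B < 1 / 2" and dec: "\<And>n. \<tau> (2 * n + 1) \<le> B * \<tau> n"
  shows "\<tau> \<in> l1_star"
    and "(\<Sum>i. \<tau> (i + (n + 1))) \<le> 1 / (1 - 2 * B) * real (n + 1) * \<tau> n"
proof -
  define D where "D = 1 / (1 - 2 * B)"
  have D: "0 < D" "1 + 2 * B * D = D" using B by (auto simp: D_def field_simps)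
  have bound: "(\<Sum>i\<in>{n + 1..<2 ^ K * (n + 1)}. \<tau> i) \<le> D * real (n + 1) * \<tau> n" for K n
  proof (induction K arbitrary: n)
    case 0
    then show ?case using D c0_starD(1)[OF \<tau>, of n] by simp
  next
    case (Suc K)
    let ?k = "2 * n + 1"
    have k: "?k + 1 = 2 * (n + 1)" "2 ^ K * (?k + 1) = 2 ^ Suc K * (n + 1)" by auto
    have "2 * (n + 1) \<le> 2 ^ Suc K * (n + 1)" by (intro mult_le_mono1) simp
    then have "(\<Sum>i\<in>{n + 1..<2 ^ Suc K * (n + 1)}. \<tau> i) =
        (\<Sum>i\<in>{n + 1..<2 * (n + 1)}. \<tau> i) + (\<Sum>i\<in>{?k + 1..<2 ^ K * (?k + 1)}. \<tau> i)"
      unfolding k(2) unfolding k(1) by (intro sum.atLeastLessThan_concat[symmetric]) auto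
    also have "(\<Sum>i\<in>{n + 1..<2 * (n + 1)}. \<tau> i) \<le> (\<Sum>i\<in>{n + 1..<2 * (n + 1)}. \<tau> n)"
      by (intro sum_mono c0_starD(2)[OF \<tau>]) auto
    also have "(\<Sum>i\<in>{?k + 1..<2 ^ K * (?k + 1)}. \<tau> i) \<le> D * real (?k + 1) * \<tau> ?k" by (rule Suc)
    also have "\<dots> \<le> D * real (?k + 1) * (B * \<tau> n)" using D dec by (intro mult_left_mono) auto
    also have "(\<Sum>i\<in>{n + 1..<2 * (n + 1)}. \<tau> n) + D * real (?k + 1) * (B * \<tau> n) =
        (1 + 2 * B * D) * real (n + 1) * \<tau> n"
      by (simp add: algebra_simps)
    finally show ?case unfolding D(2) by simp
  qed
  have part: "(\<Sum>i<k. \<tau> (i + (n + 1))) \<le> D * real (n + 1) * \<tau> n" for k n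
  proof -
    have "(\<Sum>i<k. \<tau> (i + (n + 1))) = (\<Sum>i\<in>{n + 1..<k + (n + 1)}. \<tau> i)"
      using sum.shift_bounds_nat_ivl[of \<tau> 0 "n + 1" k] by (simp add: lessThan_atLeast0)
    also have "\<dots> \<le> (\<Sum>i\<in>{n + 1..<2 ^ (k + 1) * (n + 1)}. \<tau> i)"
    proof (rule sum_mono2)
      have "k + (n + 1) \<le> (k + 1) * (n + 1)" by (simp add: algebra_simps)
      also have "\<dots> \<le> 2 ^ (k + 1) * (n + 1)" by (rule mult_le_mono1) (rule self_le_two_power)
      finally show "{n + 1..<k + (n + 1)} \<subseteq> {n + 1..<2 ^ (k + 1) * (n + 1)}" by auto
    qed (auto simp: c0_starD(1)[OF \<tau>])
    also have "\<dots> \<le> D * real (n + 1) * \<tau> n" by (rule bound)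
    finally show ?thesis .
  qed
  have summ: "summable (\<lambda>i. \<tau> (i + (n + 1)))" for n
    using part c0_starD(1)[OF \<tau>] by (intro summableI_nonneg_bounded) auto
  then have "summable \<tau>" using summable_iff_shift[of \<tau> 1] summ[of 0] by simp
  with \<tau> show "\<tau> \<in> l1_star" by (simp add: l1_star_def)
  show "(\<Sum>i. \<tau> (i + (n + 1))) \<le> 1 / (1 - 2 * B) * real (n + 1) * \<tau> n"
    using suminf_le_const[OF summ part] by (simp only: D_def)
qed

text \<open>An ampliation of \<tau> cannot be absorbed into a constant here, but it can be summed:
  it repeats each value m times, so the tail of \<eta> after n is at most K * m times the tail of
  \<tau> from n div m on.\<close>

lemma amp_le_arith_mean_inf:
  assumes \<tau>: "\<tau> \<in> l1_star" and C: "\<And>n. (\<Sum>i. \<tau> (i + (n + 1))) \<le> C * real (n + 1) * \<tau> n"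
    and \<eta>: "\<eta> \<in> c0_star" "amp_le \<eta> \<tau>"
  shows "\<eta> \<in> l1_star" "amp_le (arith_mean_inf \<eta>) \<tau>"
proof -
  note \<tau>0 = l1_starD(1)[OF \<tau>]
  obtain m K where m: "0 < m" "1 \<le> K" "\<And>n. \<eta> n \<le> K * \<tau> (n div m)"
    using amp_leE[OF \<eta>(2)] c0_starD(1)[OF \<tau>0] by blast
  have part: "(\<Sum>i<k. \<eta> (i + (n + 1))) \<le> K * (real m * (\<Sum>i. \<tau> (i + n div m)))" for k n
  proof -
    define h where "h = n div m"
    have "(\<Sum>i<k. \<eta> (i + (n + 1))) \<le> (\<Sum>i<k. K * \<tau> ((i + (n + 1)) div m))"
      by (intro sum_mono m(3))
    also have "\<dots> = K * (\<Sum>i\<in>{n + 1..<k + (n + 1)}. \<tau> (i div m))"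
      using sum.shift_bounds_nat_ivl[of "\<lambda>i. \<tau> (i div m)" 0 "n + 1" k]
      by (simp add: lessThan_atLeast0 sum_distrib_left)
    \<comment> \<open>The range is enlarged to whole blocks of length m. Block h may still contain
      indices beyond n, hence the additional term \<tau> h at the end.\<close>
    also have "(\<Sum>i\<in>{n + 1..<k + (n + 1)}. \<tau> (i div m)) \<le> (\<Sum>i\<in>{h * m..<h * m + (k + 1) * m}. \<tau> (i div m))"
    proof (rule sum_mono2)
      have "n < h * m + m" unfolding h_def using dividend_less_div_times[OF m(1), of n] by simp
      moreover have "k \<le> k * m" using m(1) by (cases m) auto
      ultimately have "k + (n + 1) \<le> h * m + (k + 1) * m" by (simp only: add_mult_distrib mult_1)
      moreover have "h * m \<le> n" by (simp add: h_def)
      ultimately show "{n + 1..<k + (n + 1)} \<subseteq> {h * m..<h * m + (k + 1) * m}" by auto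
    qed (auto simp: c0_starD(1)[OF \<tau>0])
    also have "\<dots> = (\<Sum>i<(k + 1) * m. \<tau> ((i + h * m) div m))"
      using sum.shift_bounds_nat_ivl[of "\<lambda>i. \<tau> (i div m)" 0 "h * m" "(k + 1) * m"]
      by (simp add: lessThan_atLeast0 add.commute)
    also have "\<dots> = (\<Sum>q<k + 1. \<Sum>i\<in>{q * m..<q * m + m}. \<tau> ((i + h * m) div m))"
      by (rule sum.nat_group[symmetric])
    also have "\<dots> = (\<Sum>q<k + 1. \<Sum>i\<in>{q * m..<q * m + m}. \<tau> (q + h))"
    proof (intro sum.cong refl)
      fix q i assume "i \<in> {q * m..<q * m + m}"
      then have "i div m = q" by (intro div_nat_eqI) (auto simp: algebra_simps)
      then show "\<tau> ((i + h * m) div m) = \<tau> (q + h)" using m(1) by (simp add: add.commute)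
    qed
    also have "\<dots> = real m * (\<Sum>q<k + 1. \<tau> (q + h))"
      unfolding sum_distrib_left by (rule sum.cong) auto
    also have "\<dots> \<le> real m * (\<Sum>i. \<tau> (i + h))"
      using c0_starD(1)[OF \<tau>0]
      by (intro mult_left_mono sum_le_suminf summable_shift l1_starD(2)[OF \<tau>]) auto
    finally show ?thesis using m(2) unfolding h_def by (simp add: mult_left_mono)
  qed
  have summ: "summable (\<lambda>i. \<eta> (i + (n + 1)))" for n
    using part[of n] c0_starD(1)[OF \<eta>(1)] by (intro summableI_nonneg_bounded) auto
  then have "summable \<eta>" using summable_iff_shift[of \<eta> 1] summ[of 0] by simp
  with \<eta> show "\<eta> \<in> l1_star" by (simp add: l1_star_def)
  show "amp_le (arith_mean_inf \<eta>) \<tau>"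
  proof (rule amp_leI[OF m(1)])
    fix n
    define h where "h = n div m"
    have hn: "real (h + 1) \<le> real (n + 1)" using div_le_dividend[of n m] by (simp add: h_def)
    have "real (n + 1) * arith_mean_inf \<eta> n \<le> K * (real m * (\<Sum>i. \<tau> (i + h)))"
      unfolding arith_mean_inf_eq h_def by (rule suminf_le_const[OF summ part])
    also have "(\<Sum>i. \<tau> (i + h)) = \<tau> h + (\<Sum>i. \<tau> (i + (h + 1)))"
      using tail_split[OF l1_starD(2)[OF \<tau>], of h "h + 1"] by simp
    also have "\<dots> \<le> \<tau> h + C * real (h + 1) * \<tau> h" using C by simp
    also have "\<dots> \<le> real (h + 1) * \<tau> h + \<bar>C\<bar> * real (h + 1) * \<tau> h"
      using c0_starD(1)[OF \<tau>0, of h] mult_right_mono[of 1 "real (h + 1)" "\<tau> h"]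
      by (intro add_mono mult_right_mono) auto
    also have "\<dots> = real (h + 1) * ((1 + \<bar>C\<bar>) * \<tau> h)" by (simp add: algebra_simps)
    also have "\<dots> \<le> real (n + 1) * ((1 + \<bar>C\<bar>) * \<tau> h)"
      using hn c0_starD(1)[OF \<tau>0, of h] by (intro mult_right_mono) auto
    finally have "real (n + 1) * arith_mean_inf \<eta> n \<le> real (n + 1) * (K * real m * (1 + \<bar>C\<bar>) * \<tau> h)"
      using m by (simp add: mult_left_mono mult_ac)
    then show "arith_mean_inf \<eta> n \<le> (K * real m * (1 + \<bar>C\<bar>)) * \<tau> (n div m)"
      unfolding h_def by (rule mult_left_le_imp_le) simp
  qed
qed

text \<open>The mean at infinity leaves out \<xi> n and need not dominate \<xi>, but the n + 1 terms
  from n + 1 to 2 * n + 1 show that it is at least \<xi> (2 * n + 1) at n. The ratio 4 * m covers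
  the halving of the index and its rounding; index 0 is not reached and enters L through \<xi> 0 /
  \<tau> 0.\<close>

lemma amp_le_of_arith_mean_inf:
  assumes \<xi>: "\<xi> \<in> l1_star" and \<tau>: "\<tau> \<in> c0_star" "0 < \<tau> 0" and "amp_le (arith_mean_inf \<xi>) \<tau>"
  shows "amp_le \<xi> \<tau>"
proof -
  note \<xi>0 = l1_starD(1)[OF \<xi>]
  obtain m M where m: "0 < m" "1 \<le> M" "\<And>n. arith_mean_inf \<xi> n \<le> M * \<tau> (n div m)"
    using amp_leE[OF assms(4)] c0_starD(1)[OF \<tau>(1)] by blast
  have odd: "\<xi> (2 * n + 1) \<le> arith_mean_inf \<xi> n" for n
  proof -
    have "(\<Sum>i\<in>{n + 1..<2 * n + 2}. \<xi> (2 * n + 1)) \<le> (\<Sum>i\<in>{n + 1..<2 * n + 2}. \<xi> i)"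
      by (intro sum_mono c0_starD(2)[OF \<xi>0]) auto
    moreover have "(\<Sum>i. \<xi> (i + (n + 1))) = (\<Sum>i\<in>{n + 1..<2 * n + 2}. \<xi> i) + (\<Sum>i. \<xi> (i + (2 * n + 2)))"
      by (intro tail_split l1_starD(2) \<xi>) auto
    moreover have "0 \<le> (\<Sum>i. \<xi> (i + (2 * n + 2)))"
      by (intro suminf_nonneg summable_shift l1_starD(2)[OF \<xi>] c0_starD(1)[OF \<xi>0])
    ultimately have "real (n + 1) * \<xi> (2 * n + 1) \<le> real (n + 1) * arith_mean_inf \<xi> n"
      unfolding arith_mean_inf_eq by simp
    then show ?thesis by (rule mult_left_le_imp_le) simp
  qed
  define L where "L = max M (\<xi> 0 / \<tau> 0)"
  show ?thesis
  proof (rule amp_leI[of "4 * m"])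
    fix n
    show "\<xi> n \<le> L * \<tau> (n div (4 * m))"
    proof (cases n)
      case 0
      have "\<xi> 0 = \<xi> 0 / \<tau> 0 * \<tau> 0" using \<tau>(2) by simp
      also have "\<dots> \<le> L * \<tau> 0" using \<tau>(2) by (intro mult_right_mono) (auto simp: L_def)
      finally show ?thesis using 0 by simp
    next
      case (Suc k)
      have "2 * (k div 2) + 1 \<le> n" using Suc by simp
      then have "\<xi> n \<le> \<xi> (2 * (k div 2) + 1)" by (rule c0_starD(2)[OF \<xi>0])
      also have "\<dots> \<le> M * \<tau> (k div 2 div m)" by (rule order_trans[OF odd m(3)])
      also have "\<dots> \<le> L * \<tau> (n div (4 * m))"
      proof (intro mult_mono c0_starD(2)[OF \<tau>(1)])
        have "n div 4 \<le> k div 2" using Suc by presburger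
        then show "n div (4 * m) \<le> k div 2 div m" by (simp add: div_mult2_eq div_le_mono)
      qed (use m(2) c0_starD(1)[OF \<tau>(1)] in \<open>auto simp: L_def\<close>)
      finally show ?thesis .
    qed
  qed (use m in simp)
qed

section \<open>Complex inner products and diagonal operators\<close>

instance chilbert_space \<subseteq> banach ..

lemma cinner_add_right: "cinner x (y + z) = cinner x y + cinner x z"
  by (metis cinner_add_left cinner_commute complex_cnj_add)

lemma cinner_cscale_right: "cinner x (cscale c y) = cnj c * cinner x y"
  by (metis cinner_cscale_left cinner_commute complex_cnj_mult)

lemma additive_cinner: "Modules.additive (\<lambda>x. cinner x y)" "Modules.additive (cinner x)"
  by (auto simp: Modules.additive_def cinner_add_left cinner_add_right)

lemmas cinner_zero_left [simp] = additive.zero[OF additive_cinner(1)]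
  and cinner_zero_right [simp] = additive.zero[OF additive_cinner(2)]
  and cinner_diff_left = additive.diff[OF additive_cinner(1)]
  and cinner_sum_left = additive.sum[OF additive_cinner(1)]
  and cinner_sum_right = additive.sum[OF additive_cinner(2)]

lemma cinner_self: "cinner x x = of_real ((norm x)\<^sup>2)"
proof (rule complex_eqI)
  show "Re (cinner x x) = Re (of_real ((norm x)\<^sup>2))" by (simp add: Re_cinner power2_norm_eq_inner)
  have "cinner x x = cnj (cinner x x)" by (rule cinner_commute)
  then show "Im (cinner x x) = Im (of_real ((norm x)\<^sup>2))" by (simp add: complex_eq_iff)
qed

lemma cinner_commute_zero: "cinner x y = 0 \<longleftrightarrow> cinner y x = 0"
  by (metis cinner_commute complex_cnj_zero)

lemma norm_cscale: "norm (cscale c x) = cmod c * norm x"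
proof -
  have "complex_of_real ((norm (cscale c x))\<^sup>2) = of_real ((cmod c * norm x)\<^sup>2)"
    unfolding cinner_self[symmetric] cinner_cscale_left cinner_cscale_right
    by (simp add: cinner_self power_mult_distrib complex_norm_square[of c, symmetric] mult.commute[of "cnj c"]
      flip: mult.assoc of_real_power)
  then have "(norm (cscale c x))\<^sup>2 = (cmod c * norm x)\<^sup>2" by (simp only: of_real_eq_iff)
  then show ?thesis by (rule power2_eq_imp_eq) auto
qed

text \<open>Multiplying x by a phase makes the inner product a nonnegative real number, so the real
  Cauchy-Schwarz inequality suffices.\<close>

lemma cmod_cinner_le: "cmod (cinner x y) \<le> norm x * norm y"
proof (cases "cinner x y = 0")
  case False
  define c where "c = cnj (sgn (cinner x y))"
  have "cmod c = 1" using False by (simp add: c_def norm_sgn)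
  have "cmod (cinner x y) = Re (cinner (cscale c x) y)"
  proof -
    have "c * cinner x y = of_real (cmod (cinner x y))"
      using False complex_norm_square[of "cinner x y", symmetric]
      by (simp add: c_def sgn_eq mult.commute[of "cnj _"] power2_eq_square)
    then show ?thesis by (simp add: cinner_cscale_left)
  qed
  also have "\<dots> \<le> norm (cscale c x) * norm y" unfolding Re_cinner by (rule norm_cauchy_schwarz)
  finally show ?thesis using \<open>cmod c = 1\<close> by (simp add: norm_cscale)
qed simp

lemma cinner_eqI:
  assumes "\<And>z. cinner z x = cinner z y"
  shows "x = y"
proof -
  have "cinner (x - y) (x - y) = 0"
    using assms[of "x - y"] by (simp add: additive.diff[OF additive_cinner(2)])
  then show ?thesis by (simp add: cinner_self)
qed

lemma cscale_scaleR_commute: "cscale c (r *\<^sub>R x) = r *\<^sub>R cscale c x"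
  unfolding cscale_of_real[symmetric] by (simp add: cscale_cscale mult.commute)

lemma bounded_linear_cscale: "bounded_linear (cscale c)"
  by (rule bounded_linear_intro[of _ "cmod c"])
    (simp_all add: cscale_add_right cscale_scaleR_commute norm_cscale mult.commute)

lemma bounded_linear_cscale_left: "bounded_linear (\<lambda>c. cscale c x)"
  by (rule bounded_linear_intro[of _ "norm x"])
    (simp_all add: cscale_add_left scaleR_conv_of_real norm_cscale cscale_cscale flip: cscale_of_real)

lemma bounded_linear_cinner: "bounded_linear (\<lambda>x. cinner x y)"
  by (rule bounded_linear_intro[of _ "norm y"])
    (simp_all add: cinner_add_left cinner_cscale_left scaleR_conv_of_real cmod_cinner_le flip: cscale_of_real)

lemma bounded_linear_cinner_right: "bounded_linear (cinner x)"
  by (rule bounded_linear_intro[of _ "norm x"])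
    (simp_all add: cinner_add_right cinner_cscale_right scaleR_conv_of_real mult.commute[of "norm _" "norm x"]
      cmod_cinner_le flip: cscale_of_real)

text \<open>Zero vectors are allowed, so that operators of finite rank need no separate treatment.\<close>

definition orthonormal_or_zero :: "(nat \<Rightarrow> 'a::chilbert_space) \<Rightarrow> bool" where
  "orthonormal_or_zero e \<longleftrightarrow>
     (\<forall>i j. i \<noteq> j \<longrightarrow> cinner (e i) (e j) = 0) \<and> (\<forall>i. e i = 0 \<or> norm (e i) = 1)"

lemma orthonormal_or_zero_cinner:
  assumes "orthonormal_or_zero e"
  shows "cinner (e i) (e j) = (if i = j \<and> e i \<noteq> 0 then 1 else 0)"
  using assms by (auto simp: orthonormal_or_zero_def cinner_self)

lemma norm_orthogonal_sum:
  assumes "orthonormal_or_zero e" "finite F"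
  shows "(norm (\<Sum>i\<in>F. cscale (c i) (e i)))\<^sup>2 = (\<Sum>i\<in>F. (cmod (c i))\<^sup>2 * (norm (e i))\<^sup>2)"
proof -
  have "pairwise (\<lambda>i j. orthogonal (cscale (c i) (e i)) (cscale (c j) (e j))) F"
    unfolding pairwise_def orthogonal_def Re_cinner[symmetric]
    by (simp add: cinner_cscale_left cinner_cscale_right orthonormal_or_zero_cinner[OF assms(1)])
  then show ?thesis
    using norm_sum_Pythagorean[OF assms(2), of "\<lambda>i. cscale (c i) (e i)"]
    by (simp add: norm_cscale power_mult_distrib)
qed

lemma norm_orthogonal_sum_le:
  assumes "orthonormal_or_zero e" "finite F"
  shows "(norm (\<Sum>i\<in>F. cscale (c i) (e i)))\<^sup>2 \<le> (\<Sum>i\<in>F. (cmod (c i))\<^sup>2)"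
  unfolding norm_orthogonal_sum[OF assms]
proof (rule sum_mono)
  fix i
  have "norm (e i) = 0 \<or> norm (e i) = 1" using assms(1) by (auto simp: orthonormal_or_zero_def)
  then show "(cmod (c i))\<^sup>2 * (norm (e i))\<^sup>2 \<le> (cmod (c i))\<^sup>2" by auto
qed

lemma Bessel_identity:
  assumes "orthonormal_or_zero e" "finite F"
  shows "(norm (x - (\<Sum>i\<in>F. cscale (cinner x (e i)) (e i))))\<^sup>2 + (\<Sum>i\<in>F. (cmod (cinner x (e i)))\<^sup>2) = (norm x)\<^sup>2"
proof -
  define p where "p = (\<Sum>i\<in>F. cscale (cinner x (e i)) (e i))"
  have "cinner (x - p) (e j) = 0" if "j \<in> F" for j
  proof -
    have "cinner p (e j) = (\<Sum>i\<in>F. if i = j then cinner x (e j) else 0)"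
      unfolding p_def cinner_sum_left
      by (intro sum.cong) (auto simp: cinner_cscale_left orthonormal_or_zero_cinner[OF assms(1)])
    then show ?thesis using that assms(2) by (simp add: cinner_diff_left)
  qed
  then have "cinner (x - p) p = 0" by (simp add: p_def cinner_sum_right cinner_cscale_right)
  then have "inner (x - p) p = 0" by (simp flip: Re_cinner)
  then have "(norm (x - p))\<^sup>2 + (norm p)\<^sup>2 = (norm (x - p + p))\<^sup>2"
    by (intro norm_add_Pythagorean[symmetric]) (simp add: orthogonal_def)
  moreover have "(norm p)\<^sup>2 = (\<Sum>i\<in>F. (cmod (cinner x (e i)))\<^sup>2)"
    unfolding p_def norm_orthogonal_sum[OF assms]
  proof (rule sum.cong)
    fix i
    have "e i = 0 \<or> norm (e i) = 1" using assms(1) by (auto simp: orthonormal_or_zero_def)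
    then show "(cmod (cinner x (e i)))\<^sup>2 * (norm (e i))\<^sup>2 = (cmod (cinner x (e i)))\<^sup>2" by auto
  qed simp
  ultimately show ?thesis by (simp add: p_def)
qed

lemma Bessel:
  assumes "orthonormal_or_zero e"
  shows "summable (\<lambda>i. (cmod (cinner x (e i)))\<^sup>2)" "(\<Sum>i. (cmod (cinner x (e i)))\<^sup>2) \<le> (norm x)\<^sup>2"
proof -
  have *: "(\<Sum>i<n. (cmod (cinner x (e i)))\<^sup>2) \<le> (norm x)\<^sup>2" for n
    using Bessel_identity[OF assms finite_lessThan[of n], of x] zero_le_power2[of "norm (x - (\<Sum>i<n. cscale (cinner x (e i)) (e i)))"]
    by linarith
  show s: "summable (\<lambda>i. (cmod (cinner x (e i)))\<^sup>2)"
    using * by (intro summableI_nonneg_bounded) auto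
  show "(\<Sum>i. (cmod (cinner x (e i)))\<^sup>2) \<le> (norm x)\<^sup>2" by (rule suminf_le_const[OF s *])
qed

lemma summable_orthogonal:
  fixes f :: "nat \<Rightarrow> 'a::chilbert_space"
  assumes "orthonormal_or_zero f" "summable (\<lambda>n. (cmod (c n))\<^sup>2)"
  shows "summable (\<lambda>n. cscale (c n) (f n))"
    and "(norm (\<Sum>n. cscale (c n) (f n)))\<^sup>2 \<le> (\<Sum>n. (cmod (c n))\<^sup>2)"
proof -
  show s: "summable (\<lambda>n. cscale (c n) (f n))"
    unfolding summable_Cauchy
  proof (intro allI impI)
    fix \<epsilon> :: real assume "0 < \<epsilon>"
    then have "0 < \<epsilon>\<^sup>2" by simp
    then obtain N where N: "\<And>m n. N \<le> m \<Longrightarrow> norm (\<Sum>i\<in>{m..<n}. (cmod (c i))\<^sup>2) < \<epsilon>\<^sup>2"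
      using assms(2) unfolding summable_Cauchy by meson
    have "norm (\<Sum>i\<in>{m..<n}. cscale (c i) (f i)) < \<epsilon>" if "N \<le> m" for m n
    proof -
      have "(norm (\<Sum>i\<in>{m..<n}. cscale (c i) (f i)))\<^sup>2 \<le> (\<Sum>i\<in>{m..<n}. (cmod (c i))\<^sup>2)"
        by (rule norm_orthogonal_sum_le[OF assms(1)]) simp
      also have "\<dots> < \<epsilon>\<^sup>2" using N[OF that, of n] by simp
      finally show ?thesis using \<open>0 < \<epsilon>\<close> by (simp add: power_less_imp_less_base)
    qed
    then show "\<exists>N. \<forall>m\<ge>N. \<forall>n. norm (\<Sum>i\<in>{m..<n}. cscale (c i) (f i)) < \<epsilon>" by blast
  qed
  have "(\<lambda>n. (norm (\<Sum>i<n. cscale (c i) (f i)))\<^sup>2) \<longlonglongrightarrow> (norm (\<Sum>n. cscale (c n) (f n)))\<^sup>2"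
    by (intro tendsto_intros summable_LIMSEQ s)
  moreover have "(norm (\<Sum>i<n. cscale (c i) (f i)))\<^sup>2 \<le> (\<Sum>n. (cmod (c n))\<^sup>2)" for n
    using norm_orthogonal_sum_le[OF assms(1), of "{..<n}" c] sum_le_suminf[OF assms(2), of "{..<n}"] by simp
  ultimately show "(norm (\<Sum>n. cscale (c n) (f n)))\<^sup>2 \<le> (\<Sum>n. (cmod (c n))\<^sup>2)"
    by (intro LIMSEQ_le_const2) auto
qed

section \<open>Operators given by a series over two orthonormal systems\<close>

definition diag_system :: "(nat \<Rightarrow> real) \<Rightarrow> (nat \<Rightarrow> 'a::chilbert_space) \<Rightarrow> (nat \<Rightarrow> 'a) \<Rightarrow> bool" where
  "diag_system a e f \<longleftrightarrow> (\<exists>M. \<forall>n. \<bar>a n\<bar> \<le> M) \<and> orthonormal_or_zero e \<and> orthonormal_or_zero f"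

text \<open>The Schmidt series. \<open>Blinfun\<close> is meaningful only for bounded linear maps,
  which \<open>diag_system\<close> ensures. Every compact operator will be shown to have this form,
  so that work with operators becomes work with coefficients.\<close>

definition diag_op :: "(nat \<Rightarrow> real) \<Rightarrow> (nat \<Rightarrow> 'a::chilbert_space) \<Rightarrow> (nat \<Rightarrow> 'a) \<Rightarrow> ('a \<Rightarrow>\<^sub>L 'a)" where
  "diag_op a e f = Blinfun (\<lambda>x. \<Sum>n. cscale (of_real (a n) * cinner x (e n)) (f n))"

lemma diag_series:
  fixes e f :: "nat \<Rightarrow> 'a::chilbert_space"
  assumes "orthonormal_or_zero e" "orthonormal_or_zero f" "\<And>n. \<bar>a n\<bar> \<le> M"
  shows "summable (\<lambda>n. cscale (of_real (a n) * cinner x (e n)) (f n))"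
    and "norm (\<Sum>n. cscale (of_real (a n) * cinner x (e n)) (f n)) \<le> M * norm x"
proof -
  have M: "0 \<le> M" using assms(3)[of 0] by linarith
  have le: "(cmod (of_real (a n) * cinner x (e n)))\<^sup>2 \<le> M\<^sup>2 * (cmod (cinner x (e n)))\<^sup>2" for n
    using power_mono[OF assms(3)[of n] abs_ge_zero, of 2]
    by (simp add: norm_mult power_mult_distrib mult_right_mono)
  have s: "summable (\<lambda>n. M\<^sup>2 * (cmod (cinner x (e n)))\<^sup>2)" by (intro summable_mult Bessel assms)
  have s2: "summable (\<lambda>n. (cmod (of_real (a n) * cinner x (e n)))\<^sup>2)"
    by (rule summable_comparison_test[OF _ s]) (use le in auto)
  show "summable (\<lambda>n. cscale (of_real (a n) * cinner x (e n)) (f n))"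
    by (rule summable_orthogonal[OF assms(2) s2])
  have "(norm (\<Sum>n. cscale (of_real (a n) * cinner x (e n)) (f n)))\<^sup>2
      \<le> (\<Sum>n. (cmod (of_real (a n) * cinner x (e n)))\<^sup>2)"
    by (rule summable_orthogonal[OF assms(2) s2])
  also have "\<dots> \<le> (\<Sum>n. M\<^sup>2 * (cmod (cinner x (e n)))\<^sup>2)" by (rule suminf_le[OF le s2 s])
  also have "\<dots> = M\<^sup>2 * (\<Sum>n. (cmod (cinner x (e n)))\<^sup>2)" by (intro suminf_mult Bessel assms)
  also have "\<dots> \<le> M\<^sup>2 * (norm x)\<^sup>2" by (intro mult_left_mono Bessel assms) simp
  finally have "(norm (\<Sum>n. cscale (of_real (a n) * cinner x (e n)) (f n)))\<^sup>2 \<le> (M * norm x)\<^sup>2"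
    by (simp add: power_mult_distrib)
  then show "norm (\<Sum>n. cscale (of_real (a n) * cinner x (e n)) (f n)) \<le> M * norm x"
    by (rule power2_le_imp_le) (use M in simp)
qed

lemma
  assumes "diag_system a e f"
  shows diag_op_apply: "(diag_op a e f) x = (\<Sum>n. cscale (of_real (a n) * cinner x (e n)) (f n))"
    and diag_op_sums: "(\<lambda>n. cscale (of_real (a n) * cinner x (e n)) (f n)) sums (diag_op a e f) x"
proof -
  obtain M where M: "\<And>n. \<bar>a n\<bar> \<le> M" and o: "orthonormal_or_zero e" "orthonormal_or_zero f"
    using assms by (auto simp: diag_system_def)
  have s1: "summable (\<lambda>n. cscale (of_real (a n) * cinner x (e n)) (f n))" for x
    by (rule diag_series(1)[OF o]) (rule M)
  have s2: "norm (\<Sum>n. cscale (of_real (a n) * cinner x (e n)) (f n)) \<le> M * norm x" for x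
    by (rule diag_series(2)[OF o]) (rule M)
  have "bounded_linear (\<lambda>x. \<Sum>n. cscale (of_real (a n) * cinner x (e n)) (f n))"
  proof (rule bounded_linear_intro[of _ M])
    fix x y and r :: real
    show "(\<Sum>n. cscale (of_real (a n) * cinner (x + y) (e n)) (f n)) =
      (\<Sum>n. cscale (of_real (a n) * cinner x (e n)) (f n)) + (\<Sum>n. cscale (of_real (a n) * cinner y (e n)) (f n))"
      by (simp add: suminf_add[OF s1 s1] cinner_add_left distrib_left cscale_add_left)
    show "(\<Sum>n. cscale (of_real (a n) * cinner (r *\<^sub>R x) (e n)) (f n)) =
      r *\<^sub>R (\<Sum>n. cscale (of_real (a n) * cinner x (e n)) (f n))"
      by (simp add: bounded_linear.suminf[OF bounded_linear_cscale s1] cinner_cscale_left cscale_cscale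
        mult.left_commute flip: cscale_of_real)
    show "norm (\<Sum>n. cscale (of_real (a n) * cinner x (e n)) (f n)) \<le> norm x * M"
      using s2[of x] by (simp add: mult.commute)
  qed
  then show ap: "(diag_op a e f) x = (\<Sum>n. cscale (of_real (a n) * cinner x (e n)) (f n))"
    by (simp add: diag_op_def bounded_linear_Blinfun_apply)
  show "(\<lambda>n. cscale (of_real (a n) * cinner x (e n)) (f n)) sums (diag_op a e f) x"
    unfolding ap by (rule summable_sums[OF s1])
qed

lemma norm_diag_op_le:
  assumes "diag_system a e f" "\<And>n. \<bar>a n\<bar> \<le> M"
  shows "norm ((diag_op a e f) x) \<le> M * norm x"
  unfolding diag_op_apply[OF assms(1)]
  using assms by (intro diag_series) (auto simp: diag_system_def)

lemma carrier_BH: "T \<in> carrier BH \<longleftrightarrow> (\<forall>c x. T (cscale c x) = cscale c (T x))"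
  by (simp add: BH_def)

lemma diag_op_carrier: "diag_system a e f \<Longrightarrow> diag_op a e f \<in> carrier BH"
  unfolding carrier_BH
proof (intro allI)
  fix c x assume d: "diag_system a e f"
  show "(diag_op a e f) (cscale c x) = cscale c ((diag_op a e f) x)"
    unfolding diag_op_apply[OF d] bounded_linear.suminf[OF bounded_linear_cscale sums_summable[OF diag_op_sums[OF d]]]
    by (simp add: cinner_cscale_left cscale_cscale mult.left_commute)
qed

lemma diag_op_cinner:
  assumes "diag_system a e f"
  shows "cinner ((diag_op a e f) x) (f n) = (if f n = 0 then 0 else of_real (a n) * cinner x (e n))"
proof -
  have o: "orthonormal_or_zero f" using assms by (simp add: diag_system_def)
  have "(\<lambda>k. cinner (cscale (of_real (a k) * cinner x (e k)) (f k)) (f n)) sums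
      cinner ((diag_op a e f) x) (f n)"
    by (rule bounded_linear.sums[OF bounded_linear_cinner diag_op_sums[OF assms]])
  moreover have "(\<lambda>k. cinner (cscale (of_real (a k) * cinner x (e k)) (f k)) (f n)) =
      (\<lambda>k. if k = n then if f n = 0 then 0 else of_real (a n) * cinner x (e n) else 0)"
    by (auto simp: cinner_cscale_left orthonormal_or_zero_cinner[OF o])
  ultimately have "(\<lambda>k. if k = n then if f n = 0 then 0 else of_real (a n) * cinner x (e n) else 0) sums
      cinner ((diag_op a e f) x) (f n)"
    by simp
  from sums_unique2[OF this sums_single] show ?thesis .
qed

lemma diag_op_basis:
  assumes "diag_system a e f"
  shows "(diag_op a e f) (e n) = (if e n = 0 then 0 else cscale (of_real (a n)) (f n))"
proof -
  have o: "orthonormal_or_zero e" using assms by (simp add: diag_system_def)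
  have "(\<lambda>k. cscale (of_real (a k) * cinner (e n) (e k)) (f k)) =
      (\<lambda>k. if k = n then if e n = 0 then 0 else cscale (of_real (a n)) (f n) else 0)"
    by (auto simp: orthonormal_or_zero_cinner[OF o])
  then have "(\<lambda>k. if k = n then if e n = 0 then 0 else cscale (of_real (a n)) (f n) else 0) sums
      (diag_op a e f) (e n)"
    using diag_op_sums[OF assms, of "e n"] by simp
  from sums_unique2[OF this sums_single] show ?thesis .
qed

text \<open>A zero vector in the middle system f would lose its term, so it is allowed only where
  the product of the coefficients vanishes anyway.\<close>

lemma diag_op_comp:
  assumes "diag_system a e f" "diag_system b f h" "diag_system (\<lambda>n. b n * a n) e h"
    and "\<And>n. b n * a n \<noteq> 0 \<Longrightarrow> f n \<noteq> 0"
  shows "diag_op b f h o\<^sub>L diag_op a e f = diag_op (\<lambda>n. b n * a n) e h"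
proof (rule blinfun_eqI)
  fix x
  have "cscale (of_real (b n) * cinner ((diag_op a e f) x) (f n)) (h n) =
      cscale (of_real (b n * a n) * cinner x (e n)) (h n)" for n
    using assms(4)[of n] by (auto simp: diag_op_cinner[OF assms(1)])
  then show "(diag_op b f h o\<^sub>L diag_op a e f) x = (diag_op (\<lambda>n. b n * a n) e h) x"
    by (simp only: blinfun_apply_blinfun_compose diag_op_apply[OF assms(2)] diag_op_apply[OF assms(3)])
qed

lemma diag_op_adjoint:
  assumes "diag_system a e f"
  shows "cinner ((diag_op a e f) x) y = cinner x ((diag_op a f e) y)"
proof -
  have d: "diag_system a f e" using assms by (simp add: diag_system_def)
  have "(\<lambda>n. cinner (cscale (of_real (a n) * cinner x (e n)) (f n)) y) sums
      cinner ((diag_op a e f) x) y"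
    by (rule bounded_linear.sums[OF bounded_linear_cinner diag_op_sums[OF assms]])
  moreover have "(\<lambda>n. cinner x (cscale (of_real (a n) * cinner y (f n)) (e n))) sums
      cinner x ((diag_op a f e) y)"
    by (rule bounded_linear.sums[OF bounded_linear_cinner_right diag_op_sums[OF d]])
  moreover have "(\<lambda>n. cinner (cscale (of_real (a n) * cinner x (e n)) (f n)) y) =
      (\<lambda>n. cinner x (cscale (of_real (a n) * cinner y (f n)) (e n)))"
    by (auto simp: cinner_cscale_left cinner_cscale_right cinner_commute[of y])
  ultimately show ?thesis by (metis sums_unique2)
qed

text \<open>For series operators the adjoint is explicit: the two systems change places. As all
  compact operators are of this kind, no existence theorem for general adjoints is called
  for.\<close>

lemma hilbert_adjoint_diag_op:
  assumes "diag_system a e f"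
  shows "hilbert_adjoint (diag_op a e f) = diag_op a f e"
  unfolding hilbert_adjoint_def
proof (rule the_equality)
  show "\<forall>x y. cinner ((diag_op a e f) x) y = cinner x ((diag_op a f e) y)"
    using diag_op_adjoint[OF assms] by blast
  fix S assume "\<forall>x y. cinner ((diag_op a e f) x) y = cinner x (blinfun_apply S y)"
  then show "S = diag_op a f e"
    by (intro blinfun_eqI cinner_eqI) (simp add: diag_op_adjoint[OF assms])
qed

section \<open>Compact operators and singular values\<close>

lemma compact_opsI:
  assumes "T \<in> carrier BH" "compact K" "blinfun_apply T ` cball 0 1 \<subseteq> K"
  shows "T \<in> compact_ops"
proof -
  have "closure (blinfun_apply T ` cball 0 1) \<subseteq> K"
    using assms(2,3) by (intro closure_minimal compact_imp_closed)
  then show ?thesis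
    using assms(1) compact_Int_closed[OF assms(2), of "closure (blinfun_apply T ` cball 0 1)"]
    by (simp add: compact_ops_def Int_absorb1)
qed

lemma compact_ops_image:
  assumes "T \<in> compact_ops"
  obtains K where "compact K" "blinfun_apply T ` cball 0 1 \<subseteq> K"
  by (rule that[of "closure (blinfun_apply T ` cball 0 1)"])
    (use assms in \<open>simp_all add: compact_ops_def closure_subset\<close>)

lemma compact_ops_carrier: "T \<in> compact_ops \<Longrightarrow> T \<in> carrier BH"
  by (simp add: compact_ops_def)

lemma compact_ops_zero: "0 \<in> compact_ops"
  by (rule compact_opsI[of _ "{0}"]) (auto simp: carrier_BH)

lemma compact_ops_add:
  assumes "S \<in> compact_ops" "T \<in> compact_ops"
  shows "S + T \<in> compact_ops"
proof -
  obtain K where K: "compact K" "blinfun_apply S ` cball 0 1 \<subseteq> K" using compact_ops_image[OF assms(1)] .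
  obtain L where L: "compact L" "blinfun_apply T ` cball 0 1 \<subseteq> L" using compact_ops_image[OF assms(2)] .
  show ?thesis
  proof (rule compact_opsI[OF _ compact_sums[OF K(1) L(1)]])
    show "S + T \<in> carrier BH"
      using assms by (auto simp: carrier_BH cscale_add_right blinfun.add_left dest!: compact_ops_carrier)
    show "blinfun_apply (S + T) ` cball 0 1 \<subseteq> {x + y |x y. x \<in> K \<and> y \<in> L}"
    proof clarify
      fix x :: 'a assume "x \<in> cball 0 1"
      then have "S x \<in> K" "T x \<in> L" using K(2) L(2) by blast+
      then show "\<exists>y z. (S + T) x = y + z \<and> y \<in> K \<and> z \<in> L"
        by (auto simp: blinfun.add_left)
    qed
  qed
qed

lemma compact_ops_comp_left:
  assumes "T \<in> compact_ops" "A \<in> carrier BH"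
  shows "A o\<^sub>L T \<in> compact_ops"
proof -
  obtain K where K: "compact K" "blinfun_apply T ` cball 0 1 \<subseteq> K" using compact_ops_image[OF assms(1)] .
  have "compact (blinfun_apply A ` K)"
    by (intro compact_continuous_image[OF _ K(1)] linear_continuous_on blinfun.bounded_linear_right)
  then show ?thesis
    by (rule compact_opsI[rotated]) (use assms K(2) in \<open>auto simp: carrier_BH dest!: compact_ops_carrier\<close>)
qed

lemma compact_ops_comp_right:
  assumes "T \<in> compact_ops" "A \<in> carrier BH"
  shows "T o\<^sub>L A \<in> compact_ops"
proof -
  obtain K where K: "compact K" "blinfun_apply T ` cball 0 1 \<subseteq> K" using compact_ops_image[OF assms(1)] .
  define r where "r = norm A + 1"
  have r: "0 < r" by (simp add: r_def add_nonneg_pos)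
  show ?thesis
  proof (rule compact_opsI[OF _ compact_scaling[OF K(1), of r]])
    show "T o\<^sub>L A \<in> carrier BH" using assms by (auto simp: carrier_BH dest!: compact_ops_carrier)
    show "blinfun_apply (T o\<^sub>L A) ` cball 0 1 \<subseteq> (*\<^sub>R) r ` K"
    proof clarify
      fix x :: 'a assume x: "x \<in> cball 0 1"
      have "norm (A x) \<le> norm A * norm x" by (rule norm_blinfun)
      also have "\<dots> \<le> r" using x mult_left_le[of "norm x" "norm A"] by (simp add: r_def)
      finally have "(1 / r) *\<^sub>R A x \<in> cball 0 1" using r by simp
      then have "T ((1 / r) *\<^sub>R A x) \<in> K" using K(2) by blast
      moreover have "(T o\<^sub>L A) x = r *\<^sub>R T ((1 / r) *\<^sub>R A x)"
        using r by (simp add: blinfun.scaleR_right)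
      ultimately show "(T o\<^sub>L A) x \<in> (*\<^sub>R) r ` K" by blast
    qed
  qed
qed

definition rank_one :: "'a::chilbert_space \<Rightarrow> 'a \<Rightarrow> ('a \<Rightarrow>\<^sub>L 'a)" where
  "rank_one u v = Blinfun (\<lambda>x. cscale (cinner x u) v)"

lemma rank_one_apply: "(rank_one u v) x = cscale (cinner x u) v"
proof -
  have "bounded_linear (\<lambda>x. cscale (cinner x u) v)"
    by (rule bounded_linear_compose[OF bounded_linear_cscale_left bounded_linear_cinner])
  then show ?thesis by (simp only: rank_one_def bounded_linear_Blinfun_apply)
qed

lemma rank_one_compact: "rank_one u v \<in> compact_ops"
proof (rule compact_opsI[of _ "(\<lambda>c. cscale c v) ` cball 0 (norm u)"])
  show "rank_one u v \<in> carrier BH" by (simp add: carrier_BH rank_one_apply cinner_cscale_left cscale_cscale)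
  show "compact ((\<lambda>c. cscale c v) ` cball 0 (norm u))"
    by (intro compact_continuous_image compact_cball linear_continuous_on bounded_linear_cscale_left)
  have "cmod (cinner x u) \<le> norm u" if "norm x \<le> 1" for x
    using cmod_cinner_le[of x u] mult_right_mono[OF that norm_ge_zero[of u]] by simp
  then show "blinfun_apply (rank_one u v) ` cball 0 1 \<subseteq> (\<lambda>c. cscale c v) ` cball 0 (norm u)"
    by (auto simp: rank_one_apply)
qed

lemma compact_ops_uminus:
  assumes "T \<in> compact_ops"
  shows "- T \<in> compact_ops"
proof -
  have "- id_blinfun \<in> carrier BH" by (simp add: carrier_BH blinfun.minus_left)
  then have "(- id_blinfun) o\<^sub>L T \<in> compact_ops" by (rule compact_ops_comp_left[OF assms])
  moreover have "(- id_blinfun) o\<^sub>L T = - T" by (rule blinfun_eqI) (simp add: blinfun.minus_left)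
  ultimately show ?thesis by simp
qed

lemma compact_ops_diff: "S \<in> compact_ops \<Longrightarrow> T \<in> compact_ops \<Longrightarrow> S - T \<in> compact_ops"
  using compact_ops_add[OF _ compact_ops_uminus, of S T] by simp

text \<open>Total boundedness of the image of the ball passes to norm limits by an \<epsilon>/3
  argument, and completeness turns it back into compactness.\<close>

lemma compact_ops_approx:
  assumes "T \<in> carrier BH" and approx: "\<And>\<epsilon>. 0 < \<epsilon> \<Longrightarrow> \<exists>K\<in>compact_ops. \<forall>x. norm (T x - K x) \<le> \<epsilon> * norm x"
  shows "T \<in> compact_ops"
proof -
  have "\<exists>k. finite k \<and> closure (blinfun_apply T ` cball 0 1) \<subseteq> (\<Union>x\<in>k. ball x \<epsilon>)" if "0 < \<epsilon>" for \<epsilon>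
  proof -
    have "0 < \<epsilon> / 3" using that by simp
    obtain S where S: "S \<in> compact_ops" "\<And>x. norm (T x - S x) \<le> (\<epsilon> / 3) * norm x"
      using approx[OF \<open>0 < \<epsilon> / 3\<close>] by blast
    obtain K where K: "compact K" "blinfun_apply S ` cball 0 1 \<subseteq> K" using compact_ops_image[OF S(1)] .
    obtain k where k: "finite k" "K \<subseteq> (\<Union>x\<in>k. ball x (\<epsilon> / 3))"
      using K(1) \<open>0 < \<epsilon> / 3\<close> unfolding compact_eq_totally_bounded by blast
    have "closure (blinfun_apply T ` cball 0 1) \<subseteq> (\<Union>x\<in>k. ball x \<epsilon>)"
    proof
      fix y assume "y \<in> closure (blinfun_apply T ` cball 0 1)"
      then have "\<exists>z\<in>blinfun_apply T ` cball 0 1. dist z y < \<epsilon> / 3"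
        using \<open>0 < \<epsilon> / 3\<close> unfolding closure_approachable by blast
      then obtain x where x: "norm x \<le> 1" "dist (T x) y < \<epsilon> / 3"
        by (auto simp: mem_cball)
      have "S x \<in> K" using K(2) x(1) by auto
      then obtain z where z: "z \<in> k" "dist z (S x) < \<epsilon> / 3" using k(2) by auto
      have "dist (S x) (T x) \<le> \<epsilon> / 3"
        using order_trans[OF S(2)[of x] mult_left_le[OF x(1)]] that
        by (simp add: dist_norm norm_minus_commute)
      then have "dist z y < \<epsilon>"
        using dist_triangle[of z y "S x"] dist_triangle[of "S x" y "T x"] x(2) z(2)
        by linarith
      with z(1) show "y \<in> (\<Union>x\<in>k. ball x \<epsilon>)" by auto
    qed
    with k(1) show ?thesis by blast
  qed
  moreover have "complete (closure (blinfun_apply T ` cball 0 1))"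
    by (simp add: complete_eq_closed)
  ultimately have "compact (closure (blinfun_apply T ` cball 0 1))"
    unfolding compact_eq_totally_bounded by blast
  with assms(1) show ?thesis by (simp add: compact_ops_def)
qed

lemma diag_op_compact:
  assumes o: "orthonormal_or_zero e" "orthonormal_or_zero f" and a: "a \<longlonglongrightarrow> 0"
  shows "diag_system a e f" "diag_op a e f \<in> compact_ops"
proof -
  have "Bseq a" by (rule convergent_imp_Bseq[OF convergentI[OF a]])
  then obtain M where "\<And>n. \<bar>a n\<bar> \<le> M" unfolding Bseq_def real_norm_def by blast
  with o show d: "diag_system a e f" unfolding diag_system_def by blast
  have fin: "(\<Sum>n<N. rank_one (cscale (of_real (a n)) (e n)) (f n)) \<in> compact_ops" for N
    by (induction N) (simp_all add: compact_ops_add rank_one_compact compact_ops_zero)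
  show "diag_op a e f \<in> compact_ops"
  proof (rule compact_ops_approx[OF diag_op_carrier[OF d]])
    fix \<epsilon> :: real assume "0 < \<epsilon>"
    then obtain N where N: "\<And>n. N \<le> n \<Longrightarrow> \<bar>a n\<bar> \<le> \<epsilon>"
      using LIMSEQ_D[OF a, of \<epsilon>] by (auto intro: less_imp_le)
    \<comment> \<open>What is left after removing the rank-one terms below N is again a series
      operator, and its coefficients are at most \<epsilon>.\<close>
    define b where "b = (\<lambda>n. if n < N then 0 else a n)"
    have b: "\<bar>b n\<bar> \<le> \<epsilon>" for n using N \<open>0 < \<epsilon>\<close> by (auto simp: b_def)
    then have d': "diag_system b e f" using o by (auto simp: diag_system_def)
    have "(diag_op a e f) x - blinfun_apply (\<Sum>n<N. rank_one (cscale (of_real (a n)) (e n)) (f n)) x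
        = (diag_op b e f) x" for x
    proof -
      let ?t = "\<lambda>n. cscale (of_real (a n) * cinner x (e n)) (f n)"
      have "(\<lambda>n. if n < N then ?t n else 0) sums (\<Sum>n<N. ?t n)"
        using sums_If_finite[of "\<lambda>n. n < N" ?t] by (simp add: lessThan_def)
      from sums_diff[OF diag_op_sums[OF d, of x] this]
      have "(\<lambda>n. cscale (of_real (b n) * cinner x (e n)) (f n)) sums
          ((diag_op a e f) x - (\<Sum>n<N. ?t n))"
        by (rule back_subst[of "\<lambda>t. t sums _"]) (auto simp: b_def)
      from sums_unique2[OF this diag_op_sums[OF d', of x]] show ?thesis
        by (simp add: blinfun.sum_left rank_one_apply cinner_cscale_right)
    qed
    then show "\<exists>K\<in>compact_ops. \<forall>x. norm ((diag_op a e f) x - K x) \<le> \<epsilon> * norm x"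
      using norm_diag_op_le[OF d' b] fin by (intro bexI[of _ "\<Sum>n<N. rank_one (cscale (of_real (a n)) (e n)) (f n)"]) auto
  qed
qed

section \<open>Singular systems: uniqueness and existence\<close>

definition singular_system :: "('a::chilbert_space \<Rightarrow>\<^sub>L 'a) \<Rightarrow> (nat \<Rightarrow> real) \<Rightarrow> (nat \<Rightarrow> 'a) \<Rightarrow> (nat \<Rightarrow> 'a) \<Rightarrow> bool" where
  "singular_system T s e f \<longleftrightarrow> s \<in> c0_star \<and> orthonormal_or_zero e \<and> orthonormal_or_zero f \<and>
     (\<forall>n. 0 < s n \<longrightarrow> e n \<noteq> 0 \<and> f n \<noteq> 0) \<and> T = diag_op s e f"

lemma singular_systemD:
  assumes "singular_system T s e f"
  shows "s \<in> c0_star" "orthonormal_or_zero e" "orthonormal_or_zero f" "diag_system s e f" "T = diag_op s e f"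
    "T \<in> compact_ops"
    "s n \<noteq> 0 \<Longrightarrow> e n \<noteq> 0" "s n \<noteq> 0 \<Longrightarrow> f n \<noteq> 0"
  using assms diag_op_compact[of e f s] c0_starD(1)[of s n]
  by (auto simp: singular_system_def c0_starD(3) less_le)

lemma c0_star_finite_level:
  assumes "\<xi> \<in> c0_star" "0 < t"
  shows "finite {n. \<xi> n = t}"
proof -
  have "eventually (\<lambda>n. \<xi> n < t) sequentially"
    using c0_starD(3)[OF assms(1)] assms(2) by (rule order_tendstoD(2))
  then obtain N where "\<And>n. N \<le> n \<Longrightarrow> \<xi> n < t" unfolding eventually_sequentially by blast
  then have "{n. \<xi> n = t} \<subseteq> {..<N}" by (metis (mono_tags, lifting) lessThan_iff linorder_not_less mem_Collect_eq order_less_irrefl subsetI)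
  then show ?thesis by (rule finite_subset) simp
qed

text \<open>At the first disagreement n let t be the larger value. The other sequence can take the
  value t only before n, where both agree, so t has different multiplicities in the two. This is the
  uniqueness behind \<open>THE\<close> in \<open>singular_values\<close>.\<close>

lemma c0_star_eqI:
  assumes \<xi>: "\<xi> \<in> c0_star" and \<eta>: "\<eta> \<in> c0_star"
    and card: "\<And>t. 0 < t \<Longrightarrow> card {n. \<xi> n = t} = card {n. \<eta> n = t}"
  shows "\<xi> = \<eta>"
proof (rule ccontr)
  assume "\<xi> \<noteq> \<eta>"
  then obtain m where m: "\<xi> m \<noteq> \<eta> m" by auto
  define n where "n = (LEAST n. \<xi> n \<noteq> \<eta> n)"
  have n: "\<xi> n \<noteq> \<eta> n" unfolding n_def using m by (rule LeastI)
  have eq: "\<xi> k = \<eta> k" if "k < n" for k using not_less_Least[of k "\<lambda>n. \<xi> n \<noteq> \<eta> n"] that by (auto simp: n_def)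
  have *: False
    if \<alpha>: "\<alpha> \<in> c0_star" and \<beta>: "\<beta> \<in> c0_star" and "\<alpha> n < \<beta> n" and eq: "\<And>k. k < n \<Longrightarrow> \<alpha> k = \<beta> k"
      and card: "\<And>t. 0 < t \<Longrightarrow> card {n. \<alpha> n = t} = card {n. \<beta> n = t}" for \<alpha> \<beta> :: "nat \<Rightarrow> real"
  proof -
    have pos: "0 < \<beta> n" using \<open>\<alpha> n < \<beta> n\<close> c0_starD(1)[OF \<alpha>, of n] by linarith
    have "{k. \<alpha> k = \<beta> n} \<subset> {k. \<beta> k = \<beta> n}"
    proof
      show "{k. \<alpha> k = \<beta> n} \<subseteq> {k. \<beta> k = \<beta> n}"
      proof clarify
        fix k assume k: "\<alpha> k = \<beta> n"
        then have "k < n" using c0_starD(2)[OF \<alpha>, of n k] \<open>\<alpha> n < \<beta> n\<close> by force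
        then show "\<beta> k = \<beta> n" using eq k by simp
      qed
      have "n \<in> {k. \<beta> k = \<beta> n}" "n \<notin> {k. \<alpha> k = \<beta> n}" using \<open>\<alpha> n < \<beta> n\<close> by auto
      then show "{k. \<alpha> k = \<beta> n} \<noteq> {k. \<beta> k = \<beta> n}" by blast
    qed
    then have "card {k. \<alpha> k = \<beta> n} < card {k. \<beta> k = \<beta> n}"
      by (intro psubset_card_mono c0_star_finite_level \<beta> pos)
    with card[OF pos] show False by simp
  qed
  show False
    using n *[OF \<xi> \<eta> _ eq card] *[OF \<eta> \<xi> _ eq[symmetric] card[symmetric]] by (cases "\<xi> n < \<eta> n") auto
qed

text \<open>In the system e the operator T^* T is diagonal with entries (s n)^2. For t > 0 only
  finitely many s n equal t, so the series of an eigenvector is a finite sum and lies in the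
  algebraic span, without closure.\<close>

lemma eigenspace_diag_op:
  fixes T :: "'a::chilbert_space \<Rightarrow>\<^sub>L 'a"
  assumes s: "singular_system T s e f" and t: "0 < t"
  shows "{x. (hilbert_adjoint T o\<^sub>L T) x = cscale (of_real (t\<^sup>2)) x} =
    complex_vector.span (e ` {n. s n = t})"
proof -
  note D = singular_systemD[OF s]
  have de: "diag_system (\<lambda>n. s n * s n) e e" "diag_system s f e"
  proof -
    have "(\<lambda>n. s n * s n) \<longlonglongrightarrow> 0 * 0" by (intro tendsto_mult c0_starD(3)[OF D(1)])
    then show "diag_system (\<lambda>n. s n * s n) e e" using diag_op_compact(1)[OF D(2) D(2)] by simp
    show "diag_system s f e" using D(4) by (simp add: diag_system_def)
  qed
  have TT: "hilbert_adjoint T o\<^sub>L T = diag_op (\<lambda>n. s n * s n) e e"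
    unfolding D(5) hilbert_adjoint_diag_op[OF D(4)]
    by (rule diag_op_comp[OF D(4) de(2) de(1)]) (use D(8) in auto)
  have "x \<in> complex_vector.span (e ` {n. s n = t})"
    if x: "(diag_op (\<lambda>n. s n * s n) e e) x = cscale (of_real (t\<^sup>2)) x" for x
  proof -
    have coeff: "s n = t" if "of_real (s n * s n) * cinner x (e n) \<noteq> 0" for n
    proof -
      from that have n: "s n \<noteq> 0" "cinner x (e n) \<noteq> 0" by auto
      have "of_real (s n * s n) * cinner x (e n) = of_real (t\<^sup>2) * cinner x (e n)"
        using diag_op_cinner[OF de(1), of x n] D(7)[OF n(1)] unfolding x
        by (simp only: cinner_cscale_left if_False)
      then have "complex_of_real (s n * s n) = of_real (t\<^sup>2)" using n(2) by simp
      then have "s n * s n = t\<^sup>2" by (simp only: of_real_eq_iff)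
      then show "s n = t" using t c0_starD(1)[OF D(1), of n]
        by (simp add: power2_eq_square[symmetric])
    qed
    have "(\<lambda>n. cscale (of_real (s n * s n) * cinner x (e n)) (e n)) sums
        (\<Sum>n\<in>{n. s n = t}. cscale (of_real (s n * s n) * cinner x (e n)) (e n))"
      by (rule sums_finite[OF c0_star_finite_level[OF D(1) t]]) (use coeff in fastforce)
    from sums_unique2[OF this diag_op_sums[OF de(1)]]
    have "cscale (of_real (t\<^sup>2)) x = (\<Sum>n\<in>{n. s n = t}. cscale (of_real (s n * s n) * cinner x (e n)) (e n))"
      unfolding x by simp
    also have "\<dots> \<in> complex_vector.span (e ` {n. s n = t})"
      by (intro complex_vector.span_sum complex_vector.span_scale complex_vector.span_base) auto
    finally have "cscale (of_real (1 / t\<^sup>2)) (cscale (of_real (t\<^sup>2)) x) \<in> complex_vector.span (e ` {n. s n = t})"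
      by (rule complex_vector.span_scale)
    then show ?thesis using t by (simp add: cscale_cscale)
  qed
  moreover have "(diag_op (\<lambda>n. s n * s n) e e) x = cscale (of_real (t\<^sup>2)) x"
    if "x \<in> complex_vector.span (e ` {n. s n = t})" for x
    using that
  proof (induction rule: complex_vector.span_induct_alt)
    case base
    show ?case by (simp add: blinfun.zero_right)
  next
    case (step c v y)
    then obtain n where n: "v = e n" "s n = t" by auto
    have "(diag_op (\<lambda>n. s n * s n) e e) v = cscale (of_real (t\<^sup>2)) v"
      unfolding n diag_op_basis[OF de(1)] by (simp add: n power2_eq_square)
    then show ?case
      using step diag_op_carrier[OF de(1)]
      by (simp add: blinfun.add_right carrier_BH cscale_add_right cscale_cscale mult.commute)
  qed
  ultimately show ?thesis unfolding TT by blast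
qed

lemma dim_span_orthonormal:
  assumes o: "orthonormal_or_zero e" and A: "finite A" "\<And>n. n \<in> A \<Longrightarrow> e n \<noteq> 0"
  shows "complex_vector.dim (complex_vector.span (e ` A)) = card A"
proof -
  have inj: "inj_on e A"
  proof (rule inj_onI, rule ccontr)
    fix i j assume "i \<in> A" "j \<in> A" "e i = e j" "i \<noteq> j"
    then show False
      using orthonormal_or_zero_cinner[OF o, of i i] orthonormal_or_zero_cinner[OF o, of i j] A(2)[of i] by simp
  qed
  have "complex_vector.independent (e ` A)"
    unfolding complex_vector.dependent_finite[OF finite_imageI[OF A(1)]]
  proof clarify
    fix u n assume sum: "(\<Sum>v\<in>e ` A. cscale (u v) v) = 0" and n: "n \<in> A" "u (e n) \<noteq> 0"
    have "0 = cinner (\<Sum>i\<in>A. cscale (u (e i)) (e i)) (e n)"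
      using sum by (simp add: sum.reindex[OF inj])
    also have "\<dots> = (\<Sum>i\<in>A. if i = n then u (e n) else 0)"
      unfolding cinner_sum_left using A(2)
      by (intro sum.cong) (auto simp: cinner_cscale_left orthonormal_or_zero_cinner[OF o])
    also have "\<dots> = u (e n)" using A(1) n by simp
    finally show False using n(2) by simp
  qed
  then show ?thesis
    by (simp add: complex_vector.dim_eq_card_independent card_image[OF inj])
qed

lemma singular_values_eq:
  assumes "singular_system T s e f"
  shows "singular_values T = s"
proof -
  note D = singular_systemD[OF assms]
  have card: "card {n. s n = t} =
      complex_vector.dim {x. (hilbert_adjoint T o\<^sub>L T) x = cscale (of_real (t\<^sup>2)) x}"
    if "0 < t" for t
    unfolding eigenspace_diag_op[OF assms that]
    by (rule dim_span_orthonormal[OF D(2) c0_star_finite_level[OF D(1) that], symmetric])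
      (use D(7) that in auto)
  show ?thesis
    unfolding singular_values_def
  proof (rule the_equality)
    show "s \<in> c0_star \<and> (\<forall>t>0. card {n. s n = t} =
      complex_vector.dim {x. (hilbert_adjoint T o\<^sub>L T) x = cscale (of_real (t\<^sup>2)) x})"
      using D(1) card by blast
  qed (use D(1) card in \<open>auto intro!: c0_star_eqI\<close>)
qed

text \<open>The polynomial (norm T)^2 * (norm (e + t x))^2 - (norm (T (e + t x)))^2 in the real
  variable t is nonnegative and vanishes at t = 0, so its linear coefficient is 0. This is the
  eigenvalue equation for T^* T at e, stated without the adjoint.\<close>

lemma cinner_norm_attained:
  assumes T: "T \<in> carrier BH" and e: "norm e = 1" "norm (T e) = norm T"
  shows "cinner (T x) (T e) = of_real ((norm T)\<^sup>2) * cinner x e"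
proof -
  define s where "s = norm T"
  have re: "inner (T x) (T e) = s\<^sup>2 * inner x e" for x
  proof -
    define d where "d = inner (T x) (T e) - s\<^sup>2 * inner x e"
    \<comment> \<open>The summand 1 keeps K positive, so that t = d / K can be inserted.\<close>
    define K where "K = s\<^sup>2 * (norm x)\<^sup>2 + 1"
    have K: "0 < K" by (simp add: K_def add_nonneg_pos)
    have quad: "2 * t * d \<le> t\<^sup>2 * K" for t
    proof -
      have "norm (T (e + t *\<^sub>R x)) \<le> s * norm (e + t *\<^sub>R x)"
        unfolding s_def by (rule norm_blinfun)
      then have "(norm (T (e + t *\<^sub>R x)))\<^sup>2 \<le> (s * norm (e + t *\<^sub>R x))\<^sup>2"
        by (rule power_mono) simp
      then have "(norm (T e + t *\<^sub>R T x))\<^sup>2 \<le> s\<^sup>2 * (norm (e + t *\<^sub>R x))\<^sup>2"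
        by (simp add: blinfun.add_right blinfun.scaleR_right power_mult_distrib)
      moreover have expand: "(norm (a + t *\<^sub>R b))\<^sup>2 = (norm a)\<^sup>2 + 2 * t * inner b a + t\<^sup>2 * (norm b)\<^sup>2" for a b :: 'a
        unfolding power2_norm_eq_inner
        by (simp add: inner_add_left inner_add_right inner_commute[of a b] power2_eq_square algebra_simps)
      ultimately have "s\<^sup>2 + 2 * t * inner (T x) (T e) + t\<^sup>2 * (norm (T x))\<^sup>2
          \<le> s\<^sup>2 * (1 + 2 * t * inner x e + t\<^sup>2 * (norm x)\<^sup>2)"
        unfolding expand by (simp add: e s_def)
      moreover have "0 \<le> t\<^sup>2 * (norm (T x))\<^sup>2" by simp
      ultimately have "2 * t * inner (T x) (T e) \<le>
          s\<^sup>2 * (1 + 2 * t * inner x e + t\<^sup>2 * (norm x)\<^sup>2) - s\<^sup>2"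
        by linarith
      then have "2 * t * d \<le> t\<^sup>2 * (s\<^sup>2 * (norm x)\<^sup>2)" by (simp add: d_def algebra_simps)
      also have "\<dots> \<le> t\<^sup>2 * K" by (intro mult_left_mono) (auto simp: K_def)
      finally show ?thesis .
    qed
    have "2 * (d / K) * d \<le> (d / K)\<^sup>2 * K" by (rule quad)
    also have "\<dots> = d * d / K" using K by (simp add: power2_eq_square)
    finally have "d * d \<le> 0" using K by (simp add: field_simps)
    then have "d = 0" by (metis mult_eq_0_iff not_square_less_zero order_le_less)
    then show ?thesis by (simp add: d_def)
  qed
  have "Re (cinner (T x) (T e)) = s\<^sup>2 * Re (cinner x e)"
    by (simp only: Re_cinner re)
  \<comment> \<open>Inserting \<i> x into the real identity yields the imaginary parts.\<close>
  moreover have "Re (cinner (T (cscale \<i> x)) (T e)) = s\<^sup>2 * Re (cinner (cscale \<i> x) e)"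
    by (simp only: Re_cinner re)
  then have "Im (cinner (T x) (T e)) = s\<^sup>2 * Im (cinner x e)"
    using T by (simp add: carrier_BH cinner_cscale_left)
  ultimately show ?thesis by (simp add: complex_eq_iff s_def)
qed

text \<open>
  By the parallelogram law, a maximising sequence in the unit ball is Cauchy as soon as its image
  converges, so that weak compactness is not needed.
\<close>

lemma compact_norm_attained:
  assumes T: "T \<in> compact_ops" and "T \<noteq> 0"
  obtains e where "norm e = 1" "norm (T e) = norm T"
proof -
  define s where "s = norm T"
  have s: "0 < s" using assms by (simp add: s_def)
  obtain K where K: "compact K" "blinfun_apply T ` cball 0 1 \<subseteq> K" using compact_ops_image[OF T] .
  have "\<exists>x. norm x \<le> 1 \<and> s - 1 / real (Suc n) < norm (T x)" for n
  proof (rule ccontr)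
    assume "\<not> ?thesis"
    then have le: "norm (T x) \<le> max 0 (s - 1 / real (Suc n))" if "norm x \<le> 1" for x
      using that by (meson le_max_iff_disj not_less)
    have "norm T \<le> max 0 (s - 1 / real (Suc n))"
    proof (rule norm_blinfun_bound)
      fix x
      show "norm (T x) \<le> max 0 (s - 1 / real (Suc n)) * norm x"
      proof (cases "x = 0")
        case False
        have "norm (T ((1 / norm x) *\<^sub>R x)) \<le> max 0 (s - 1 / real (Suc n))"
          by (rule le) (use False in simp)
        then show ?thesis using False by (simp add: blinfun.scaleR_right field_simps)
      qed (simp add: blinfun.zero_right)
    qed simp
    then have "s \<le> 0 \<or> s \<le> s - 1 / real (Suc n)" by (simp only: le_max_iff_disj s_def)
    moreover have "0 < 1 / real (Suc n)" by simp
    ultimately show False using s by linarith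
  qed
  then obtain x where x: "\<And>n. norm (x n) \<le> 1" "\<And>n. s - 1 / real (Suc n) < norm (T (x n))"
    by metis
  have "\<forall>n. T (x n) \<in> K" using x(1) K(2) by auto
  then obtain y r where r: "strict_mono r" and "((\<lambda>n. T (x n)) \<circ> r) \<longlonglongrightarrow> y"
    using seq_compactE[OF compact_imp_seq_compact[OF K(1)]] by metis
  then have y: "(\<lambda>n. T (x (r n))) \<longlonglongrightarrow> y" by (simp add: o_def)
  have norm_le: "norm (T v) \<le> s * norm v" for v unfolding s_def by (rule norm_blinfun)
  have norm_y: "norm y = s"
  proof (rule LIMSEQ_unique[OF tendsto_norm[OF y]])
    show "(\<lambda>n. norm (T (x (r n)))) \<longlonglongrightarrow> s"
    proof (rule real_tendsto_sandwich)
      have "(\<lambda>n. s - 1 / real (Suc n)) \<longlonglongrightarrow> s - 0" by (intro tendsto_diff tendsto_const LIMSEQ_Suc lim_1_over_n)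
      from LIMSEQ_subseq_LIMSEQ[OF this r] show "(\<lambda>n. s - 1 / real (Suc (r n))) \<longlonglongrightarrow> s" by (simp add: o_def)
      show "(\<lambda>n. s) \<longlonglongrightarrow> s" by simp
      show "\<forall>\<^sub>F n in sequentially. s - 1 / real (Suc (r n)) \<le> norm (T (x (r n)))"
        using x(2) by (intro always_eventually allI less_imp_le)
      show "\<forall>\<^sub>F n in sequentially. norm (T (x (r n))) \<le> s"
      proof (intro always_eventually allI)
        fix n
        show "norm (T (x (r n))) \<le> s"
          using order_trans[OF norm_le mult_left_le[OF x(1)]] s by simp
      qed
    qed
  qed
  have "Cauchy (\<lambda>n. x (r n))"
  proof (rule metric_CauchyI)
    fix \<epsilon> :: real assume \<epsilon>: "0 < \<epsilon>"
    \<comment> \<open>The bound by s keeps 2 * s - 2 * \<delta> nonnegative, so that the inequality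
      can be squared; the other makes 8 * \<delta> at most s * \<epsilon>^2 / 2 in the end.\<close>
    define \<delta> where "\<delta> = min s (s * \<epsilon>\<^sup>2 / 16)"
    have \<delta>: "0 < \<delta>" "\<delta> \<le> s" "\<delta> \<le> s * \<epsilon>\<^sup>2 / 16" using s \<epsilon> by (auto simp: \<delta>_def)
    obtain N where N: "\<And>n. N \<le> n \<Longrightarrow> dist (T (x (r n))) y < \<delta>"
      using metric_LIMSEQ_D[OF y \<delta>(1)] by blast
    have "dist (x (r m)) (x (r n)) < \<epsilon>" if "N \<le> m" "N \<le> n" for m n
    proof -
      let ?u = "x (r m)" and ?v = "x (r n)"
      have "norm (y + y) \<le> norm (T ?u + T ?v) +
          norm ((y - T ?u) + (y - T ?v))"
        using norm_triangle_ineq[of "T ?u + T ?v" "(y - T ?u) + (y - T ?v)"]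
        by (simp add: algebra_simps)
      also have "norm ((y - T ?u) + (y - T ?v)) \<le> 2 * \<delta>"
        using norm_triangle_ineq[of "y - T ?u" "y - T ?v"] N[OF that(1)] N[OF that(2)]
        by (simp add: dist_norm norm_minus_commute)
      also have "norm (T ?u + T ?v) \<le> s * norm (?u + ?v)"
        using norm_le[of "?u + ?v"] by (simp add: blinfun.add_right)
      finally have "2 * s - 2 * \<delta> \<le> s * norm (?u + ?v)"
        by (simp add: norm_y flip: scaleR_2)
      then have "(2 * s - 2 * \<delta>)\<^sup>2 \<le> (s * norm (?u + ?v))\<^sup>2" using \<delta> by (intro power_mono) auto
      then have "4 * s\<^sup>2 + 4 * \<delta>\<^sup>2 - 8 * s * \<delta> \<le> s\<^sup>2 * (norm (?u + ?v))\<^sup>2"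
        by (simp add: power2_diff power_mult_distrib)
      moreover have "0 \<le> \<delta>\<^sup>2" by simp
      ultimately have "4 * s\<^sup>2 - 8 * s * \<delta> \<le> s\<^sup>2 * (norm (?u + ?v))\<^sup>2" by linarith
      moreover have "(norm (?u + ?v))\<^sup>2 + (norm (?u - ?v))\<^sup>2 = 2 * (norm ?u)\<^sup>2 + 2 * (norm ?v)\<^sup>2"
        by (simp add: power2_norm_eq_inner inner_add_left inner_add_right inner_diff_left inner_diff_right)
      then have "(norm (?u + ?v))\<^sup>2 \<le> 4 - (norm (?u - ?v))\<^sup>2"
        using power_le_one[OF norm_ge_zero x(1), of "r m" 2] power_le_one[OF norm_ge_zero x(1), of "r n" 2] by simp
      then have "s\<^sup>2 * (norm (?u + ?v))\<^sup>2 \<le> s\<^sup>2 * (4 - (norm (?u - ?v))\<^sup>2)" by (rule mult_left_mono) simp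
      ultimately have "s * (s * (norm (?u - ?v))\<^sup>2) \<le> s * (8 * \<delta>)" by (simp add: algebra_simps power2_eq_square)
      then have "s * (norm (?u - ?v))\<^sup>2 \<le> 8 * \<delta>" using s by simp
      also have "\<dots> \<le> s * (\<epsilon>\<^sup>2 / 2)" using \<delta> by simp
      finally have "(norm (?u - ?v))\<^sup>2 \<le> \<epsilon>\<^sup>2 / 2" using s by simp
      also have "\<dots> < \<epsilon>\<^sup>2" using \<epsilon> by simp
      finally show ?thesis using \<epsilon> by (simp add: dist_norm power_less_imp_less_base)
    qed
    then show "\<exists>M. \<forall>m\<ge>M. \<forall>n\<ge>M. dist (x (r m)) (x (r n)) < \<epsilon>" by blast
  qed
  then obtain e where e: "(\<lambda>n. x (r n)) \<longlonglongrightarrow> e" using Cauchy_convergent convergentD by blast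
  have "(\<lambda>n. T (x (r n))) \<longlonglongrightarrow> T e" by (intro tendsto_intros e)
  then have Te: "norm (T e) = s" using LIMSEQ_unique[OF y] norm_y by auto
  moreover have "norm e \<le> 1" using tendsto_norm[OF e] x(1) by (intro LIMSEQ_le_const2[of "\<lambda>n. norm (x (r n))"]) auto
  moreover have "1 \<le> norm e" using norm_le[of e] Te s by simp
  ultimately show thesis using that[of e] by (simp add: s_def)
qed

text \<open>Each step splits off a vector at which the norm of the remaining operator is attained.\<close>

lemma singular_system_exists:
  fixes T :: "'a::chilbert_space \<Rightarrow>\<^sub>L 'a"
  assumes T: "T \<in> compact_ops"
  obtains s e f where "singular_system T s e f"
proof -
  \<comment> \<open>The value 0 for R = 0 lets the recursion run on after an operator of finite rank
    is exhausted.\<close>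
  define top where "top = (\<lambda>R :: 'a \<Rightarrow>\<^sub>L 'a. SOME e. if R = 0 then e = 0 else norm e = 1 \<and> norm (blinfun_apply R e) = norm R)"
  have top: "if R = 0 then top R = 0 else norm (top R) = 1 \<and> norm (R (top R)) = norm R"
    if "R \<in> compact_ops" for R
  proof -
    have "\<exists>e. if R = 0 then e = 0 else norm e = 1 \<and> norm (R e) = norm R"
      using compact_norm_attained[OF that] by (metis (full_types))
    then show ?thesis unfolding top_def by (rule someI_ex)
  qed
  \<comment> \<open>For R \<noteq> 0 this is R after the orthogonal projection off the line spanned
    by \<open>top R\<close>.\<close>
  define next_op where "next_op = (\<lambda>R. R - rank_one (top R) (R (top R)))"
  define R where "R = (\<lambda>n. (next_op ^^ n) T)"
  define e where "e = (\<lambda>n. top (R n))"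
  define s where "s = (\<lambda>n. norm (R n))"
  define f where "f = (\<lambda>n. (1 / s n) *\<^sub>R (R n) (e n))"
  have R0: "R 0 = T" by (simp add: R_def)
  have R_Suc: "(R (Suc n)) x = (R n) x - cscale (cinner x (e n)) ((R n) (e n))" for n x
    by (simp add: R_def next_op_def e_def blinfun.diff_left rank_one_apply)
  have Rc: "R n \<in> compact_ops" for n
    by (induction n) (auto simp: R_def T next_op_def intro: compact_ops_diff rank_one_compact)
  have e0: "e n = 0" if "s n = 0" for n using top[OF Rc[of n]] that by (simp add: s_def e_def)
  have e1: "norm (e n) = 1" "norm ((R n) (e n)) = s n" if "s n \<noteq> 0" for n
    using top[OF Rc[of n]] that by (auto simp: s_def e_def)
  have s0: "0 \<le> s n" for n by (simp add: s_def)
  have R_zero: "s n = 0 \<Longrightarrow> (R n) x = 0" for n x by (simp add: s_def)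
  have cin: "cinner ((R n) x) ((R n) (e n)) = of_real ((s n)\<^sup>2) * cinner x (e n)" for n x
  proof (cases "s n = 0")
    case False
    then show ?thesis
      unfolding s_def using e1[OF False] Rc[of n]
      by (intro cinner_norm_attained) (auto simp: s_def dest: compact_ops_carrier)
  qed (simp add: R_zero)
  have ker: "cinner x (e n) = 0" if "(R n) x = 0" for n x
    using cin[of n x] that e0[of n] by auto
  have R_e: "(R (Suc n)) (e n) = 0" for n
  proof (cases "s n = 0")
    case True
    then show ?thesis by (simp add: e0 blinfun.zero_right)
  next
    case False
    then show ?thesis by (simp add: R_Suc cinner_self e1)
  qed
  \<comment> \<open>Vectors already split off stay in the kernel: by \<open>ker\<close> such a
    vector is orthogonal to e n, so the next correction vanishes on it.\<close>
  have R_old: "(R n) (e k) = 0" if "k < n" for k n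
    using that
  proof (induction n)
    case (Suc n)
    show ?case
    proof (cases "k = n")
      case True
      then show ?thesis by (simp add: R_e)
    next
      case False
      then have "(R n) (e k) = 0" using Suc by simp
      then show ?thesis using ker[of n "e k"] by (simp add: R_Suc)
    qed
  qed simp
  have e_orth: "cinner (e i) (e j) = 0" if "i \<noteq> j" for i j
    using ker[OF R_old[of i j]] ker[OF R_old[of j i]] that cinner_commute_zero[of "e i" "e j"]
    by (cases "i < j") auto
  have oe: "orthonormal_or_zero e"
    unfolding orthonormal_or_zero_def using e_orth e0 e1(1) by metis
  have T_e: "(R n) (e j) = T (e j)" if "n \<le> j" for n j
    using that by (induction n) (simp_all add: R0 R_Suc e_orth)
  have s_f: "s n *\<^sub>R f n = T (e n)" for n
    using T_e[of n n] R_zero[of n] by (cases "s n = 0") (simp_all add: f_def e0 blinfun.zero_right)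
  have s_Suc: "s (Suc n) \<le> s n" for n
    unfolding s_def
  proof (rule norm_blinfun_bound)
    fix x
    have "(norm (x - cscale (cinner x (e n)) (e n)))\<^sup>2 + (cmod (cinner x (e n)))\<^sup>2 = (norm x)\<^sup>2"
      using Bessel_identity[OF oe, of "{n}" x] by simp
    moreover have "0 \<le> (cmod (cinner x (e n)))\<^sup>2" by simp
    ultimately have "(norm (x - cscale (cinner x (e n)) (e n)))\<^sup>2 \<le> (norm x)\<^sup>2" by linarith
    then have le: "norm (x - cscale (cinner x (e n)) (e n)) \<le> norm x" by (rule power2_le_imp_le) simp
    have "(R (Suc n)) x = (R n) (x - cscale (cinner x (e n)) (e n))"
      using compact_ops_carrier[OF Rc[of n]] by (simp add: R_Suc blinfun.diff_right carrier_BH)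
    also have "norm \<dots> \<le> norm (R n) * norm (x - cscale (cinner x (e n)) (e n))" by (rule norm_blinfun)
    also have "\<dots> \<le> norm (R n) * norm x" by (intro mult_left_mono le) simp
    finally show "norm ((R (Suc n)) x) \<le> norm (R n) * norm x" .
  qed simp
  have s_dec: "s n \<le> s m" if "m \<le> n" for m n using s_Suc that by (rule lift_Suc_antimono_le)
  have Te_orth: "cinner (T (e i)) (T (e j)) = 0" if "j < i" for i j
    using cin[of j "e i"] e_orth[of i j] that by (simp add: T_e)
  have Te_orth': "cinner (T (e i)) (T (e j)) = 0" if "i \<noteq> j" for i j
    using Te_orth[of i j] Te_orth[of j i] that cinner_commute_zero[of "T (e i)"]
    by (cases "i < j") auto
  have f_norm: "norm (f n) = 1" if "s n \<noteq> 0" for n using e1(2)[OF that] that s0[of n] by (simp add: f_def)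
  have f_eq: "f n = cscale (of_real (1 / s n)) (T (e n))" for n
    by (simp add: f_def T_e cscale_of_real del: of_real_divide)
  have of': "orthonormal_or_zero f"
    unfolding orthonormal_or_zero_def
  proof (intro conjI allI impI)
    show "cinner (f i) (f j) = 0" if "i \<noteq> j" for i j
      using Te_orth'[OF that] by (simp add: f_eq cinner_cscale_left cinner_cscale_right del: of_real_divide)
    show "f i = 0 \<or> norm (f i) = 1" for i using f_norm[of i] by (cases "s i = 0") (simp_all add: f_def)
  qed
  \<comment> \<open>If s stayed above some c > 0, the vectors T (e n) would be pairwise orthogonal
    with norms at least c, and none of their subsequences could converge, against
    compactness.\<close>
  have s_lim: "s \<longlonglongrightarrow> 0"
  proof (rule ccontr)
    assume nl: "\<not> s \<longlonglongrightarrow> 0"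
    have "\<exists>c>0. \<forall>n. c \<le> s n"
    proof (rule ccontr)
      assume "\<not> ?thesis"
      then have small: "\<exists>N. s N < c" if "0 < c" for c using that by (meson not_less)
      have "s \<longlonglongrightarrow> 0"
      proof (rule LIMSEQ_I)
        fix r :: real assume "0 < r"
        then obtain N where "s N < r" using small by blast
        then have "norm (s n - 0) < r" if "N \<le> n" for n
          using order_le_less_trans[OF s_dec[OF that]] s0[of n] by simp
        then show "\<exists>N. \<forall>n\<ge>N. norm (s n - 0) < r" by blast
      qed
      with nl show False by simp
    qed
    then obtain c where c: "0 < c" "\<And>n. c \<le> s n" by blast
    have sn: "s n \<noteq> 0" for n using c(1) c(2)[of n] by linarith
    obtain K where K: "compact K" "blinfun_apply T ` cball 0 1 \<subseteq> K" using compact_ops_image[OF T] .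
    have "\<forall>n. T (e n) \<in> K" using K(2) e1(1)[OF sn] by auto
    then obtain y r where r: "strict_mono r" and "((\<lambda>n. T (e n)) \<circ> r) \<longlonglongrightarrow> y"
      using seq_compactE[OF compact_imp_seq_compact[OF K(1)]] by metis
    then have "Cauchy (\<lambda>n. T (e (r n)))" using LIMSEQ_imp_Cauchy by (auto simp: o_def)
    then obtain N where N: "\<And>m n. N \<le> m \<Longrightarrow> N \<le> n \<Longrightarrow> dist (T (e (r m))) (T (e (r n))) < c"
      using metric_CauchyD[OF _ c(1)] by metis
    define i j where "i = r N" and "j = r (Suc N)"
    have ij: "i \<noteq> j" using r by (simp add: i_def j_def strict_mono_eq)
    have "norm (T (e i)) = s i" using e1(2)[OF sn[of i]] by (simp add: T_e)
    have "inner (T (e i)) (T (e j)) = 0"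
      using Te_orth'[OF ij] by (simp flip: Re_cinner)
    then have "(norm (T (e i) - T (e j)))\<^sup>2
        = (norm (T (e i)))\<^sup>2 + (norm (T (e j)))\<^sup>2"
      unfolding power2_norm_eq_inner by (simp add: inner_diff_left inner_diff_right inner_commute)
    then have "c\<^sup>2 \<le> (norm (T (e i) - T (e j)))\<^sup>2"
      using power_mono[OF c(2)[of i], of 2] c(1) \<open>norm (T (e i)) = s i\<close> by (simp add: add_increasing2)
    then have "c \<le> norm (T (e i) - T (e j))" by (rule power2_le_imp_le) simp
    with N[of N "Suc N"] show False by (simp add: i_def j_def dist_norm)
  qed
  have sc: "s \<in> c0_star" by (rule c0_starI) (use s0 s_dec s_lim in auto)
  have d: "diag_system s e f" by (rule diag_op_compact(1)[OF oe of' s_lim])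
  have R_eq: "(R n) x = T x - (\<Sum>k<n. cscale (of_real (s k) * cinner x (e k)) (f k))" for n x
  proof (induction n)
    case (Suc n)
    have "cscale (cinner x (e n)) ((R n) (e n)) = cscale (of_real (s n) * cinner x (e n)) (f n)"
      unfolding T_e[of n n, OF order_refl] s_f[symmetric] cscale_of_real[symmetric] by (simp add: cscale_cscale mult.commute)
    with Suc show ?case by (simp add: R_Suc)
  qed (simp add: R0)
  have "T = diag_op s e f"
  proof (rule blinfun_eqI)
    fix x
    have "(\<lambda>n. (R n) x) \<longlonglongrightarrow> 0"
    proof (rule Lim_null_comparison)
      show "\<forall>\<^sub>F n in sequentially. norm ((R n) x) \<le> s n * norm x"
        by (intro always_eventually allI) (simp add: s_def norm_blinfun)
      show "(\<lambda>n. s n * norm x) \<longlonglongrightarrow> 0" using tendsto_mult_left_zero[OF s_lim] .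
    qed
    then have "(\<lambda>n. \<Sum>k<n. cscale (of_real (s k) * cinner x (e k)) (f k)) \<longlonglongrightarrow> T x"
      using tendsto_diff[OF tendsto_const[of "T x"], of "\<lambda>n. (R n) x" 0 sequentially]
      by (simp add: R_eq)
    then show "T x = (diag_op s e f) x"
      using sums_unique2[OF _ diag_op_sums[OF d, of x]] by (simp add: sums_def)
  qed
  moreover have "e n \<noteq> 0 \<and> f n \<noteq> 0" if "0 < s n" for n
    using e1(1)[of n] f_norm[of n] that by auto
  ultimately have "singular_system T s e f"
    unfolding singular_system_def using sc oe of' by blast
  then show thesis by (rule that)
qed

lemma singular_values_system:
  assumes "T \<in> compact_ops"
  obtains e f where "singular_system T (singular_values T) e f"
  using singular_system_exists[OF assms] singular_values_eq by metis

lemma singular_values_c0_star: "T \<in> compact_ops \<Longrightarrow> singular_values T \<in> c0_star"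
  by (metis singular_values_system singular_systemD(1))

section \<open>Min-max estimates for singular values\<close>

lemma underdetermined_system:
  fixes a :: "'i \<Rightarrow> 'j \<Rightarrow> complex"
  assumes "finite I" "finite J" "card I < card J"
  shows "\<exists>x. (\<exists>j\<in>J. x j \<noteq> 0) \<and> (\<forall>i\<in>I. (\<Sum>j\<in>J. a i j * x j) = 0)"
  using assms
proof (induction I arbitrary: a J rule: finite_induct)
  case empty
  then have "J \<noteq> {}" by auto
  then show ?case by (intro exI[of _ "\<lambda>_. 1"]) auto
next
  case (insert i I)
  show ?case
  proof (cases "\<forall>j\<in>J. a i j = 0")
    case True
    have "card I < card J" using insert by simp
    from insert.IH[OF insert.prems(1) this, of a] obtain x
      where "\<exists>j\<in>J. x j \<noteq> 0" "\<forall>i\<in>I. (\<Sum>j\<in>J. a i j * x j) = 0" by blast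
    then show ?thesis using True by (intro exI[of _ x]) auto
  next
    case False
    then obtain p where p: "p \<in> J" "a i p \<noteq> 0" by auto
    define J' where "J' = J - {p}"
    have J': "finite J'" "card I < card J'" "p \<notin> J'" "J = insert p J'"
      using insert p by (auto simp: J'_def)
    \<comment> \<open>Gaussian elimination: equation i is used to eliminate the unknown p, and y
      restores its value.\<close>
    define b where "b = (\<lambda>k j. a k j - a k p * a i j / a i p)"
    from insert.IH[OF J'(1,2), of b] obtain x
      where x: "\<exists>j\<in>J'. x j \<noteq> 0" "\<forall>k\<in>I. (\<Sum>j\<in>J'. b k j * x j) = 0" by blast
    define S where "S = (\<Sum>j\<in>J'. a i j * x j)"
    define y where "y = x(p := - S / a i p)"
    have sum_y: "(\<Sum>j\<in>J. a k j * y j) = a k p * (- S / a i p) + (\<Sum>j\<in>J'. a k j * x j)" for k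
    proof -
      have "(\<Sum>j\<in>J'. a k j * y j) = (\<Sum>j\<in>J'. a k j * x j)"
        using J'(3) by (intro sum.cong) (auto simp: y_def)
      then show ?thesis using J'(1,3) by (simp add: J'(4) y_def)
    qed
    have "(\<Sum>j\<in>J. a k j * y j) = 0" if "k \<in> insert i I" for k
    proof (cases "k = i")
      case True
      then show ?thesis using p(2) by (simp add: sum_y S_def)
    next
      case False
      with that x(2) have "0 = (\<Sum>j\<in>J'. b k j * x j)" by simp
      also have "\<dots> = (\<Sum>j\<in>J'. a k j * x j) - a k p * S / a i p"
        by (simp add: b_def S_def left_diff_distrib sum_subtractf sum_distrib_left sum_divide_distrib mult.assoc)
      finally show ?thesis by (simp add: sum_y)
    qed
    moreover have "\<exists>j\<in>J. y j \<noteq> 0" using x(1) J'(3,4) by (auto simp: y_def)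
    ultimately show ?thesis by blast
  qed
qed

definition clinear_functional :: "('a::chilbert_space \<Rightarrow> complex) \<Rightarrow> bool" where
  "clinear_functional \<phi> \<longleftrightarrow> (\<forall>x y. \<phi> (x + y) = \<phi> x + \<phi> y) \<and> (\<forall>c x. \<phi> (cscale c x) = c * \<phi> x)"

lemma clinear_functional_sum:
  assumes "clinear_functional \<phi>"
  shows "\<phi> (\<Sum>i\<in>A. cscale (c i) (g i)) = (\<Sum>i\<in>A. c i * \<phi> (g i))"
proof -
  have "\<phi> 0 = 0" using assms unfolding clinear_functional_def by (metis add_cancel_right_right)
  then show ?thesis
    using assms by (induction A rule: infinite_finite_induct) (auto simp: clinear_functional_def)
qed

text \<open>
  A min-max characterisation of the singular values. Functionals instead of vectors spare the
  adjoint of an arbitrary bounded operator in the estimate for products.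
\<close>

definition bounded_off :: "nat \<Rightarrow> real \<Rightarrow> ('a::chilbert_space \<Rightarrow>\<^sub>L 'a) \<Rightarrow> bool" where
  "bounded_off n c T \<longleftrightarrow> (\<exists>\<Phi>. finite \<Phi> \<and> card \<Phi> \<le> n \<and> (\<forall>\<phi>\<in>\<Phi>. clinear_functional \<phi>) \<and>
     (\<forall>x. (\<forall>\<phi>\<in>\<Phi>. \<phi> x = 0) \<longrightarrow> norm (T x) \<le> c * norm x))"

text \<open>The functionals are the coefficients along the first n vectors of e; where they vanish,
  only terms with singular values at most s n remain in the series.\<close>

lemma bounded_off_singular_values:
  assumes "T \<in> compact_ops"
  shows "bounded_off n (singular_values T n) T"
proof -
  define s where "s = singular_values T"
  obtain e f where S: "singular_system T s e f" using singular_values_system[OF assms] by (auto simp: s_def)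
  note D = singular_systemD[OF S]
  define \<Phi> where "\<Phi> = (\<lambda>i x. cinner x (e i)) ` {..<n}"
  have "finite \<Phi>" "card \<Phi> \<le> n" using card_image_le[of "{..<n}"] by (auto simp: \<Phi>_def)
  moreover have "\<forall>\<phi>\<in>\<Phi>. clinear_functional \<phi>"
    by (auto simp: \<Phi>_def clinear_functional_def cinner_add_left cinner_cscale_left)
  moreover have "norm (T x) \<le> s n * norm x" if "\<forall>\<phi>\<in>\<Phi>. \<phi> x = 0" for x
  proof -
    define b where "b = (\<lambda>i. if i < n then 0 else s i)"
    have b: "\<bar>b i\<bar> \<le> s n" for i using c0_starD(1,2)[OF D(1)] by (auto simp: b_def)
    then have d: "diag_system b e f" using D(2,3) by (auto simp: diag_system_def)
    have "(\<lambda>i. cscale (of_real (s i) * cinner x (e i)) (f i)) = (\<lambda>i. cscale (of_real (b i) * cinner x (e i)) (f i))"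
      using that by (auto simp: b_def \<Phi>_def)
    then have "T x = (diag_op b e f) x"
      by (simp only: D(5) diag_op_apply[OF D(4)] diag_op_apply[OF d])
    then show ?thesis using norm_diag_op_le[OF d b] by simp
  qed
  ultimately show ?thesis unfolding bounded_off_def s_def by blast
qed

text \<open>If c < s n, some nonzero combination v of the n + 1 vectors e 0, ..., e n is annihilated
  by the at most n functionals, and orthogonality gives norm (T v) \<ge> s n * norm v, a
  contradiction.\<close>

lemma singular_values_le:
  assumes T: "T \<in> compact_ops" and "bounded_off n c T" and c: "0 \<le> c"
  shows "singular_values T n \<le> c"
proof (rule ccontr)
  assume "\<not> ?thesis"
  define s where "s = singular_values T"
  have sc: "c < s n" using \<open>\<not> _\<close> by (simp add: s_def)
  obtain e f where S: "singular_system T s e f" using singular_values_system[OF T] by (auto simp: s_def)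
  note D = singular_systemD[OF S]
  obtain \<Phi> where \<Phi>: "finite \<Phi>" "card \<Phi> \<le> n" "\<And>\<phi>. \<phi> \<in> \<Phi> \<Longrightarrow> clinear_functional \<phi>"
    "\<And>x. (\<forall>\<phi>\<in>\<Phi>. \<phi> x = 0) \<Longrightarrow> norm (T x) \<le> c * norm x"
    using assms(2) unfolding bounded_off_def by blast
  have ge: "s n \<le> s j" "s j \<noteq> 0" if "j \<le> n" for j
    using c0_starD(2)[OF D(1) that] sc c by auto
  have "\<exists>u. (\<exists>j\<in>{..n}. u j \<noteq> 0) \<and> (\<forall>\<phi>\<in>\<Phi>. (\<Sum>j\<in>{..n}. \<phi> (e j) * u j) = 0)"
    by (rule underdetermined_system) (use \<Phi> in auto)
  then obtain u where u: "\<exists>j\<le>n. u j \<noteq> 0" "\<And>\<phi>. \<phi> \<in> \<Phi> \<Longrightarrow> (\<Sum>j\<le>n. \<phi> (e j) * u j) = 0" by auto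
  define v where "v = (\<Sum>j\<le>n. cscale (u j) (e j))"
  have e1: "norm (e j) = 1" and f1: "norm (f j) = 1" if "j \<le> n" for j
    using D(2,3) D(7)[OF ge(2)[OF that]] D(8)[OF ge(2)[OF that]] by (auto simp: orthonormal_or_zero_def)
  have "\<phi> v = 0" if "\<phi> \<in> \<Phi>" for \<phi>
    using u(2)[OF that] by (simp add: v_def clinear_functional_sum[OF \<Phi>(3)[OF that]] mult.commute)
  then have le: "norm (T v) \<le> c * norm v" using \<Phi>(4) by blast
  have nv: "(norm v)\<^sup>2 = (\<Sum>j\<le>n. (cmod (u j))\<^sup>2)"
    unfolding v_def by (simp add: norm_orthogonal_sum[OF D(2)] e1)
  have "T v = (\<Sum>j\<le>n. cscale (u j * of_real (s j)) (f j))"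
  proof -
    have "T v = (\<Sum>j\<le>n. cscale (u j) (T (e j)))"
      using compact_ops_carrier[OF T] by (simp add: v_def blinfun.sum_right carrier_BH)
    also have "\<dots> = (\<Sum>j\<le>n. cscale (u j * of_real (s j)) (f j))"
    proof (intro sum.cong refl)
      fix j assume "j \<in> {..n}"
      then have "e j \<noteq> 0" using e1[of j] by auto
      then have "T (e j) = cscale (of_real (s j)) (f j)" by (simp add: D(5) diag_op_basis[OF D(4)])
      then show "cscale (u j) (T (e j)) = cscale (u j * of_real (s j)) (f j)" by (simp add: cscale_cscale)
    qed
    finally show ?thesis .
  qed
  then have "(norm (T v))\<^sup>2 = (\<Sum>j\<le>n. (cmod (u j))\<^sup>2 * (s j)\<^sup>2)"
    by (simp add: norm_orthogonal_sum[OF D(3)] f1 norm_mult power_mult_distrib)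
  moreover have "(\<Sum>j\<le>n. (cmod (u j))\<^sup>2 * (s n)\<^sup>2) \<le> (\<Sum>j\<le>n. (cmod (u j))\<^sup>2 * (s j)\<^sup>2)"
    using ge(1) c0_starD(1)[OF D(1)] by (intro sum_mono mult_left_mono power_mono) auto
  ultimately have "(s n)\<^sup>2 * (norm v)\<^sup>2 \<le> (norm (T v))\<^sup>2"
    by (simp add: nv sum_distrib_left mult.commute)
  also have "\<dots> \<le> (c * norm v)\<^sup>2" by (rule power_mono[OF le]) simp
  finally have "(s n)\<^sup>2 * (norm v)\<^sup>2 \<le> c\<^sup>2 * (norm v)\<^sup>2" by (simp add: power_mult_distrib)
  moreover have "c\<^sup>2 < (s n)\<^sup>2" using sc c by (intro power_strict_mono) auto
  moreover have "0 < (norm v)\<^sup>2"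
  proof -
    obtain j where "j \<le> n" "u j \<noteq> 0" using u(1) by blast
    then show ?thesis unfolding nv by (intro sum_pos2[of _ j]) auto
  qed
  ultimately show False by (simp add: mult_le_cancel_right)
qed

text \<open>The functionals for S and for T are imposed together; there are at most m + n of
  them.\<close>

lemma singular_values_add_le:
  assumes "S \<in> compact_ops" "T \<in> compact_ops"
  shows "singular_values (S + T) (m + n) \<le> singular_values S m + singular_values T n"
proof (rule singular_values_le[OF compact_ops_add[OF assms]])
  obtain \<Phi> where \<Phi>: "finite \<Phi>" "card \<Phi> \<le> m" "\<forall>\<phi>\<in>\<Phi>. clinear_functional \<phi>"
    "\<And>x. (\<forall>\<phi>\<in>\<Phi>. \<phi> x = 0) \<Longrightarrow> norm (S x) \<le> singular_values S m * norm x"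
    using bounded_off_singular_values[OF assms(1), of m] unfolding bounded_off_def by blast
  obtain \<Psi> where \<Psi>: "finite \<Psi>" "card \<Psi> \<le> n" "\<forall>\<phi>\<in>\<Psi>. clinear_functional \<phi>"
    "\<And>x. (\<forall>\<phi>\<in>\<Psi>. \<phi> x = 0) \<Longrightarrow> norm (T x) \<le> singular_values T n * norm x"
    using bounded_off_singular_values[OF assms(2), of n] unfolding bounded_off_def by blast
  show "bounded_off (m + n) (singular_values S m + singular_values T n) (S + T)"
    unfolding bounded_off_def
  proof (intro exI[of _ "\<Phi> \<union> \<Psi>"] conjI allI impI)
    show "card (\<Phi> \<union> \<Psi>) \<le> m + n" using card_Un_le[of \<Phi> \<Psi>] \<Phi>(2) \<Psi>(2) by linarith
    fix x assume "\<forall>\<phi>\<in>\<Phi> \<union> \<Psi>. \<phi> x = 0"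
    then show "norm ((S + T) x) \<le> (singular_values S m + singular_values T n) * norm x"
      using \<Phi>(4)[of x] \<Psi>(4)[of x] norm_triangle_ineq[of "S x" "T x"]
      by (simp add: blinfun.add_left distrib_right)
  qed (use \<Phi> \<Psi> in auto)
  show "0 \<le> singular_values S m + singular_values T n"
    using assms by (intro add_nonneg_nonneg c0_starD(1)[OF singular_values_c0_star])
qed

lemma singular_values_comp_left_le:
  assumes "T \<in> compact_ops" "A \<in> carrier BH"
  shows "singular_values (A o\<^sub>L T) n \<le> norm A * singular_values T n"
proof (rule singular_values_le[OF compact_ops_comp_left[OF assms]])
  obtain \<Phi> where \<Phi>: "finite \<Phi>" "card \<Phi> \<le> n" "\<forall>\<phi>\<in>\<Phi>. clinear_functional \<phi>"
    "\<And>x. (\<forall>\<phi>\<in>\<Phi>. \<phi> x = 0) \<Longrightarrow> norm (T x) \<le> singular_values T n * norm x"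
    using bounded_off_singular_values[OF assms(1), of n] unfolding bounded_off_def by blast
  have "norm ((A o\<^sub>L T) x) \<le> norm A * singular_values T n * norm x" if "\<forall>\<phi>\<in>\<Phi>. \<phi> x = 0" for x
    using order_trans[OF norm_blinfun mult_left_mono[OF \<Phi>(4)[OF that] norm_ge_zero]] by (simp add: mult.assoc)
  with \<Phi> show "bounded_off n (norm A * singular_values T n) (A o\<^sub>L T)" unfolding bounded_off_def by blast
  show "0 \<le> norm A * singular_values T n"
    using assms by (intro mult_nonneg_nonneg c0_starD(1)[OF singular_values_c0_star]) auto
qed

lemma singular_values_comp_right_le:
  assumes "T \<in> compact_ops" "A \<in> carrier BH"
  shows "singular_values (T o\<^sub>L A) n \<le> norm A * singular_values T n"
proof (rule singular_values_le[OF compact_ops_comp_right[OF assms]])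
  note s0 = c0_starD(1)[OF singular_values_c0_star[OF assms(1)], of n]
  obtain \<Phi> where \<Phi>: "finite \<Phi>" "card \<Phi> \<le> n" "\<forall>\<phi>\<in>\<Phi>. clinear_functional \<phi>"
    "\<And>x. (\<forall>\<phi>\<in>\<Phi>. \<phi> x = 0) \<Longrightarrow> norm (T x) \<le> singular_values T n * norm x"
    using bounded_off_singular_values[OF assms(1), of n] unfolding bounded_off_def by blast
  show "bounded_off n (norm A * singular_values T n) (T o\<^sub>L A)"
    unfolding bounded_off_def
  proof (intro exI[of _ "(\<lambda>\<phi>. \<phi> \<circ> blinfun_apply A) ` \<Phi>"] conjI allI impI)
    show "card ((\<lambda>\<phi>. \<phi> \<circ> blinfun_apply A) ` \<Phi>) \<le> n" using card_image_le[OF \<Phi>(1)] \<Phi>(2) by (rule order_trans)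
    show "\<forall>\<phi>\<in>(\<lambda>\<phi>. \<phi> \<circ> blinfun_apply A) ` \<Phi>. clinear_functional \<phi>"
      using \<Phi>(3) assms(2) by (auto simp: clinear_functional_def carrier_BH blinfun.add_right)
    fix x assume "\<forall>\<phi>\<in>(\<lambda>\<phi>. \<phi> \<circ> blinfun_apply A) ` \<Phi>. \<phi> x = 0"
    then have "norm (T (A x)) \<le> singular_values T n * norm (A x)"
      by (intro \<Phi>(4)) auto
    also have "\<dots> \<le> singular_values T n * (norm A * norm x)" by (intro mult_left_mono norm_blinfun s0)
    finally show "norm ((T o\<^sub>L A) x) \<le> norm A * singular_values T n * norm x"
      by (simp add: mult_ac)
  qed (use \<Phi> in auto)
  show "0 \<le> norm A * singular_values T n" using s0 by simp
qed

section \<open>Principal ideals\<close>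

lemma BH_simps [simp]: "mult BH = (o\<^sub>L)" "add BH = (+)" "one BH = id_blinfun" "zero BH = 0"
  by (simp_all add: BH_def)

lemma ring_BH: "ring (BH :: ('a::chilbert_space \<Rightarrow>\<^sub>L 'a) ring)"
proof (rule ringI)
  show "abelian_group (BH :: ('a \<Rightarrow>\<^sub>L 'a) ring)"
  proof (rule abelian_groupI)
    fix x :: "'a \<Rightarrow>\<^sub>L 'a" assume "x \<in> carrier BH"
    then show "\<exists>y\<in>carrier BH. y \<oplus>\<^bsub>BH\<^esub> x = \<zero>\<^bsub>BH\<^esub>"
      by (intro bexI[of _ "- x"]) (auto simp: carrier_BH blinfun.minus_left)
  qed (auto simp: carrier_BH blinfun.add_left cscale_add_right)
  show "monoid (BH :: ('a \<Rightarrow>\<^sub>L 'a) ring)"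
    by (rule monoidI) (auto simp: carrier_BH intro: blinfun_eqI)
qed (auto intro!: blinfun_eqI simp: blinfun.add_left blinfun.add_right)

lemma ideal_BH_I:
  fixes I :: "('a::chilbert_space \<Rightarrow>\<^sub>L 'a) set"
  assumes "I \<subseteq> carrier BH" "0 \<in> I" "\<And>S T. S \<in> I \<Longrightarrow> T \<in> I \<Longrightarrow> S + T \<in> I"
    "\<And>A T. T \<in> I \<Longrightarrow> A \<in> carrier BH \<Longrightarrow> A o\<^sub>L T \<in> I"
    "\<And>A T. T \<in> I \<Longrightarrow> A \<in> carrier BH \<Longrightarrow> T o\<^sub>L A \<in> I"
  shows "ideal I BH"
proof (rule idealI[OF ring_BH])
  interpret ring "BH :: ('a \<Rightarrow>\<^sub>L 'a) ring" by (rule ring_BH)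
  show "subgroup I (add_monoid BH)"
  proof (rule group.subgroupI[OF a_group])
    fix T assume T: "T \<in> I"
    have "- id_blinfun \<in> carrier (BH :: ('a \<Rightarrow>\<^sub>L 'a) ring)" by (simp add: carrier_BH blinfun.minus_left)
    then have "(- id_blinfun) o\<^sub>L T \<in> I" by (rule assms(4)[OF T])
    moreover have "(- id_blinfun) o\<^sub>L T = - T" by (rule blinfun_eqI) (simp add: blinfun.minus_left)
    ultimately have mT: "- T \<in> I" by simp
    have "\<ominus>\<^bsub>BH\<^esub> T = - T"
      by (rule minus_equality) (use T mT assms(1) in auto)
    then show "inv\<^bsub>add_monoid BH\<^esub> T \<in> I" using mT by (simp add: a_inv_def)
  qed (use assms in auto)
qed (use assms in auto)

lemma ideal_BH_D:
  assumes "ideal I BH"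
  shows "I \<subseteq> carrier BH" "0 \<in> I" "S \<in> I \<Longrightarrow> T \<in> I \<Longrightarrow> S + T \<in> I"
    "T \<in> I \<Longrightarrow> A \<in> carrier BH \<Longrightarrow> A o\<^sub>L T \<in> I" "T \<in> I \<Longrightarrow> A \<in> carrier BH \<Longrightarrow> T o\<^sub>L A \<in> I"
proof -
  interpret ideal I BH by (rule assms)
  show "I \<subseteq> carrier BH" by (rule a_subset)
  show "0 \<in> I" using additive_subgroup.zero_closed[OF is_additive_subgroup] by simp
  show "S \<in> I \<Longrightarrow> T \<in> I \<Longrightarrow> S + T \<in> I" using additive_subgroup.a_closed[OF is_additive_subgroup, of S T] by simp
  show "T \<in> I \<Longrightarrow> A \<in> carrier BH \<Longrightarrow> A o\<^sub>L T \<in> I" using I_l_closed[of T A] by simp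
  show "T \<in> I \<Longrightarrow> A \<in> carrier BH \<Longrightarrow> T o\<^sub>L A \<in> I" using I_r_closed[of T A] by simp
qed

lemma ideal_sum_mem: "ideal I BH \<Longrightarrow> (\<And>j. j \<in> A \<Longrightarrow> F j \<in> I) \<Longrightarrow> sum F A \<in> I"
  by (induction A rule: infinite_finite_induct) (auto intro: ideal_BH_D)

definition principal_ops :: "(nat \<Rightarrow> real) \<Rightarrow> ('a::chilbert_space \<Rightarrow>\<^sub>L 'a) set" where
  "principal_ops \<xi> = {T \<in> compact_ops. amp_le (singular_values T) \<xi>}"

lemma singular_values_zero: "singular_values (0 :: 'a::chilbert_space \<Rightarrow>\<^sub>L 'a) = (\<lambda>_. 0)"
proof (rule singular_values_eq)
  have d: "diag_system (\<lambda>_. 0) (\<lambda>_. 0 :: 'a) (\<lambda>_. 0)" by (auto simp: diag_system_def orthonormal_or_zero_def)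
  have "diag_op (\<lambda>_. 0) (\<lambda>_. 0 :: 'a) (\<lambda>_. 0) = 0" by (rule blinfun_eqI) (simp add: diag_op_apply[OF d])
  then show "singular_system (0 :: 'a \<Rightarrow>\<^sub>L 'a) (\<lambda>_. 0) (\<lambda>_. 0) (\<lambda>_. 0)"
    by (auto simp: singular_system_def orthonormal_or_zero_def c0_star_def antimono_def)
qed

lemma singular_values_eq_zero:
  assumes "T \<in> compact_ops" "singular_values T 0 = 0"
  shows "T = 0"
proof -
  obtain e f where S: "singular_system T (singular_values T) e f" using singular_values_system[OF assms(1)] .
  note D = singular_systemD[OF S]
  have "singular_values T n = 0" for n
    using c0_starD(2)[OF D(1), of 0 n] c0_starD(1)[OF D(1), of n] assms(2) by simp
  then have "T x = 0" for x
    using diag_op_sums[OF D(4), of x] D(5) sums_unique2[OF _ sums_zero] by simp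
  then show ?thesis by (intro blinfun_eqI) simp
qed

text \<open>Closure under sums is where ampliations enter: the value of S + T at n is at most the
  sum of the values of S and T at n div 2, and 2 * (m * k) is a common ratio for both
  bounds.\<close>

lemma ideal_principal_ops:
  assumes \<xi>: "\<xi> \<in> c0_star"
  shows "ideal (principal_ops \<xi> :: ('a::chilbert_space \<Rightarrow>\<^sub>L 'a) set) BH"
proof (rule ideal_BH_I)
  note \<xi>0 = c0_starD(1)[OF \<xi>]
  show "principal_ops \<xi> \<subseteq> carrier BH" by (auto simp: principal_ops_def dest: compact_ops_carrier)
  show "0 \<in> principal_ops \<xi>"
    by (auto simp: principal_ops_def singular_values_zero compact_ops_zero intro!: amp_le_of_le[of _ 0])
  fix S T :: "'a \<Rightarrow>\<^sub>L 'a" assume S: "S \<in> principal_ops \<xi>" and T: "T \<in> principal_ops \<xi>"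
  then have c: "S \<in> compact_ops" "T \<in> compact_ops"
    and le: "amp_le (singular_values S) \<xi>" "amp_le (singular_values T) \<xi>"
    by (auto simp: principal_ops_def)
  obtain m M where m: "0 < m" "1 \<le> M" "\<And>n. singular_values S n \<le> M * \<xi> (n div m)"
    using amp_leE[OF le(1) \<xi>0] by blast
  obtain k K where k: "0 < k" "1 \<le> K" "\<And>n. singular_values T n \<le> K * \<xi> (n div k)"
    using amp_leE[OF le(2) \<xi>0] by blast
  have "amp_le (singular_values (S + T)) \<xi>"
  proof (rule amp_leI)
    fix n
    have "singular_values (S + T) n \<le> singular_values (S + T) (n div 2 + n div 2)"
      by (rule c0_starD(2)[OF singular_values_c0_star[OF compact_ops_add[OF c]]]) simp
    also have "\<dots> \<le> singular_values S (n div 2) + singular_values T (n div 2)"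
      by (rule singular_values_add_le[OF c])
    also have "\<dots> \<le> M * \<xi> (n div 2 div m) + K * \<xi> (n div 2 div k)" by (intro add_mono m k)
    also have "\<dots> \<le> M * \<xi> (n div (2 * (m * k))) + K * \<xi> (n div (2 * (m * k)))"
      using m(1,2) k(1,2)
      by (intro add_mono mult_left_mono c0_starD(2)[OF \<xi>]) (auto simp: div_mult2_eq[symmetric] intro!: div_le_mono2)
    finally show "singular_values (S + T) n \<le> (M + K) * \<xi> (n div (2 * (m * k)))" by (simp add: distrib_right)
  qed (use m k in simp)
  with c show "S + T \<in> principal_ops \<xi>" by (simp add: principal_ops_def compact_ops_add)
next
  fix A T :: "'a \<Rightarrow>\<^sub>L 'a" assume T: "T \<in> principal_ops \<xi>" and A: "A \<in> carrier BH"
  then have c: "T \<in> compact_ops" "amp_le (singular_values T) \<xi>" by (auto simp: principal_ops_def)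
  note trans = amp_le_trans[OF _ c(2) singular_values_c0_star[OF c(1)] \<xi>]
  show "A o\<^sub>L T \<in> principal_ops \<xi>"
    unfolding principal_ops_def
    using compact_ops_comp_left[OF c(1) A] trans[OF amp_le_of_le[OF singular_values_comp_left_le[OF c(1) A]]] by simp
  show "T o\<^sub>L A \<in> principal_ops \<xi>"
    unfolding principal_ops_def
    using compact_ops_comp_right[OF c(1) A] trans[OF amp_le_of_le[OF singular_values_comp_right_le[OF c(1) A]]] by simp
qed

lemma orthonormal_or_zero_reindex:
  "orthonormal_or_zero e \<Longrightarrow> inj r \<Longrightarrow> orthonormal_or_zero (\<lambda>n. e (r n))"
  by (auto simp: orthonormal_or_zero_def inj_eq)

text \<open>
  \<open>S\<close> splits into \<open>m\<close> operators carrying the singular values of \<open>S\<close> along the residue classes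
  modulo \<open>m\<close>; each of them factors through \<open>T\<close>.
\<close>

lemma mem_ideal_of_amp_le:
  fixes S T :: "'a::chilbert_space \<Rightarrow>\<^sub>L 'a"
  assumes J: "ideal J BH" and T: "T \<in> J" "T \<in> compact_ops" and S: "S \<in> compact_ops"
    and le: "amp_le (singular_values S) (singular_values T)"
  shows "S \<in> J"
proof -
  define s where "s = singular_values S"
  define t where "t = singular_values T"
  obtain e f where "singular_system S s e f" using singular_values_system[OF S] by (auto simp: s_def)
  note DS = singular_systemD[OF this]
  obtain g h where "singular_system T t g h" using singular_values_system[OF T(2)] by (auto simp: t_def)
  note DT = singular_systemD[OF this]
  obtain m M where m: "0 < m" "1 \<le> M" "\<And>n. s n \<le> M * t (n div m)"
    using amp_leE[OF le] c0_starD(1)[OF DT(1)] unfolding s_def t_def by blast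
  define P where "P = (\<lambda>j. diag_op (\<lambda>n. s (n * m + j)) (\<lambda>n. e (n * m + j)) (\<lambda>n. f (n * m + j)))"
  have inj: "inj (\<lambda>n. n * m + j)" for j using m(1) by (auto simp: inj_def)
  have oe: "orthonormal_or_zero (\<lambda>n. e (n * m + j))" and of': "orthonormal_or_zero (\<lambda>n. f (n * m + j))" for j
    by (rule orthonormal_or_zero_reindex[OF DS(2) inj]) (rule orthonormal_or_zero_reindex[OF DS(3) inj])
  have s_bd: "\<bar>s n\<bar> \<le> s 0" for n using c0_starD(1)[OF DS(1)] c0_starD(2)[OF DS(1), of 0 n] by simp
  have dP: "diag_system (\<lambda>n. s (n * m + j)) (\<lambda>n. e (n * m + j)) (\<lambda>n. f (n * m + j))" for j
    using oe of' s_bd by (auto simp: diag_system_def)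
  have PJ: "P j \<in> J" if "j < m" for j
  proof -
    \<comment> \<open>Where t n = 0 the quotient is 0 by the convention for division, and s (n * m +
      j) vanishes too, so a n * t n recovers it everywhere.\<close>
    define a where "a = (\<lambda>n. s (n * m + j) / t n)"
    have st: "s (n * m + j) \<le> M * t n" for n using m(3)[of "n * m + j"] that by simp
    have t0: "t n = 0 \<Longrightarrow> s (n * m + j) = 0" for n
      using st[of n] c0_starD(1)[OF DS(1), of "n * m + j"] by simp
    have "\<bar>a n\<bar> \<le> M" for n
      using st[of n] c0_starD(1)[OF DS(1), of "n * m + j"] c0_starD(1)[OF DT(1), of n] m(2)
      by (cases "t n = 0") (auto simp: a_def field_simps)
    then have dA: "diag_system a h (\<lambda>n. f (n * m + j))" using of' DT(3) by (auto simp: diag_system_def)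
    \<comment> \<open>This operator carries the coefficient along e (n * m + j) over to g n; T and
      the operator with coefficients a, applied after it, produce P j.\<close>
    have dB: "diag_system (\<lambda>_. 1) (\<lambda>n. e (n * m + j)) g"
      using oe DT(2) by (auto simp: diag_system_def)
    have dTB: "diag_system t (\<lambda>n. e (n * m + j)) h"
      using oe DT(4) by (auto simp: diag_system_def)
    have eq: "(\<lambda>n. a n * t n) = (\<lambda>n. s (n * m + j))" using t0 by (auto simp: a_def)
    have "diag_op t g h o\<^sub>L diag_op (\<lambda>_. 1) (\<lambda>n. e (n * m + j)) g = diag_op (\<lambda>n. t n * 1) (\<lambda>n. e (n * m + j)) h"
      by (rule diag_op_comp[OF dB DT(4)]) (use dTB DT(7) in simp_all)
    then have TB: "T o\<^sub>L diag_op (\<lambda>_. 1) (\<lambda>n. e (n * m + j)) g = diag_op t (\<lambda>n. e (n * m + j)) h"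
      unfolding DT(5) by simp
    have "diag_op a h (\<lambda>n. f (n * m + j)) o\<^sub>L diag_op t (\<lambda>n. e (n * m + j)) h =
        diag_op (\<lambda>n. a n * t n) (\<lambda>n. e (n * m + j)) (\<lambda>n. f (n * m + j))"
      by (rule diag_op_comp[OF dTB dA]) (use dP DT(8) in \<open>simp_all add: eq\<close>)
    then have "diag_op a h (\<lambda>n. f (n * m + j)) o\<^sub>L (T o\<^sub>L diag_op (\<lambda>_. 1) (\<lambda>n. e (n * m + j)) g) = P j"
      unfolding TB P_def eq .
    then show ?thesis
      using ideal_BH_D(4)[OF J ideal_BH_D(5)[OF J T(1) diag_op_carrier[OF dB]] diag_op_carrier[OF dA]] by simp
  qed
  have "S = sum P {..<m}"
  proof (rule blinfun_eqI)
    fix x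
    define u where "u = (\<lambda>n. cscale (of_real (s n) * cinner x (e n)) (f n))"
    have "u sums S x" using diag_op_sums[OF DS(4), of x] by (simp add: u_def DS(5))
    from sums_group[OF this m(1)] have "(\<lambda>n. sum u {n * m..<n * m + m}) sums S x" .
    moreover have "(\<lambda>n. \<Sum>j<m. u (n * m + j)) sums (\<Sum>j<m. (P j) x)"
      unfolding P_def u_def by (intro sums_sum diag_op_sums dP)
    moreover have "sum u {n * m..<n * m + m} = (\<Sum>j<m. u (n * m + j))" for n
      using sum.shift_bounds_nat_ivl[of u 0 "n * m" m] by (simp add: lessThan_atLeast0 add.commute)
    ultimately show "S x = (sum P {..<m}) x"
      by (simp add: sums_unique2 blinfun.sum_left)
  qed
  then show ?thesis using ideal_sum_mem[OF J, of "{..<m}" P] PJ by simp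
qed

text \<open>One inclusion is minimality of the generated ideal, the other the factorisation of
  dominated operators through T.\<close>

lemma genideal_eq_principal_ops:
  assumes T: "T \<in> compact_ops"
  shows "genideal BH {T} = principal_ops (singular_values T)"
proof
  interpret ring BH by (rule ring_BH)
  have Tc: "T \<in> carrier BH" by (rule compact_ops_carrier[OF T])
  show "genideal BH {T} \<subseteq> principal_ops (singular_values T)"
    by (rule genideal_minimal[OF ideal_principal_ops[OF singular_values_c0_star[OF T]]])
      (auto simp: principal_ops_def T intro!: amp_le_of_le[of _ 1])
  show "principal_ops (singular_values T) \<subseteq> genideal BH {T}"
    using mem_ideal_of_amp_le[OF genideal_ideal genideal_self'[OF Tc] T] Tc by (auto simp: principal_ops_def)
qed

section \<open>Orthonormal bases and diagonal generators\<close>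

lemma maximal_orthonormal_set:
  "\<exists>S :: 'a::chilbert_space set. (\<forall>x\<in>S. norm x = 1) \<and> (\<forall>x\<in>S. \<forall>y\<in>S. x \<noteq> y \<longrightarrow> cinner x y = 0) \<and>
     (\<forall>x. (\<forall>y\<in>S. cinner x y = 0) \<longrightarrow> x = 0)"
proof -
  define \<A> where "\<A> = {S :: 'a set. (\<forall>x\<in>S. norm x = 1) \<and> (\<forall>x\<in>S. \<forall>y\<in>S. x \<noteq> y \<longrightarrow> cinner x y = 0)}"
  have "\<exists>M\<in>\<A>. \<forall>X\<in>\<A>. M \<subseteq> X \<longrightarrow> X = M"
  proof (rule subset_Zorn')
    fix C assume C: "subset.chain \<A> C"
    show "\<Union>C \<in> \<A>"
      unfolding \<A>_def
    proof (intro CollectI conjI ballI impI)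
      fix x assume "x \<in> \<Union>C"
      then show "norm x = 1" using C by (auto simp: subset.chain_def \<A>_def)
    next
      fix x y assume xy: "x \<in> \<Union>C" "y \<in> \<Union>C" "x \<noteq> y"
      then obtain X Y where X: "X \<in> C" "x \<in> X" and Y: "Y \<in> C" "y \<in> Y" by blast
      then have "X \<subseteq> Y \<or> Y \<subseteq> X" using C by (auto simp: subset.chain_def)
      then obtain Z where "Z \<in> C" "x \<in> Z" "y \<in> Z" using X Y by blast
      then show "cinner x y = 0" using C xy(3) by (auto simp: subset.chain_def \<A>_def)
    qed
  qed
  then obtain S where S: "S \<in> \<A>" and max: "\<And>X. X \<in> \<A> \<Longrightarrow> S \<subseteq> X \<Longrightarrow> X = S" by blast
  have "x = 0" if x: "\<And>y. y \<in> S \<Longrightarrow> cinner x y = 0" for x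
  proof (rule ccontr)
    assume "x \<noteq> 0"
    define u where "u = (1 / norm x) *\<^sub>R x"
    have u: "norm u = 1" using \<open>x \<noteq> 0\<close> by (simp add: u_def)
    have "cinner u y = 0" if "y \<in> S" for y
      using x[OF that] unfolding u_def cscale_of_real[symmetric] by (simp add: cinner_cscale_left)
    moreover from this have "cinner y u = 0" if "y \<in> S" for y
      using that cinner_commute_zero by blast
    ultimately have "insert u S \<in> \<A>" using S u by (auto simp: \<A>_def)
    then have "u \<in> S" using max[of "insert u S"] by blast
    then have "cinner u u = 0" using \<open>\<And>y. y \<in> S \<Longrightarrow> cinner u y = 0\<close> by blast
    then show False using u by (simp add: cinner_self)
  qed
  then show ?thesis using S by (intro exI[of _ S]) (auto simp: \<A>_def)
qed

text \<open>A maximal orthonormal set is infinite, since a finite one would span the space, and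
  countable, since its members have distance sqrt 2 and so choosing points of the dense set within
  1/2 of them is injective. Hence nat enumerates it.\<close>

lemma orthonormal_basis_exists:
  assumes separable: "\<exists>D :: 'a::chilbert_space set. countable D \<and> closure D = UNIV"
    and infinite_dimensional: "\<not> (\<exists>B :: 'a set. finite B \<and> complex_vector.span B = UNIV)"
  obtains b :: "nat \<Rightarrow> 'a::chilbert_space" where "orthonormal_basis b"
proof -
  obtain S :: "'a set" where *: "(\<forall>x\<in>S. norm x = 1) \<and> (\<forall>x\<in>S. \<forall>y\<in>S. x \<noteq> y \<longrightarrow> cinner x y = 0) \<and>
     (\<forall>x. (\<forall>y\<in>S. cinner x y = 0) \<longrightarrow> x = 0)"
    using maximal_orthonormal_set ..
  have S: "norm x = 1" "y \<in> S \<Longrightarrow> x \<noteq> y \<Longrightarrow> cinner x y = 0" if "x \<in> S" for x y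
    using * that by simp_all
  have S_max: "x = 0" if "\<And>y. y \<in> S \<Longrightarrow> cinner x y = 0" for x
    using * that by simp
  have "infinite S"
  proof
    assume fin: "finite S"
    have "x \<in> complex_vector.span S" for x
    proof -
      define p where "p = (\<Sum>y\<in>S. cscale (cinner x y) y)"
      have "cinner (x - p) z = 0" if z: "z \<in> S" for z
      proof -
        have "cinner p z = (\<Sum>y\<in>S. if y = z then cinner x z else 0)"
          unfolding p_def cinner_sum_left using S(1,2) z
          by (intro sum.cong) (auto simp: cinner_cscale_left cinner_self)
        then show ?thesis using z fin by (simp add: cinner_diff_left)
      qed
      then have "x = p" using S_max[of "x - p"] by simp
      then show ?thesis unfolding p_def
        by (metis (no_types, lifting) complex_vector.span_base complex_vector.span_scale complex_vector.span_sum)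
    qed
    with infinite_dimensional fin show False by blast
  qed
  moreover have "countable S"
  proof -
    obtain D :: "'a set" where D: "countable D" "closure D = UNIV" using separable by blast
    have "\<exists>d\<in>D. dist d x < 1 / 2" for x
      using D(2) closure_approachable[of x D] by (metis UNIV_I half_gt_zero_iff zero_less_one)
    then obtain d where d: "\<And>x. d x \<in> D" "\<And>x. dist (d x) x < 1 / 2" by metis
    have "inj_on d S"
    proof (rule inj_onI, rule ccontr)
      fix x y assume xy: "x \<in> S" "y \<in> S" "d x = d y" "x \<noteq> y"
      have "inner x y = 0" using S(2)[OF xy(1,2,4)] by (simp flip: Re_cinner)
      then have "(norm (x - y))\<^sup>2 = (norm x)\<^sup>2 + (norm y)\<^sup>2"
        unfolding power2_norm_eq_inner by (simp add: inner_diff_left inner_diff_right inner_commute)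
      then have "(dist x y)\<^sup>2 = 2" using S(1) xy by (simp add: dist_norm)
      moreover have "dist x y \<le> 1"
        using dist_triangle3[of x y "d x"] d(2)[of x] d(2)[of y] xy(3) by simp
      then have "(dist x y)\<^sup>2 \<le> 1" by (simp add: power_le_one)
      ultimately show False by simp
    qed
    moreover have "d ` S \<subseteq> D" using d(1) by blast
    ultimately show ?thesis using D(1) countable_image_inj_on countable_subset by blast
  qed
  ultimately obtain b :: "nat \<Rightarrow> 'a" where b: "bij_betw b UNIV S"
    using bij_betw_from_nat_into by blast
  have bS: "b n \<in> S" for n using b by (auto simp: bij_betw_def)
  have inj: "b i = b j \<longleftrightarrow> i = j" for i j using b by (auto simp: bij_betw_def inj_eq)
  have cin: "cinner (b i) (b j) = (if i = j then 1 else 0)" for i j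
    using S(1)[OF bS[of i]] S(2)[OF bS[of i] bS[of j]] inj[of i j] by (auto simp: cinner_self)
  have o: "orthonormal_or_zero b" using cin S(1)[OF bS] by (simp add: orthonormal_or_zero_def)
  have d: "diag_system (\<lambda>_. 1) b b" using o by (auto simp: diag_system_def)
  have "x \<in> closure (complex_vector.span (range b))" for x
  proof -
    define p where "p = (diag_op (\<lambda>_. 1) b b) x"
    have "b n \<noteq> 0" for n using S(1)[OF bS[of n]] by auto
    then have "cinner (x - p) (b n) = 0" for n
      unfolding p_def by (simp add: cinner_diff_left diag_op_cinner[OF d])
    moreover have "S = range b" using b by (simp add: bij_betw_def)
    ultimately have "x = p" using S_max[of "x - p"] by auto
    then have "(\<lambda>n. \<Sum>k<n. cscale (of_real 1 * cinner x (b k)) (b k)) \<longlonglongrightarrow> x"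
      using diag_op_sums[OF d, of x] by (simp add: sums_def p_def)
    moreover have "(\<Sum>k<n. cscale (of_real 1 * cinner x (b k)) (b k)) \<in> complex_vector.span (range b)" for n
      by (intro complex_vector.span_sum complex_vector.span_scale complex_vector.span_base) auto
    ultimately show ?thesis unfolding closure_sequential
      by (intro exI[of _ "\<lambda>n. \<Sum>k<n. cscale (of_real 1 * cinner x (b k)) (b k)"]) simp
  qed
  then have "orthonormal_basis b" unfolding orthonormal_basis_def using cin by blast
  then show thesis by (rule that)
qed

lemma orthonormal_basisD:
  assumes "orthonormal_basis b"
  shows "orthonormal_or_zero b" "b n \<noteq> 0"
proof -
  have cin: "cinner (b i) (b j) = (if i = j then 1 else 0)" for i j
    using assms by (simp add: orthonormal_basis_def)
  have "(norm (b i))\<^sup>2 = 1" for i using cin[of i i] unfolding cinner_self by (simp flip: of_real_power)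
  then have "norm (b i) = 1" for i by (simp add: power2_eq_1_iff) (metis norm_ge_zero not_one_le_zero neg_0_le_iff_le)
  then show "orthonormal_or_zero b" using cin by (simp add: orthonormal_or_zero_def)
  show "b n \<noteq> 0" using cin[of n n] by auto
qed

lemma singular_system_diag:
  assumes "orthonormal_basis b" "\<xi> \<in> c0_star"
  shows "singular_system (diag_op \<xi> b b) \<xi> b b"
  using orthonormal_basisD[OF assms(1)] assms(2) by (simp add: singular_system_def)

lemma is_diag_diag_op:
  assumes "orthonormal_basis b" "\<xi> \<in> c0_star"
  shows "is_diag \<xi> (diag_op \<xi> b b)"
proof -
  note d = singular_systemD(4)[OF singular_system_diag[OF assms]]
  show ?thesis
    unfolding is_diag_def using diag_op_carrier[OF d] diag_op_basis[OF d] assms(1) orthonormal_basisD(2)[OF assms(1)]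
    by auto
qed

text \<open>T and the series operator are continuous and agree on the dense span of a basis. That
  basis comes with T and may differ from the one fixed for the density arguments.\<close>

lemma is_diag_singular_system:
  assumes T: "is_diag \<xi> T" and \<xi>: "\<xi> \<in> c0_star"
  obtains e where "singular_system T \<xi> e e"
proof -
  obtain e where e: "orthonormal_basis e" and Te: "\<And>n. T (e n) = cscale (of_real (\<xi> n)) (e n)"
    and Tc: "T \<in> carrier BH"
    using T unfolding is_diag_def by blast
  note S = singular_system_diag[OF e \<xi>]
  note D = singular_systemD[OF S]
  have "T = diag_op \<xi> e e"
  proof (rule blinfun_eqI)
    fix x
    have "closed {x. T x = (diag_op \<xi> e e) x}"
      by (intro closed_Collect_eq continuous_intros)
    moreover have "complex_vector.span (range e) \<subseteq> {x. T x = (diag_op \<xi> e e) x}"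
    proof
      fix x assume "x \<in> complex_vector.span (range e)"
      then have "T x = (diag_op \<xi> e e) x"
      proof (induction rule: complex_vector.span_induct_alt)
        case base
        show ?case by (simp add: blinfun.zero_right)
      next
        case (step c v y)
        then obtain n where "v = e n" by auto
        then have "T v = (diag_op \<xi> e e) v"
          using Te[of n] by (simp add: diag_op_basis[OF D(4)] orthonormal_basisD(2)[OF e])
        then show ?case
          using step Tc diag_op_carrier[OF D(4)] by (simp add: blinfun.add_right carrier_BH)
      qed
      then show "x \<in> {x. T x = (diag_op \<xi> e e) x}" by simp
    qed
    ultimately have "closure (complex_vector.span (range e)) \<subseteq> {x. T x = (diag_op \<xi> e e) x}"
      by (rule closure_minimal[rotated])
    then show "T x = (diag_op \<xi> e e) x"
      using e by (auto simp: orthonormal_basis_def)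
  qed
  with S show thesis using that by blast
qed

lemma diag_op_add:
  assumes "diag_system a e f" "diag_system b e f"
  shows "diag_op a e f + diag_op b e f = diag_op (\<lambda>n. a n + b n) e f"
proof (rule blinfun_eqI)
  fix x
  obtain M N where "\<And>n. \<bar>a n\<bar> \<le> M" "\<And>n. \<bar>b n\<bar> \<le> N" using assms by (auto simp: diag_system_def)
  then have "\<bar>a n + b n\<bar> \<le> M + N" for n by (meson abs_triangle_ineq add_mono order_trans)
  then have d: "diag_system (\<lambda>n. a n + b n) e f" using assms by (auto simp: diag_system_def)
  have "(\<lambda>n. cscale (of_real (a n + b n) * cinner x (e n)) (f n)) sums
      ((diag_op a e f) x + (diag_op b e f) x)"
    using sums_add[OF diag_op_sums[OF assms(1), of x] diag_op_sums[OF assms(2), of x]]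
    by (simp add: distrib_right cscale_add_left)
  from sums_unique2[OF this diag_op_sums[OF d, of x]]
  show "(diag_op a e f + diag_op b e f) x = (diag_op (\<lambda>n. a n + b n) e f) x"
    by (simp add: blinfun.add_left)
qed

lemma c0_star_add:
  assumes "\<xi> \<in> c0_star" "\<eta> \<in> c0_star"
  shows "(\<lambda>n. \<xi> n + \<eta> n) \<in> c0_star"
proof (rule c0_starI)
  show "(\<lambda>n. \<xi> n + \<eta> n) \<longlonglongrightarrow> 0"
    using tendsto_add[OF c0_starD(3)[OF assms(1)] c0_starD(3)[OF assms(2)]] by simp
qed (simp_all add: add_mono c0_starD[OF assms(1)] c0_starD[OF assms(2)])

lemma genideal_diag_op:
  assumes "orthonormal_basis b" "\<xi> \<in> c0_star"
  shows "genideal BH {diag_op \<xi> b b} = principal_ops \<xi>"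
proof -
  note S = singular_system_diag[OF assms]
  show ?thesis using genideal_eq_principal_ops[OF singular_systemD(6)[OF S]] by (simp only: singular_values_eq[OF S])
qed

lemma diag_op_mem_principal_ops:
  assumes "orthonormal_basis b" "\<xi> \<in> c0_star"
  shows "diag_op \<xi> b b \<in> principal_ops \<eta> \<longleftrightarrow> amp_le \<xi> \<eta>"
  using singular_system_diag[OF assms] by (simp add: principal_ops_def singular_values_eq singular_systemD(6))

text \<open>Necessity is tested on the diagonal operator with diagonal \<xi>.\<close>

lemma principal_ops_subset_iff:
  fixes b :: "nat \<Rightarrow> 'a::chilbert_space"
  assumes "orthonormal_basis b" "\<xi> \<in> c0_star" "\<eta> \<in> c0_star"
  shows "(principal_ops \<xi> :: ('a \<Rightarrow>\<^sub>L 'a) set) \<subseteq> principal_ops \<eta> \<longleftrightarrow> amp_le \<xi> \<eta>"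
proof
  assume "(principal_ops \<xi> :: ('a \<Rightarrow>\<^sub>L 'a) set) \<subseteq> principal_ops \<eta>"
  then show "amp_le \<xi> \<eta>"
    using diag_op_mem_principal_ops[OF assms(1,2), of \<xi>] diag_op_mem_principal_ops[OF assms(1,2), of \<eta>] amp_le_refl
    by blast
next
  assume "amp_le \<xi> \<eta>"
  then show "(principal_ops \<xi> :: ('a \<Rightarrow>\<^sub>L 'a) set) \<subseteq> principal_ops \<eta>"
    using amp_le_trans[OF _ _ assms(2,3)] unfolding principal_ops_def by blast
qed

lemma char_set_principal_ops:
  fixes b :: "nat \<Rightarrow> 'a::chilbert_space"
  assumes b: "orthonormal_basis b"
  shows "char_set (principal_ops \<xi> :: ('a \<Rightarrow>\<^sub>L 'a) set) = {\<eta> \<in> c0_star. amp_le \<eta> \<xi>}"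
proof
  show "char_set (principal_ops \<xi> :: ('a \<Rightarrow>\<^sub>L 'a) set) \<subseteq> {\<eta> \<in> c0_star. amp_le \<eta> \<xi>}"
    by (auto simp: char_set_def principal_ops_def singular_values_c0_star)
  show "{\<eta> \<in> c0_star. amp_le \<eta> \<xi>} \<subseteq> char_set (principal_ops \<xi> :: ('a \<Rightarrow>\<^sub>L 'a) set)"
  proof clarify
    fix \<eta> assume \<eta>: "\<eta> \<in> c0_star" "amp_le \<eta> \<xi>"
    have "diag_op \<eta> b b \<in> principal_ops \<xi>" using \<eta> by (simp add: diag_op_mem_principal_ops[OF b])
    then show "\<eta> \<in> char_set (principal_ops \<xi> :: ('a \<Rightarrow>\<^sub>L 'a) set)"
      unfolding char_set_def using singular_values_eq[OF singular_system_diag[OF b \<eta>(1)]] by (metis image_eqI)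
  qed
qed

lemma principal_ops_PL:
  fixes b :: "nat \<Rightarrow> 'a::chilbert_space"
  assumes b: "orthonormal_basis b" and \<xi>: "\<xi> \<in> c0_star" "0 < \<xi> 0"
  shows "(principal_ops \<xi> :: ('a \<Rightarrow>\<^sub>L 'a) set) \<in> PL"
proof -
  let ?D = "diag_op \<xi> b b"
  note S = singular_system_diag[OF b \<xi>(1)]
  have D: "?D \<in> principal_ops \<xi>" by (simp add: diag_op_mem_principal_ops[OF b \<xi>(1)] amp_le_refl)
  have "?D \<noteq> 0" using singular_values_eq[OF S] \<xi>(2) singular_values_zero[where 'a = 'a] by auto
  then have "(principal_ops \<xi> :: ('a \<Rightarrow>\<^sub>L 'a) set) \<noteq> {0}" using D by auto
  moreover have "principalideal (principal_ops \<xi> :: ('a \<Rightarrow>\<^sub>L 'a) set) BH"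
    by (rule principalidealI[OF ideal_principal_ops[OF \<xi>(1)]])
      (use genideal_diag_op[OF b \<xi>(1)] diag_op_carrier[OF singular_systemD(4)[OF S]] in blast)
  ultimately show ?thesis
    using ideal_principal_ops[OF \<xi>(1)] by (auto simp: PL_def ideals_def principal_ops_def)
qed

lemma PL_generator:
  assumes "I \<in> PL"
  obtains T where "T \<in> compact_ops" "T \<noteq> 0" "I = genideal BH {T}" "T \<in> I"
proof -
  interpret ring BH by (rule ring_BH)
  obtain T where T: "T \<in> carrier BH" "I = genideal BH {T}"
    using assms principalideal.generate by (auto simp: PL_def)
  have TI: "T \<in> I" unfolding T(2) by (rule genideal_self'[OF T(1)])
  moreover have "T \<noteq> 0" using assms T(2) genideal_zero by (auto simp: PL_def ideals_def)
  ultimately show thesis using that[of T] T(2) assms by (auto simp: PL_def ideals_def)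
qed

lemma PL_E:
  assumes "I \<in> PL"
  obtains \<xi> where "\<xi> \<in> c0_star" "0 < \<xi> 0" "I = principal_ops \<xi>"
proof -
  obtain T where T: "T \<in> compact_ops" "T \<noteq> 0" "I = genideal BH {T}" "T \<in> I" using PL_generator[OF assms] .
  note c0 = singular_values_c0_star[OF T(1)]
  have "singular_values T 0 \<noteq> 0" using singular_values_eq_zero[OF T(1)] T(2) by blast
  then have "0 < singular_values T 0" using c0_starD(1)[OF c0, of 0] by simp
  then show thesis using that[OF c0] T(3) genideal_eq_principal_ops[OF T(1)] by simp
qed

section \<open>Lower gaps\<close>

lemma PL_has_lower_gap:
  fixes I :: "('a::chilbert_space \<Rightarrow>\<^sub>L 'a) set"
  assumes "I \<in> PL"
  shows "has_lower_gap I"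
proof -
  interpret ring "BH :: ('a \<Rightarrow>\<^sub>L 'a) ring" by (rule ring_BH)
  obtain T where T: "T \<in> compact_ops" "T \<noteq> 0" "I = genideal BH {T}" "T \<in> I" using PL_generator[OF assms] .
  have I: "ideal I BH" "I \<subseteq> compact_ops" using assms by (auto simp: PL_def ideals_def)
  \<comment> \<open>Avoiding the single element T is inherited by unions of chains, so Zorn's lemma
    applies. The zero ideal belongs to the family and may itself be maximal, which the convention
    for lower gaps admits. An ideal strictly between a maximal member and I would either contain T,
    hence all of I, or lie in the family.\<close>
  define \<A> where "\<A> = {K. ideal K BH \<and> K \<subseteq> I \<and> T \<notin> K}"
  have "{0} \<in> \<A>" using zeroideal ideal_BH_D(2)[OF I(1)] T(2) by (simp add: \<A>_def)
  then have "\<A> \<noteq> {}" by blast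
  then have "\<exists>M\<in>\<A>. \<forall>X\<in>\<A>. M \<subseteq> X \<longrightarrow> X = M"
  proof (rule subset_Zorn_nonempty)
    fix C assume C: "C \<noteq> {}" "subset.chain \<A> C"
    then have mem: "ideal K BH" "K \<subseteq> I" "T \<notin> K" if "K \<in> C" for K
      using that by (auto simp: subset.chain_def \<A>_def)
    have "ideal (\<Union>C) BH"
    proof (rule ideal_BH_I)
      show "\<Union>C \<subseteq> carrier BH" using mem(1) ideal_BH_D(1) by blast
      show "0 \<in> \<Union>C" using C(1) mem(1) ideal_BH_D(2) by blast
      show "S + S' \<in> \<Union>C" if S: "S \<in> \<Union>C" "S' \<in> \<Union>C" for S S'
      proof -
        obtain X Y where X: "X \<in> C" "S \<in> X" and Y: "Y \<in> C" "S' \<in> Y" using S by blast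
        then have "X \<subseteq> Y \<or> Y \<subseteq> X" using C by (auto simp: subset.chain_def)
        then obtain Z where "Z \<in> C" "S \<in> Z" "S' \<in> Z" using X Y by blast
        then show ?thesis using ideal_BH_D(3)[OF mem(1)] by blast
      qed
      show "A o\<^sub>L S \<in> \<Union>C" "S o\<^sub>L A \<in> \<Union>C" if "S \<in> \<Union>C" "A \<in> carrier BH" for A S
        using that ideal_BH_D(4,5)[OF mem(1)] by blast+
    qed
    then show "\<Union>C \<in> \<A>" using mem by (auto simp: \<A>_def)
  qed
  then obtain J where J: "J \<in> \<A>" and max: "\<And>K. K \<in> \<A> \<Longrightarrow> J \<subseteq> K \<Longrightarrow> K = J" by blast
  have "\<not> (\<exists>K\<in>ideals. J \<subset> K \<and> K \<subset> I)"
  proof (rule notI, elim bexE conjE)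
    fix K assume K: "K \<in> ideals" "J \<subset> K" "K \<subset> I"
    then have "ideal K BH" by (simp add: ideals_def)
    moreover have "T \<notin> K"
    proof
      assume "T \<in> K"
      then have "I \<subseteq> K" unfolding T(3) by (intro genideal_minimal[OF \<open>ideal K BH\<close>]) simp
      with K show False by blast
    qed
    ultimately have "K \<in> \<A>" using K by (auto simp: \<A>_def)
    with max[of K] K show False by blast
  qed
  moreover have "J \<subset> I" using J T(4) by (auto simp: \<A>_def)
  moreover have "J \<in> ideals \<or> J = {0}" using J I(2) by (auto simp: \<A>_def ideals_def)
  ultimately show ?thesis unfolding has_lower_gap_def by blast
qed

section \<open>Upper density\<close>

lemma larger_ideal_sequence:
  fixes J :: "('a::chilbert_space \<Rightarrow>\<^sub>L 'a) set"
  assumes b: "orthonormal_basis (b :: nat \<Rightarrow> 'a)" and \<xi>: "\<xi> \<in> c0_star"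
    and J: "J \<in> ideals" "principal_ops \<xi> \<subset> J"
  obtains \<rho> where "\<rho> \<in> c0_star" "\<And>n. \<xi> n \<le> \<rho> n" "\<not> amp_le \<rho> \<xi>" "principal_ops \<rho> \<subseteq> J"
proof -
  interpret ring "BH :: ('a \<Rightarrow>\<^sub>L 'a) ring" by (rule ring_BH)
  have id: "ideal J BH" "J \<subseteq> compact_ops" using J(1) by (auto simp: ideals_def)
  obtain S where S: "S \<in> J" "S \<notin> principal_ops \<xi>" using J(2) by blast
  have Sc: "S \<in> compact_ops" using S(1) id(2) by blast
  define \<eta> where "\<eta> = singular_values S"
  have \<eta>: "\<eta> \<in> c0_star" unfolding \<eta>_def by (rule singular_values_c0_star[OF Sc])
  \<comment> \<open>Adding \<xi> makes \<rho> \<ge> \<xi> pointwise; both summands are diagonal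
    operators in the same basis, so their sum is diagonal and lies in J.\<close>
  define \<rho> where "\<rho> = (\<lambda>n. \<xi> n + \<eta> n)"
  have \<rho>: "\<rho> \<in> c0_star" unfolding \<rho>_def by (rule c0_star_add[OF \<xi> \<eta>])
  note D = singular_system_diag[OF b]
  have "diag_op \<eta> b b \<in> J"
    by (rule mem_ideal_of_amp_le[OF id(1) S(1) Sc singular_systemD(6)[OF D[OF \<eta>]]])
      (simp only: singular_values_eq[OF D[OF \<eta>]] \<eta>_def[symmetric] amp_le_refl)
  moreover have "diag_op \<xi> b b \<in> J"
    using J(2) diag_op_mem_principal_ops[OF b \<xi>, of \<xi>] amp_le_refl by blast
  ultimately have "diag_op \<xi> b b + diag_op \<eta> b b \<in> J" by (intro ideal_BH_D(3)[OF id(1)])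
  then have "diag_op \<rho> b b \<in> J"
    unfolding \<rho>_def diag_op_add[OF singular_systemD(4)[OF D[OF \<xi>]] singular_systemD(4)[OF D[OF \<eta>]]] .
  then have "principal_ops \<rho> \<subseteq> J"
    unfolding genideal_diag_op[OF b \<rho>, symmetric] by (intro genideal_minimal[OF id(1)]) simp
  moreover have "\<not> amp_le \<rho> \<xi>"
  proof
    assume "amp_le \<rho> \<xi>"
    moreover have "amp_le \<eta> \<rho>" by (rule amp_le_of_le[of _ 1]) (simp add: \<rho>_def c0_starD(1)[OF \<xi>])
    ultimately have "amp_le \<eta> \<xi>"
      by (rule amp_le_trans[OF _ _ \<rho> \<xi>, rotated])
    then show False using S(2) Sc by (simp add: principal_ops_def \<eta>_def)
  qed
  moreover have "\<xi> n \<le> \<rho> n" for n by (simp add: \<rho>_def c0_starD(1)[OF \<eta>])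
  ultimately show thesis using that[OF \<rho>] by blast
qed

text \<open>The only ingredient of density that depends on the lattice. It asks nothing about
  strictness below the larger ideal, because \<tau> \<le> \<sigma> inherits that from
  \<sigma>.\<close>

definition minorants_in :: "('a::chilbert_space \<Rightarrow>\<^sub>L 'a) set set \<Rightarrow> (nat \<Rightarrow> real) \<Rightarrow> bool" where
  "minorants_in L \<xi> \<longleftrightarrow> (\<forall>\<sigma>\<in>c0_star. (\<forall>n. \<xi> n \<le> \<sigma> n) \<and> \<not> amp_le \<sigma> \<xi> \<longrightarrow>
     (\<exists>\<tau>\<in>c0_star. (\<forall>n. \<tau> n \<le> \<sigma> n) \<and> amp_le \<xi> \<tau> \<and> \<not> amp_le \<tau> \<xi> \<and> principal_ops \<tau> \<in> L))"

lemma upper_dense_of_minorants: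
  fixes L :: "('a::chilbert_space \<Rightarrow>\<^sub>L 'a) set set"
  assumes b: "orthonormal_basis (b :: nat \<Rightarrow> 'a)"
    and L: "\<And>I. I \<in> L \<Longrightarrow> \<exists>\<xi>\<in>c0_star. 0 < \<xi> 0 \<and> I = principal_ops \<xi> \<and> minorants_in L \<xi>"
  shows "upper_dense L ideals"
  unfolding upper_dense_def
proof (intro ballI impI)
  fix I J assume I: "I \<in> L" and J: "J \<in> ideals" "I \<subset> J"
  obtain \<xi> where \<xi>: "\<xi> \<in> c0_star" "0 < \<xi> 0" "I = principal_ops \<xi>" and m: "minorants_in L \<xi>"
    using L[OF I] by blast
  obtain \<rho> where \<rho>: "\<rho> \<in> c0_star" "\<And>n. \<xi> n \<le> \<rho> n" "\<not> amp_le \<rho> \<xi>" "principal_ops \<rho> \<subseteq> J"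
    using larger_ideal_sequence[OF b \<xi>(1) J(1)] J(2) \<xi>(3) by blast
  obtain \<sigma> where \<sigma>: "\<sigma> \<in> c0_star" "\<And>n. \<xi> n \<le> \<sigma> n" "\<And>n. \<sigma> n \<le> \<rho> n" "\<not> amp_le \<sigma> \<xi>" "\<not> amp_le \<rho> \<sigma>"
    using strictly_between_sequence[OF \<xi>(1) \<rho>(1) \<xi>(2) \<rho>(2,3)] by blast
  obtain \<tau> where \<tau>: "\<tau> \<in> c0_star" "\<And>n. \<tau> n \<le> \<sigma> n" "amp_le \<xi> \<tau>" "\<not> amp_le \<tau> \<xi>" "principal_ops \<tau> \<in> L"
    using m \<sigma>(1,2,4) unfolding minorants_in_def by blast
  have "amp_le \<tau> \<sigma>" by (rule amp_le_of_le[of _ 1]) (simp add: \<tau>(2))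
  then have n: "\<not> amp_le \<rho> \<tau>"
    using \<sigma>(5) amp_le_trans[OF _ _ \<tau>(1) \<sigma>(1)] by blast
  have "amp_le \<tau> \<rho>" by (rule amp_le_of_le[of _ 1]) (use order_trans[OF \<tau>(2) \<sigma>(3)] in simp)
  note iff = principal_ops_subset_iff[OF b]
  show "\<exists>K\<in>L. I \<subset> K \<and> K \<subset> J"
  proof (intro bexI[OF _ \<tau>(5)] conjI)
    show "I \<subset> principal_ops \<tau>"
      unfolding \<xi>(3) less_le_not_le using iff[OF \<xi>(1) \<tau>(1)] iff[OF \<tau>(1) \<xi>(1)] \<tau>(3,4) by blast
    show "principal_ops \<tau> \<subset> J"
      using iff[OF \<tau>(1) \<rho>(1)] iff[OF \<rho>(1) \<tau>(1)] n \<open>amp_le \<tau> \<rho>\<close> \<rho>(4) by blast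
  qed
qed

lemma amp_le_pos:
  assumes "amp_le \<xi> \<tau>" "\<tau> \<in> c0_star" "0 < \<xi> 0"
  shows "0 < \<tau> 0"
proof -
  obtain m M where "0 < m" "1 \<le> M" "\<And>n. \<xi> n \<le> M * \<tau> (n div m)"
    using amp_leE[OF assms(1) c0_starD(1)[OF assms(2)]] by blast
  from this(2) this(3)[of 0] assms(3) have "0 < M * \<tau> 0" "1 \<le> M" by auto
  then show ?thesis by (simp add: zero_less_mult_iff)
qed

text \<open>No condition is put on generators here, so \<sigma> itself serves as the
  minorant.\<close>

lemma upper_dense_PL:
  assumes b: "orthonormal_basis (b :: nat \<Rightarrow> 'a::chilbert_space)"
  shows "upper_dense (PL :: ('a \<Rightarrow>\<^sub>L 'a) set set) ideals"
proof (rule upper_dense_of_minorants[OF b])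
  fix I :: "('a \<Rightarrow>\<^sub>L 'a) set" assume "I \<in> PL"
  then obtain \<xi> where \<xi>: "\<xi> \<in> c0_star" "0 < \<xi> 0" "I = principal_ops \<xi>" by (rule PL_E)
  have "minorants_in (PL :: ('a \<Rightarrow>\<^sub>L 'a) set set) \<xi>"
    unfolding minorants_in_def
  proof (intro ballI impI, elim conjE)
    fix \<sigma> assume \<sigma>: "\<sigma> \<in> c0_star" "\<forall>n. \<xi> n \<le> \<sigma> n" "\<not> amp_le \<sigma> \<xi>"
    have le: "amp_le \<xi> \<sigma>" by (rule amp_le_of_le[of _ 1]) (use \<sigma>(2) in simp)
    then show "\<exists>\<tau>\<in>c0_star. (\<forall>n. \<tau> n \<le> \<sigma> n) \<and> amp_le \<xi> \<tau> \<and> \<not> amp_le \<tau> \<xi> \<and>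
        (principal_ops \<tau> :: ('a \<Rightarrow>\<^sub>L 'a) set) \<in> PL"
      using \<sigma> principal_ops_PL[OF b \<sigma>(1) amp_le_pos[OF le \<sigma>(1) \<xi>(2)]] by (intro bexI[OF _ \<sigma>(1)]) simp
  qed
  with \<xi>(2,3) show "\<exists>\<xi>\<in>c0_star. 0 < \<xi> 0 \<and> I = principal_ops \<xi> \<and> minorants_in (PL :: ('a \<Rightarrow>\<^sub>L 'a) set set) \<xi>" by (intro bexI[OF _ \<xi>(1)] conjI)
qed

lemma upper_dense_Delta_half_PL:
  assumes b: "orthonormal_basis (b :: nat \<Rightarrow> 'a::chilbert_space)"
  shows "upper_dense (Delta_half_PL :: ('a \<Rightarrow>\<^sub>L 'a) set set) ideals"
proof (rule upper_dense_of_minorants[OF b])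
  fix I :: "('a \<Rightarrow>\<^sub>L 'a) set" assume I: "I \<in> Delta_half_PL"
  then obtain \<xi> T where \<xi>: "\<xi> \<in> c0_star" and T: "is_diag \<xi> T" "I = genideal BH {T}"
    and dom: "dominated (ampliation 2 \<xi>) \<xi>" and PL: "I \<in> PL"
    by (auto simp: Delta_half_PL_def is_generator_def)
  obtain e where S: "singular_system T \<xi> e e" using is_diag_singular_system[OF T(1) \<xi>] .
  have I_eq: "I = principal_ops \<xi>"
    using genideal_eq_principal_ops[OF singular_systemD(6)[OF S]] T(2) by (simp add: singular_values_eq[OF S])
  \<comment> \<open>The generator named in the definition is only known to lie in
    \<open>c0_star\<close>; it is nonzero because an ampliation of it dominates the nonzero
    generator \<zeta> of the same ideal.\<close>
  have pos: "0 < \<xi> 0"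
  proof -
    obtain \<zeta> where \<zeta>: "\<zeta> \<in> c0_star" "0 < \<zeta> 0" "I = principal_ops \<zeta>" using PL_E[OF PL] .
    then have "amp_le \<zeta> \<xi>" using principal_ops_subset_iff[OF b \<zeta>(1) \<xi>] I_eq by blast
    then show ?thesis using \<xi> \<zeta>(2) by (rule amp_le_pos)
  qed
  obtain C where C: "\<And>n. \<xi> (n div 2) \<le> C * \<xi> n" using dom by (auto simp: dominated_def ampliation_def)
  define B where "B = max 1 C"
  have "\<xi> (n div 2) \<le> B * \<xi> n" for n
    using order_trans[OF C mult_right_mono[OF _ c0_starD(1)[OF \<xi>], of C B]] by (simp add: B_def)
  then have reg: "\<xi> (n div 2 ^ j) \<le> 1 * B ^ j * \<xi> n" for j n
    using ampliation_power_le[of \<xi> B n j] by (simp add: B_def)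
  have "minorants_in (Delta_half_PL :: ('a \<Rightarrow>\<^sub>L 'a) set set) \<xi>"
    unfolding minorants_in_def
  proof (intro ballI impI, elim conjE)
    fix \<sigma> assume \<sigma>: "\<sigma> \<in> c0_star" "\<forall>n. \<xi> n \<le> \<sigma> n" "\<not> amp_le \<sigma> \<xi>"
    \<comment> \<open>Any constant is good enough for the \<Delta>-condition, so B + 1 can be taken
      as the relaxed bound.\<close>
    obtain \<tau> where \<tau>: "\<tau> \<in> c0_star" "\<And>n. \<tau> n \<le> \<sigma> n" "amp_le \<xi> \<tau>" "\<not> amp_le \<tau> \<xi>"
      and step: "\<And>n. \<tau> (n div 2) \<le> (B + 1) * \<tau> n"
      using regular_minorant[OF \<xi> \<sigma>(1) pos _ \<sigma>(3) _ _ reg, of "B + 1"] \<sigma>(2) by (auto simp: B_def)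
    have "(principal_ops \<tau> :: ('a \<Rightarrow>\<^sub>L 'a) set) \<in> PL"
      by (rule principal_ops_PL[OF b \<tau>(1) amp_le_pos[OF \<tau>(3) \<tau>(1) pos]])
    moreover have "is_generator \<tau> (principal_ops \<tau> :: ('a \<Rightarrow>\<^sub>L 'a) set)"
      unfolding is_generator_def using \<tau>(1) is_diag_diag_op[OF b \<tau>(1)] genideal_diag_op[OF b \<tau>(1)] by blast
    moreover have "dominated (ampliation 2 \<tau>) \<tau>" using step by (auto simp: dominated_def ampliation_def)
    ultimately have "(principal_ops \<tau> :: ('a \<Rightarrow>\<^sub>L 'a) set) \<in> Delta_half_PL"
      unfolding Delta_half_PL_def by blast
    then show "\<exists>\<tau>\<in>c0_star. (\<forall>n. \<tau> n \<le> \<sigma> n) \<and> amp_le \<xi> \<tau> \<and> \<not> amp_le \<tau> \<xi> \<and>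
        (principal_ops \<tau> :: ('a \<Rightarrow>\<^sub>L 'a) set) \<in> Delta_half_PL"
      using \<tau>(2-4) by (intro bexI[OF _ \<tau>(1)] conjI allI)
  qed
  with pos I_eq show "\<exists>\<xi>\<in>c0_star. 0 < \<xi> 0 \<and> I = principal_ops \<xi> \<and> minorants_in (Delta_half_PL :: ('a \<Rightarrow>\<^sub>L 'a) set set) \<xi>" by (intro bexI[OF _ \<xi>] conjI)
qed

lemma upper_dense_SPL:
  assumes b: "orthonormal_basis (b :: nat \<Rightarrow> 'a::chilbert_space)"
  shows "upper_dense (SPL :: ('a \<Rightarrow>\<^sub>L 'a) set set) ideals"
proof (rule upper_dense_of_minorants[OF b])
  fix I :: "('a \<Rightarrow>\<^sub>L 'a) set" assume I: "I \<in> SPL"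
  then obtain \<xi> where \<xi>: "\<xi> \<in> c0_star" "0 < \<xi> 0" "I = principal_ops \<xi>" by (auto simp: SPL_def elim: PL_E)
  have am: "I = pre_am I" using I by (simp add: SPL_def)
  \<comment> \<open>Stability is evaluated at the generator itself.\<close>
  have "diag_op \<xi> b b \<in> pre_am I"
    unfolding am[symmetric] unfolding \<xi>(3) by (simp add: diag_op_mem_principal_ops[OF b \<xi>(1)] amp_le_refl)
  then have "amp_le (arith_mean \<xi>) \<xi>"
    unfolding \<xi>(3) pre_am_def ideal_of_char_set_def char_set_principal_ops[OF b]
    by (simp add: singular_values_eq[OF singular_system_diag[OF b \<xi>(1)]])
  then obtain C where C: "1 \<le> C" "\<And>n. arith_mean \<xi> n \<le> C * \<xi> n"
    using arith_mean_bound_of_amp_le[OF \<xi>(1)] by blast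
  obtain B where B: "1 \<le> B" "B < 2" and reg: "\<And>j n. \<xi> (n div 2 ^ j) \<le> C * B ^ j * \<xi> n"
    using arith_mean_bound_imp_regular[OF \<xi>(1) C] by blast
  \<comment> \<open>The midpoint of B and 2 leaves room above the bound of \<xi> and stays below the
    threshold for am-stability.\<close>
  define B' where "B' = (B + 2) / 2"
  have B': "1 \<le> B'" "B < B'" "B' < 2" using B by (auto simp: B'_def)
  have "minorants_in (SPL :: ('a \<Rightarrow>\<^sub>L 'a) set set) \<xi>"
    unfolding minorants_in_def
  proof (intro ballI impI, elim conjE)
    fix \<sigma> assume \<sigma>: "\<sigma> \<in> c0_star" "\<forall>n. \<xi> n \<le> \<sigma> n" "\<not> amp_le \<sigma> \<xi>"
    obtain \<tau> where \<tau>: "\<tau> \<in> c0_star" "\<And>n. \<tau> n \<le> \<sigma> n" "amp_le \<xi> \<tau>" "\<not> amp_le \<tau> \<xi>"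
      and step: "\<And>n. \<tau> (n div 2) \<le> B' * \<tau> n"
      using regular_minorant[OF \<xi>(1) \<sigma>(1) \<xi>(2) _ \<sigma>(3) B(1) B'(2) reg] \<sigma>(2) by blast
    have "(principal_ops \<tau> :: ('a \<Rightarrow>\<^sub>L 'a) set) \<in> PL"
      by (rule principal_ops_PL[OF b \<tau>(1) amp_le_pos[OF \<tau>(3) \<tau>(1) \<xi>(2)]])
    moreover have "(principal_ops \<tau> :: ('a \<Rightarrow>\<^sub>L 'a) set) = pre_am (principal_ops \<tau>)"
    proof -
      \<comment> \<open>This is the equality of the two ideals on the level of singular values;
        \<open>c0_star\<close> occurs because characteristic sets consist of such sequences.\<close>
      have "amp_le \<eta> \<tau> \<longleftrightarrow> arith_mean \<eta> \<in> c0_star \<and> amp_le (arith_mean \<eta>) \<tau>" if \<eta>: "\<eta> \<in> c0_star" for \<eta>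
      proof
        assume "amp_le \<eta> \<tau>"
        with step have am: "amp_le (arith_mean \<eta>) \<tau>" by (rule amp_le_arith_mean[OF \<tau>(1) B'(1,3)])
        then have "arith_mean \<eta> \<in> c0_star"
          by (intro amp_le_c0_star[OF _ _ am \<tau>(1)] arith_mean_nonneg[OF \<eta>] arith_mean_antimono[OF \<eta>])
        with am show "arith_mean \<eta> \<in> c0_star \<and> amp_le (arith_mean \<eta>) \<tau>" by blast
      next
        assume am: "arith_mean \<eta> \<in> c0_star \<and> amp_le (arith_mean \<eta>) \<tau>"
        have "amp_le \<eta> (arith_mean \<eta>)"
          by (rule amp_le_of_le[of _ 1]) (simp add: le_arith_mean[OF \<eta>])
        then show "amp_le \<eta> \<tau>" using am amp_le_trans[OF _ _ _ \<tau>(1)] by blast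
      qed
      then show ?thesis
        unfolding pre_am_def ideal_of_char_set_def char_set_principal_ops[OF b]
        by (auto simp: principal_ops_def singular_values_c0_star)
    qed
    ultimately have "(principal_ops \<tau> :: ('a \<Rightarrow>\<^sub>L 'a) set) \<in> SPL"
      unfolding SPL_def by blast
    then show "\<exists>\<tau>\<in>c0_star. (\<forall>n. \<tau> n \<le> \<sigma> n) \<and> amp_le \<xi> \<tau> \<and> \<not> amp_le \<tau> \<xi> \<and>
        (principal_ops \<tau> :: ('a \<Rightarrow>\<^sub>L 'a) set) \<in> SPL"
      using \<tau>(2-4) by (intro bexI[OF _ \<tau>(1)] conjI allI)
  qed
  with \<xi>(2,3) show "\<exists>\<xi>\<in>c0_star. 0 < \<xi> 0 \<and> I = principal_ops \<xi> \<and> minorants_in (SPL :: ('a \<Rightarrow>\<^sub>L 'a) set set) \<xi>" by (intro bexI[OF _ \<xi>(1)] conjI)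
qed

lemma upper_dense_S_inf_PL:
  assumes b: "orthonormal_basis (b :: nat \<Rightarrow> 'a::chilbert_space)"
  shows "upper_dense (S_inf_PL :: ('a \<Rightarrow>\<^sub>L 'a) set set) ideals"
proof (rule upper_dense_of_minorants[OF b])
  fix I :: "('a \<Rightarrow>\<^sub>L 'a) set" assume I: "I \<in> S_inf_PL"
  then obtain \<xi> where \<xi>: "\<xi> \<in> c0_star" "0 < \<xi> 0" "I = principal_ops \<xi>" by (auto simp: S_inf_PL_def elim: PL_E)
  have am: "I = pre_am_inf I" using I by (simp add: S_inf_PL_def)
  have "diag_op \<xi> b b \<in> pre_am_inf I"
    unfolding am[symmetric] unfolding \<xi>(3) by (simp add: diag_op_mem_principal_ops[OF b \<xi>(1)] amp_le_refl)
  then have l1: "\<xi> \<in> l1_star" and "amp_le (arith_mean_inf \<xi>) \<xi>"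
    unfolding \<xi>(3) pre_am_inf_def ideal_of_char_set_def char_set_principal_ops[OF b]
    by (simp_all add: singular_values_eq[OF singular_system_diag[OF b \<xi>(1)]])
  then obtain C where C: "1 \<le> C" "\<And>n. (\<Sum>i. \<xi> (i + (n + 1))) \<le> C * real (n + 1) * \<xi> n"
    using arith_mean_inf_bound_of_amp_le by blast
  obtain B M where B: "0 < B" "B < 1 / 2" and dec: "\<And>j n. \<xi> (2 ^ j * (n + 1) - 1) \<le> M * B ^ j * \<xi> n"
    using arith_mean_inf_bound_imp_decaying[OF l1 C] by blast
  \<comment> \<open>The midpoint of B and 1/2: above the decay rate of \<xi>, yet below the
    threshold at which summability could be lost.\<close>
  define B' where "B' = (B + 1 / 2) / 2"
  have B': "0 < B'" "B < B'" "B' < 1 / 2" "B' < 1" using B by (auto simp: B'_def)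
  have "minorants_in (S_inf_PL :: ('a \<Rightarrow>\<^sub>L 'a) set set) \<xi>"
    unfolding minorants_in_def
  proof (intro ballI impI, elim conjE)
    fix \<sigma> assume \<sigma>: "\<sigma> \<in> c0_star" "\<forall>n. \<xi> n \<le> \<sigma> n" "\<not> amp_le \<sigma> \<xi>"
    obtain \<tau> where \<tau>: "\<tau> \<in> c0_star" "\<And>n. \<tau> n \<le> \<sigma> n" "amp_le \<xi> \<tau>" "\<not> amp_le \<tau> \<xi>"
      and step: "\<And>n. \<tau> (2 * n + 1) \<le> B' * \<tau> n"
      using decaying_minorant[OF \<xi>(1) \<sigma>(1) \<xi>(2) _ \<sigma>(3) B(1) B'(2,4) dec] \<sigma>(2) by blast
    have pos: "0 < \<tau> 0" by (rule amp_le_pos[OF \<tau>(3) \<tau>(1) \<xi>(2)])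
    have "(principal_ops \<tau> :: ('a \<Rightarrow>\<^sub>L 'a) set) \<in> PL" by (rule principal_ops_PL[OF b \<tau>(1) pos])
    moreover have "(principal_ops \<tau> :: ('a \<Rightarrow>\<^sub>L 'a) set) = pre_am_inf (principal_ops \<tau>)"
    proof -
      have sm: "\<tau> \<in> l1_star" "(\<Sum>i. \<tau> (i + (n + 1))) \<le> 1 / (1 - 2 * B') * real (n + 1) * \<tau> n" for n
        using decaying_imp_summable[OF \<tau>(1) B'(1,3)] step by blast+
      have "amp_le \<eta> \<tau> \<longleftrightarrow> \<eta> \<in> l1_star \<and> arith_mean_inf \<eta> \<in> c0_star \<and> amp_le (arith_mean_inf \<eta>) \<tau>"
        if \<eta>: "\<eta> \<in> c0_star" for \<eta>
      proof
        assume "amp_le \<eta> \<tau>"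
        note am = amp_le_arith_mean_inf[OF sm(1) _ \<eta> this, of "1 / (1 - 2 * B')"]
        have "\<eta> \<in> l1_star" "amp_le (arith_mean_inf \<eta>) \<tau>"
          by (rule am(1), rule sm(2)) (rule am(2), rule sm(2))
        moreover from this have "arith_mean_inf \<eta> \<in> c0_star"
          by (intro amp_le_c0_star[OF _ _ _ \<tau>(1), of "arith_mean_inf \<eta>"] arith_mean_inf_nonneg arith_mean_inf_antimono)
        ultimately show "\<eta> \<in> l1_star \<and> arith_mean_inf \<eta> \<in> c0_star \<and> amp_le (arith_mean_inf \<eta>) \<tau>" by blast
      next
        assume am: "\<eta> \<in> l1_star \<and> arith_mean_inf \<eta> \<in> c0_star \<and> amp_le (arith_mean_inf \<eta>) \<tau>"
        show "amp_le \<eta> \<tau>" by (rule amp_le_of_arith_mean_inf[OF _ \<tau>(1) pos]) (use am in simp_all)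
      qed
      then show ?thesis
        unfolding pre_am_inf_def ideal_of_char_set_def char_set_principal_ops[OF b]
        by (auto simp: principal_ops_def singular_values_c0_star)
    qed
    ultimately have "(principal_ops \<tau> :: ('a \<Rightarrow>\<^sub>L 'a) set) \<in> S_inf_PL"
      unfolding S_inf_PL_def by blast
    then show "\<exists>\<tau>\<in>c0_star. (\<forall>n. \<tau> n \<le> \<sigma> n) \<and> amp_le \<xi> \<tau> \<and> \<not> amp_le \<tau> \<xi> \<and>
        (principal_ops \<tau> :: ('a \<Rightarrow>\<^sub>L 'a) set) \<in> S_inf_PL"
      using \<tau>(2-4) by (intro bexI[OF _ \<tau>(1)] conjI allI)
  qed
  with \<xi>(2,3) show "\<exists>\<xi>\<in>c0_star. 0 < \<xi> 0 \<and> I = principal_ops \<xi> \<and> minorants_in (S_inf_PL :: ('a \<Rightarrow>\<^sub>L 'a) set set) \<xi>" by (intro bexI[OF _ \<xi>(1)] conjI)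
qed

theorem corollary3p14:
  assumes separable: "\<exists>D :: 'a::chilbert_space set. countable D \<and> closure D = UNIV"
    and infinite_dimensional: "\<not> (\<exists>B :: 'a set. finite B \<and> complex_vector.span B = UNIV)"
  shows "(\<forall>L' \<in> {PL :: ('a \<Rightarrow>\<^sub>L 'a) set set, Delta_half_PL, SPL, S_inf_PL}.
            upper_dense L' ideals \<and> (\<forall>I\<in>L'. has_lower_gap I)) \<and>
         (\<forall>L' \<in> {PL :: ('a \<Rightarrow>\<^sub>L 'a) set set, Delta_half_PL, SPL, S_inf_PL}.
            \<not> (\<exists>I J. is_gap L' I J))"
proof -
  obtain b :: "nat \<Rightarrow> 'a" where b: "orthonormal_basis b"
    using orthonormal_basis_exists[OF separable infinite_dimensional] .
  have dense: "upper_dense L' ideals"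
    and sub: "L' \<subseteq> PL" if "L' \<in> {PL :: ('a \<Rightarrow>\<^sub>L 'a) set set, Delta_half_PL, SPL, S_inf_PL}" for L'
    using that upper_dense_PL[OF b] upper_dense_Delta_half_PL[OF b] upper_dense_SPL[OF b] upper_dense_S_inf_PL[OF b]
    by (auto simp: Delta_half_PL_def SPL_def S_inf_PL_def)
  \<comment> \<open>Both ends of a gap lie in L', which is contained in \<open>ideals\<close>, so
    upper density already excludes gaps.\<close>
  have no_gap: "\<not> (\<exists>I J. is_gap L' I J)" if "L' \<in> {PL :: ('a \<Rightarrow>\<^sub>L 'a) set set, Delta_half_PL, SPL, S_inf_PL}" for L'
  proof -
    have "L' \<subseteq> ideals" using sub[OF that] by (auto simp: PL_def)
    then show ?thesis using dense[OF that] unfolding upper_dense_def is_gap_def by blast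
  qed
  have lower_gap: "has_lower_gap I"
    if "L' \<in> {PL :: ('a \<Rightarrow>\<^sub>L 'a) set set, Delta_half_PL, SPL, S_inf_PL}" "I \<in> L'" for L' I
    using sub[OF that(1)] that(2) by (intro PL_has_lower_gap) blast
  show ?thesis by (intro conjI ballI dense lower_gap no_gap; assumption)
qed

end
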